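(* Let $\overline{N}_2(s,3,n)$ denote the number of overpartitions of $n$ whose $M_2$-rank is congruent to $s$ modulo $3$, and for $d\in\{0,1,2\}$ set $$R_{01}(d)=\sum_{n\ge 0}\bigl(\overline{N}_2(0,3,3n+d)-\overline{N}_2(1,3,3n+d)\bigr)q^n .$$ Then, as formal power series (equivalently for $|q|<1$), $$R_{01}(0) = -1 + \frac{(-q)_\infty (q^3;q^3)_\infty^2}{(q)_\infty(-q^3;q^3)_\infty^2},$$ $$R_{01}(1) = \frac{2(q^3;q^3)_\infty (q^6;q^6)_\infty}{(q)_\infty},$$ $$R_{01}(2) = \frac{4(q^6;q^6)_\infty^4}{(q^2;q^2)_\infty (q^3;q^3)_\infty^2} + \frac{6q(-q^3;q^3)_\infty}{(q^3;q^3)_\infty}\sum_{n\in\mathbb{Z}}\frac{(-1)^n q^{3n^2+6n}}{1-q^{6n+2}}.$$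
   Context: Notation: $(a_1,\dots,a_j;q)_\infty=\prod_{k\ge 0}(1-a_1q^k)\cdots(1-a_jq^k)$, and $(q)_\infty=(q;q)_\infty$, $(-q)_\infty=(-q;q)_\infty$. An overpartition of $n$ is a partition of $n$ in which the first occurrence of each distinct part may (or may not) be overlined. For an overpartition $\lambda$, let $\ell(\lambda)$ be its largest part, $n(\lambda)$ its number of parts, $\lambda_o$ the subpartition consisting of the odd non-overlined parts, and $\chi(\lambda)=1$ if the largest part of $\lambda$ is odd and non-overlined, $\chi(\lambda)=0$ otherwise. The $M_2$-rank of $\lambda$ is $\lceil \ell(\lambda)/2\rceil - n(\lambda)+n(\lambda_o)-\chi(\lambda)$ (e.g. the $M_2$-rank of $5+\bar 4+4+\bar 3+1+1$ is $3-6+3-1=-1$). Convention: $\overline{N}_2(s,\ell,0)=0$ for all $s$ (the empty overpartition is not counted), as dictated by the paper's generating function for $M_2$-ranks. *)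

theory Defs
  imports
    "HOL-Analysis.Analysis"
    "HOL-Library.Multiset"
    "HOL-Number_Theory.Cong"
    "HOL-Computational_Algebra.Formal_Power_Series"
begin

(* Meaningful for norm q < 1, where the product converges for every a. *)
definition qpoch_inf :: "complex \<Rightarrow> complex \<Rightarrow> complex" where
  "qpoch_inf a q = (\<Prod>k. 1 - a * q ^ k)"

(* An overpartition is a pair (P, S): P is the multiset of all parts, overlined or not, and S is
   the set of those part sizes whose first occurrence is overlined.  Thus a size k in S contributes
   exactly one overlined part k and count P k - 1 non-overlined parts k. *)
type_synonym overpartition = "nat multiset \<times> nat set"

definition overpartition_of :: "nat \<Rightarrow> overpartition \<Rightarrow> bool" where
  "overpartition_of n = (\<lambda>(P, S). 0 \<notin># P \<and> \<Sum>\<^sub># P = n \<and> S \<subseteq> set_mset P)"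

(* Junk value on the empty overpartition, which is never counted. *)
definition largest_part :: "overpartition \<Rightarrow> nat" where
  "largest_part = (\<lambda>(P, S). Max (set_mset P))"

definition num_parts :: "overpartition \<Rightarrow> nat" where
  "num_parts = (\<lambda>(P, S). size P)"

definition odd_nonoverlined :: "overpartition \<Rightarrow> nat multiset" where
  "odd_nonoverlined = (\<lambda>(P, S). {#k \<in># P - mset_set S. odd k#})"

(* If the largest size occurs both overlined and non-overlined, then the largest part is the first
   of these occurrences, i.e. the overlined one, so the value is 0. *)
definition chi :: "overpartition \<Rightarrow> int" where
  "chi = (\<lambda>(P, S). if odd (largest_part (P, S)) \<and> largest_part (P, S) \<notin> S then 1 else 0)"

definition M2_rank :: "overpartition \<Rightarrow> int" where
  "M2_rank x = \<lceil>real (largest_part x) / 2\<rceil> - int (num_parts x)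
     + int (size (odd_nonoverlined x)) - chi x"

(* The empty overpartition of 0 is not counted, so that N2_bar s l 0 = 0. *)
definition N2_bar :: "int \<Rightarrow> int \<Rightarrow> nat \<Rightarrow> nat" where
  "N2_bar s l n = card {x. overpartition_of n x \<and> x \<noteq> ({#}, {}) \<and> [M2_rank x = s] (mod l)}"

definition R01 :: "nat \<Rightarrow> complex fps" where
  "R01 d = Abs_fps (\<lambda>n. of_nat (N2_bar 0 3 (3 * n + d)) - of_nat (N2_bar 1 3 (3 * n + d)))"

end

(* Writing F(z) for the generating function of nonempty overpartitions with z marking the M2-rank,
   splitting by the largest part gives a 3-phi-2 series for F.  A telescoping certificate shows that
   (1 + z) / (1 - z) * (1 + F(z)) satisfies the same first order q-difference equation in z as
   2 A(z) / theta - 1, where A is an Appell-Lerch sum.  Multiplied by a theta function the difference is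
   elliptic and holomorphic on an annulus wider than a period, hence constant by the maximum modulus
   principle, and it has a zero.  At a primitive cube root of unity w this expresses theta * (1 + F(w))
   as a Lambert-type series.  Its terms split by residues modulo 3 into three Appell-Lerch sums with the
   cubed nome; these are values of one elliptic function with two simple poles, so that they differ by
   logarithmic derivatives of theta functions, and the remaining Lambert series is the cubic theta
   quotient theta(q)^3 / theta(q^3).  The result is
     (1 + F(w)) theta(q) theta(q^9) = theta(q^3)^3 + 6 q^5 theta(q) * (Appell-Lerch sum in q^3),
   and the 3-dissections of theta(q) and of 1 / theta(q) separate the residue classes of the exponent. *)

theory Submission
  imports Defs "HOL-Complex_Analysis.Complex_Analysis"
begin

section \<open>Infinite products and theta functions\<close>

text \<open>The rank difference is one value of \<open>rank_gf\<close>: the closed form at a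
  primitive cube root of unity is the same for both roots, so Fourier inversion modulo 3 collapses
  to a single evaluation. The rank series is controlled only near the unit circle. Ellipticity is
  therefore exploited on an annulus slightly longer than one period, with the poles on it removed by
  matching residues, instead of on the whole punctured plane. After the splitting modulo 3 the rank
  series contains three Appell-Lerch sums. The cubic theta quotient, once its logarithmic
  derivatives are rewritten through the addition formula, contains the first two in exactly the same
  combination, so these cancel. The survivor has the factor \<open>q ^ 5\<close> and otherwise
  depends on \<open>q ^ 3\<close> only; as 5 is 2 modulo 3, it enters the third identity alone, and
  the first two are pure products. Every theta function has a nonzero nome, so \<open>q = 0\<close>
  is settled separately by counting the overpartitions of 0, 1 and 2.\<close>

lemma qpoch_summable:
  fixes a q :: complex
  assumes "norm q < 1"
  shows "summable (\<lambda>k. norm (a * q ^ k))"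
  using assms by (auto simp: norm_mult norm_power intro!: summable_mult summable_geometric)

lemma qpoch_abs_convergent:
  fixes a q :: complex
  assumes "norm q < 1"
  shows "abs_convergent_prod (\<lambda>k. 1 - a * q ^ k)"
  by (rule summable_imp_abs_convergent_prod) (use qpoch_summable[OF assms, of a] in \<open>simp add: norm_minus_commute\<close>)

lemma qpoch_convergent:
  fixes a q :: complex
  assumes "norm q < 1"
  shows "convergent_prod (\<lambda>k. 1 - a * q ^ k)"
  using qpoch_abs_convergent[OF assms] by (rule abs_convergent_prod_imp_convergent_prod)

lemma qpoch_has_prod:
  assumes "norm q < 1"
  shows "(\<lambda>k. 1 - a * q ^ k) has_prod qpoch_inf a q"
  using qpoch_convergent[OF assms] unfolding qpoch_inf_def by blast

lemma qpoch_inf_eq_0_iff: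
  assumes "norm q < 1"
  shows "qpoch_inf a q = 0 \<longleftrightarrow> (\<exists>k. a * q ^ k = 1)"
  using has_prod_eq_0_iff[OF qpoch_has_prod[OF assms, of a]] by auto

lemma qpoch_tendsto:
  assumes "norm q < 1"
  shows "(\<lambda>n. \<Prod>k<n. 1 - a * q ^ k) \<longlonglongrightarrow> qpoch_inf a q"
  by (rule has_prod_imp_tendsto'[OF qpoch_has_prod[OF assms]])

lemma qpoch_inf_rec:
  assumes "norm q < 1"
  shows "qpoch_inf a q = (1 - a) * qpoch_inf (a * q) q"
proof -
  have "(\<lambda>n. \<Prod>k<Suc n. 1 - a * q ^ k) \<longlonglongrightarrow> qpoch_inf a q"
    using qpoch_tendsto[OF assms, of a] by (rule LIMSEQ_Suc)
  moreover have "(\<Prod>k<Suc n. 1 - a * q ^ k) = (1 - a) * (\<Prod>k<n. 1 - (a * q) * q ^ k)" for n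
    by (subst prod.lessThan_Suc_shift) (simp add: mult_ac)
  moreover have "(\<lambda>n. (1 - a) * (\<Prod>k<n. 1 - (a * q) * q ^ k)) \<longlonglongrightarrow> (1 - a) * qpoch_inf (a * q) q"
    by (intro tendsto_intros qpoch_tendsto assms)
  ultimately show ?thesis
    using LIMSEQ_unique by fastforce
qed

text \<open>Uniformity on discs in the parameter \<open>a\<close>, for a fixed nome, is what makes
  \<open>qpoch_inf\<close> entire in \<open>a\<close> and lets its logarithmic derivative be taken
  factor by factor.\<close>

lemma qpoch_uniform_limit:
  fixes q :: complex
  assumes "norm q < 1"
  shows "uniform_limit (cball 0 r) (\<lambda>n a. \<Prod>k<n. 1 - a * q ^ k) (\<lambda>a. qpoch_inf a q) sequentially"
proof -
  have "uniformly_convergent_on (cball 0 r) (\<lambda>N a. \<Sum>n<N. norm ((1 - a * q ^ n) - 1))"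
  proof (rule Weierstrass_m_test')
    show "norm (norm (1 - a * q ^ n - 1)) \<le> norm (complex_of_real r * q ^ n)" if "a \<in> cball 0 r" for n a
      using that by (auto simp: norm_mult norm_power intro!: mult_right_mono)
    show "summable (\<lambda>n. norm (complex_of_real r * q ^ n))"
      by (rule qpoch_summable[OF assms])
  qed
  hence "uniformly_convergent_on (cball 0 r) (\<lambda>N a. \<Prod>n<N. 1 - a * q ^ n)"
    by (intro uniformly_convergent_on_prod') (auto intro!: continuous_intros)
  then obtain g where g: "uniform_limit (cball 0 r) (\<lambda>n a. \<Prod>k<n. 1 - a * q ^ k) g sequentially"
    by (auto simp: uniformly_convergent_on_def)
  show ?thesis
  proof (rule uniform_limit_cong[THEN iffD1, OF _ _ g])
    show "g a = qpoch_inf a q" if "a \<in> cball 0 r" for a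
      by (rule LIMSEQ_unique[OF tendsto_uniform_limitI[OF g that] qpoch_tendsto[OF assms]])
  qed auto
qed

lemma qpoch_inf_holomorphic:
  assumes "norm q < 1"
  shows "(\<lambda>a. qpoch_inf a q) holomorphic_on A"
proof -
  have "(\<lambda>a. qpoch_inf a q) holomorphic_on ball 0 r" for r
    by (rule holomorphic_uniform_limit[OF _ qpoch_uniform_limit[OF assms]])
       (auto intro!: always_eventually holomorphic_intros continuous_intros)
  hence "(\<lambda>a. qpoch_inf a q) holomorphic_on (\<Union>r\<in>UNIV. ball 0 r)"
    by (intro holomorphic_on_UN_open) auto
  also have "(\<Union>r\<in>UNIV. ball 0 r) = (UNIV :: complex set)"
    by (auto intro: gt_ex)
  finally show ?thesis
    by (rule holomorphic_on_subset) auto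
qed

lemma qpoch_inf_holomorphic_compose [holomorphic_intros]:
  assumes "norm q < 1" "f holomorphic_on A"
  shows "(\<lambda>z. qpoch_inf (f z) q) holomorphic_on A"
  using holomorphic_on_compose_gen[OF assms(2) qpoch_inf_holomorphic[OF assms(1), of UNIV]]
  by (auto simp: o_def)

lemma qpoch_inf_isCont:
  assumes "norm q < 1"
  shows "isCont (\<lambda>a. qpoch_inf a q) z"
  using holomorphic_on_imp_continuous_on[OF qpoch_inf_holomorphic[OF assms, of UNIV]]
  by (simp add: continuous_on_eq_continuous_at)

section \<open>Lambert series as logarithmic derivatives of infinite products\<close>

definition lambert :: "complex \<Rightarrow> complex \<Rightarrow> complex" where
  "lambert p a = (\<Sum>n. a * p ^ n / (1 - a * p ^ n))"

text \<open>Each factor \<open>1 - z * p ^ k\<close> contributes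
  \<open>- (p ^ k) / (1 - a * p ^ k)\<close> to the logarithmic derivative at \<open>a\<close>;
  multiplication by \<open>- a\<close> turns the sum into the Lambert series. Convergence and
  holomorphy of \<open>lambert\<close> wherever the product does not vanish both come from this
  identification.\<close>

lemma lambert_sums_logderiv:
  assumes p: "norm p < 1" and nz: "qpoch_inf a p \<noteq> 0"
  shows "(\<lambda>n. a * p ^ n / (1 - a * p ^ n)) sums
           (- a * (deriv (\<lambda>z. qpoch_inf z p) a / qpoch_inf a p))"
proof -
  have "(\<lambda>k. deriv (\<lambda>z. 1 - z * p ^ k) a / (1 - a * p ^ k)) sums
          (deriv (\<lambda>z. qpoch_inf z p) a / qpoch_inf a p)"
    by (rule logderiv_prodinf_complex_uniform_limit[where A = "ball 0 (norm a + 1)"])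
       (auto intro!: holomorphic_intros nz uniform_limit_on_subset[OF qpoch_uniform_limit[OF p, of "norm a + 1"]])
  moreover have "deriv (\<lambda>z. 1 - z * p ^ k) a = - (p ^ k)" for k
    by (rule DERIV_imp_deriv) (auto intro!: derivative_eq_intros)
  ultimately have "(\<lambda>k. (- a) * (- (p ^ k) / (1 - a * p ^ k))) sums
          (- a * (deriv (\<lambda>z. qpoch_inf z p) a / qpoch_inf a p))"
    by (intro sums_mult) simp
  thus ?thesis by simp
qed

lemma lambert_sums:
  assumes "norm p < 1" "qpoch_inf a p \<noteq> 0"
  shows "(\<lambda>n. a * p ^ n / (1 - a * p ^ n)) sums lambert p a"
  using lambert_sums_logderiv[OF assms] unfolding lambert_def by (simp add: sums_iff)

lemma lambert_logderiv:
  assumes "norm p < 1" "qpoch_inf a p \<noteq> 0"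
  shows "lambert p a = - a * (deriv (\<lambda>z. qpoch_inf z p) a / qpoch_inf a p)"
  using lambert_sums_logderiv[OF assms] unfolding lambert_def by (simp add: sums_iff)

lemma lambert_holomorphic:
  assumes p: "norm p < 1" and f: "f holomorphic_on A" and nz: "\<And>z. z \<in> A \<Longrightarrow> qpoch_inf (f z) p \<noteq> 0"
  shows "(\<lambda>z. lambert p (f z)) holomorphic_on A"
proof -
  have *: "(\<lambda>a. - a * (deriv (\<lambda>z. qpoch_inf z p) a / qpoch_inf a p)) holomorphic_on {a. qpoch_inf a p \<noteq> 0}"
    using p by (intro holomorphic_intros holomorphic_deriv[OF _ open_UNIV, THEN holomorphic_on_subset]) auto
  have "(\<lambda>z. - f z * (deriv (\<lambda>z. qpoch_inf z p) (f z) / qpoch_inf (f z) p)) holomorphic_on A"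
    using holomorphic_on_compose_gen[OF f *] nz by (auto simp: o_def)
  thus ?thesis
    by (rule holomorphic_transform) (simp add: lambert_logderiv p nz)
qed

lemma lambert_rec:
  assumes "norm p < 1" "qpoch_inf a p \<noteq> 0"
  shows "lambert p a = a / (1 - a) + lambert p (a * p)"
proof -
  have nz: "qpoch_inf (a * p) p \<noteq> 0"
    using qpoch_inf_rec[OF assms(1), of a] assms(2) by auto
  have "(\<lambda>n. (a * p) * p ^ n / (1 - (a * p) * p ^ n)) sums (lambert p a - a / (1 - a))"
    using lambert_sums[OF assms] by (subst (asm) sums_iff_shift'[of _ 1, symmetric]) (simp add: mult_ac)
  from sums_unique2[OF this lambert_sums[OF assms(1) nz]] show ?thesis
    by (simp add: diff_eq_eq add.commute)
qed

text \<open>\<open>z\<close> times the logarithmic derivative of the theta function \<open>jprod\<close> below.\<close>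

definition logth :: "complex \<Rightarrow> complex \<Rightarrow> complex" where
  "logth p z = lambert p (p / z) - lambert p z"

section \<open>The theta function (z, p/z, p; p)_infinity: quasi-periodicity, zeros, logarithmic
  derivative\<close>

definition jprod :: "complex \<Rightarrow> complex \<Rightarrow> complex" where
  "jprod z p = qpoch_inf z p * qpoch_inf (p / z) p * qpoch_inf p p"

lemma qpoch_self_nonzero:
  assumes "norm p < 1"
  shows "qpoch_inf p p \<noteq> 0"
proof -
  have "p * p ^ k \<noteq> 1" for k
  proof
    assume "p * p ^ k = 1"
    hence "norm p ^ Suc k = 1"
      by (metis norm_one norm_power power_Suc)
    thus False
      using power_less_one_iff[of "norm p" "Suc k"] assms by simp
  qed
  thus ?thesis
    using qpoch_inf_eq_0_iff[OF assms] by blast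
qed

lemma qpoch_nonzero_norm:
  assumes "norm p < 1" "norm a < 1"
  shows "qpoch_inf a p \<noteq> 0"
proof -
  have "a * p ^ k \<noteq> 1" for k
  proof
    assume "a * p ^ k = 1"
    hence "norm a * norm p ^ k = 1"
      by (metis norm_one norm_power norm_mult)
    moreover have "norm a * norm p ^ k \<le> norm a"
      using assms by (simp add: mult_left_le power_le_one)
    ultimately show False
      using assms by simp
  qed
  thus ?thesis
    using qpoch_inf_eq_0_iff[OF assms(1)] by blast
qed

text \<open>Once \<open>a * p\<close> lies in the unit disc, \<open>1 - a\<close> is the only factor
  of the product that can vanish.\<close>

lemma qpoch_nonzero_annulus:
  assumes "norm p < 1" "norm a * norm p < 1" "a \<noteq> 1"
  shows "qpoch_inf a p \<noteq> 0"
proof -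
  have "qpoch_inf (a * p) p \<noteq> 0"
    using assms by (intro qpoch_nonzero_norm) (auto simp: norm_mult)
  thus ?thesis
    using assms qpoch_inf_rec[of p a] by simp
qed

lemma jprod_shift:
  assumes "norm p < 1" "p \<noteq> 0" "z \<noteq> 0"
  shows "jprod (p * z) p = - jprod z p / z"
proof -
  have "jprod z p = (1 - z) * qpoch_inf (z * p) p * qpoch_inf (p / z) p * qpoch_inf p p"
    unfolding jprod_def by (subst qpoch_inf_rec[OF assms(1), of z]) simp
  moreover have "jprod (p * z) p = qpoch_inf (z * p) p * ((1 - 1 / z) * qpoch_inf (p / z) p) * qpoch_inf p p"
    using qpoch_inf_rec[OF assms(1), of "1 / z"] assms by (simp add: jprod_def mult_ac)
  ultimately show ?thesis
    using assms by (simp add: divide_simps) (simp add: algebra_simps)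
qed

lemma jprod_reflect:
  assumes "p \<noteq> 0" "z \<noteq> 0"
  shows "jprod (p / z) p = jprod z p"
  using assms by (simp add: jprod_def)

lemma jprod_nonzero_annulus:
  assumes "norm p < 1" "norm p < norm z" "norm z * norm p < 1" "z \<noteq> 1"
  shows "jprod z p \<noteq> 0"
  using assms qpoch_self_nonzero[of p] qpoch_nonzero_annulus[of p z] qpoch_nonzero_norm[of p "p / z"]
  by (auto simp: jprod_def norm_divide divide_less_eq)

lemma jprod_holomorphic [holomorphic_intros]:
  assumes "norm p < 1" "f holomorphic_on A" "\<And>z. z \<in> A \<Longrightarrow> f z \<noteq> 0"
  shows "(\<lambda>z. jprod (f z) p) holomorphic_on A"
  unfolding jprod_def using assms by (intro holomorphic_intros) auto

lemma jprod_1 [simp]: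
  assumes "norm p < 1" shows "jprod 1 p = 0"
  using qpoch_inf_rec[OF assms, of 1] by (simp add: jprod_def)

text \<open>The limit is minus the derivative of the theta function at its simple zero 1. It
  supplies the residues of quotients with a theta function in the denominator.\<close>

lemma jprod_div_tendsto:
  assumes "norm p < 1"
  shows "((\<lambda>z. jprod z p / (1 - z)) \<longlongrightarrow> qpoch_inf p p ^ 3) (at 1)"
proof -
  have "((\<lambda>z. qpoch_inf (z * p) p * qpoch_inf (p / z) p * qpoch_inf p p)
          \<longlongrightarrow> qpoch_inf (1 * p) p * qpoch_inf (p / 1) p * qpoch_inf p p) (at 1)"
    by (intro tendsto_intros isCont_tendsto_compose[OF qpoch_inf_isCont[OF assms]]) auto
  moreover have "eventually (\<lambda>z. qpoch_inf (z * p) p * qpoch_inf (p / z) p * qpoch_inf p p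
       = jprod z p / (1 - z)) (at (1 :: complex))"
    unfolding eventually_at_filter jprod_def
    by (intro always_eventually allI impI, subst (4) qpoch_inf_rec[OF assms]) auto
  ultimately show ?thesis
    by (auto simp: power3_eq_cube intro: Lim_transform_eventually)
qed

text \<open>Logarithmic form of \<open>jprod_shift\<close>: z times the logarithmic derivative of
  the multiplier \<open>- 1 / z\<close> is -1. The two nonvanishing assumptions exclude the powers
  of p, which are the poles.\<close>

lemma logth_shift:
  assumes "norm p < 1" "p \<noteq> 0" "z \<noteq> 0" "qpoch_inf z p \<noteq> 0" "qpoch_inf (1 / z) p \<noteq> 0"
  shows "logth p (p * z) = logth p z - 1"
proof -
  have "z \<noteq> 1" using assms qpoch_inf_rec[of p 1] by auto
  have "lambert p z = z / (1 - z) + lambert p (p * z)"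
    using lambert_rec[of p z] assms by (simp add: mult_ac)
  moreover have "lambert p (1 / z) = (1 / z) / (1 - 1 / z) + lambert p (p / z)"
    using lambert_rec[of p "1 / z"] assms by simp
  moreover have "z / (1 - z) + (1 / z) / (1 - 1 / z) = -1"
    using \<open>z \<noteq> 1\<close> \<open>z \<noteq> 0\<close> by (simp add: divide_simps) (simp add: algebra_simps)
  ultimately show ?thesis
    using assms by (simp add: logth_def algebra_simps)
qed

lemma logth_minus:
  assumes "norm p < 1" "p \<noteq> 0" "z \<noteq> 0" "qpoch_inf z p \<noteq> 0" "qpoch_inf (1 / z) p \<noteq> 0"
  shows "logth p (1 / z) = 1 - logth p z"
proof -
  have "logth p (1 / z) = - logth p (p * z)"
    using assms by (simp add: logth_def)
  thus ?thesis using logth_shift[OF assms] by simp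
qed

text \<open>With its singularities removed, H extends to a holomorphic function invariant under
  division by p. On a compact fundamental annulus its modulus has a maximum, and invariance carries
  the bound to a neighbourhood of that annulus, so the maximum is interior. The strict inequality
  \<open>r1 < r2 * norm p\<close> leaves room for this neighbourhood. The second conclusion reads
  the constant off as a limit at a removed point, where the value of H itself may be junk from a
  division by zero.\<close>

lemma annulus_elliptic_constant:
  fixes H :: "complex \<Rightarrow> complex" and p :: complex
  assumes p: "norm p < 1" "p \<noteq> 0"
    and r: "0 \<le> r1" "r1 < r2 * norm p"
    and K: "finite K"
    and hol: "H holomorphic_on ({z. r1 < norm z \<and> norm z < r2} - K)"
    and lim: "\<And>k. k \<in> K \<Longrightarrow> ((\<lambda>z. (z - k) * H z) \<longlongrightarrow> 0) (at k)"
    and per: "\<And>z. r1 < norm z \<Longrightarrow> norm z < r2 * norm p \<Longrightarrow> z / p \<notin> K \<Longrightarrow> z \<notin> K \<Longrightarrow> H (z / p) = H z"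
  obtains c where "\<And>z. r1 < norm z \<Longrightarrow> norm z < r2 \<Longrightarrow> z \<notin> K \<Longrightarrow> H z = c"
    "\<And>k. k \<in> K \<Longrightarrow> r1 < norm k \<Longrightarrow> norm k < r2 \<Longrightarrow> (H \<longlongrightarrow> c) (at k)"
proof -
  define A where "A = {z :: complex. r1 < norm z \<and> norm z < r2}"
  have A_alt: "A = {z. r1 < norm (z - 0)} \<inter> {z. norm (z - 0) < r2}"
    by (auto simp: A_def)
  have "open A"
    unfolding A_alt by (intro open_Int open_Collect_less continuous_intros)
  have "connected A"
    using connected_annulus[of r1 "0::complex" r2] by (simp add: A_def)
  \<comment> \<open>Singularities are removed one at a time; H is generalised in the induction
    because each removal replaces it.\<close>
  have "\<exists>g. g holomorphic_on A \<and> (\<forall>z\<in>A - K. g z = H z)"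
    using K hol[folded A_def] lim
  proof (induction K arbitrary: H rule: finite_induct)
    case empty
    thus ?case by auto
  next
    case (insert k K H)
    have opn: "open (A - K)" using \<open>open A\<close> insert.hyps by (simp add: finite_imp_closed open_Diff)
    have "\<exists>g. g holomorphic_on (A - K) \<and> (\<forall>z\<in>(A - K) - {k}. g z = H z)"
    proof (cases "k \<in> A")
      case True
      show ?thesis
      proof (subst holomorphic_on_extend_lim)
        show "H holomorphic_on A - K - {k}"
          using insert.prems(1) by (metis Diff_insert)
        show "k \<in> interior (A - K)"
          using True insert.hyps opn by (simp add: interior_open)
        show "((\<lambda>z. (z - k) * H z) \<longlongrightarrow> 0) (at k)"
          using insert.prems by simp
      qed
    next
      case False
      thus ?thesis using insert.prems by (intro exI[of _ H]) (auto simp: Diff_insert0)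
    qed
    then obtain g where g: "g holomorphic_on (A - K)" "\<And>z. z \<in> A - K - {k} \<Longrightarrow> g z = H z"
      by blast
    \<comment> \<open>Outside A the old H is kept: points of K may lie outside A, and the induction
      hypothesis asks for the limit condition there as well.\<close>
    have "\<exists>h. h holomorphic_on A \<and> (\<forall>z\<in>A - K. h z = (if z \<in> A then g z else H z))"
    proof (rule insert.IH)
      show "(\<lambda>z. if z \<in> A then g z else H z) holomorphic_on A - K"
        using g(1) by (rule holomorphic_transform) auto
      fix j assume j: "j \<in> K"
      hence "j \<noteq> k" using insert.hyps by auto
      have "open (- ((K - {j}) \<union> {k}))"
        using insert.hyps by (intro open_Compl finite_imp_closed) auto
      hence "eventually (\<lambda>z. z \<in> - ((K - {j}) \<union> {k})) (at j)"
        using \<open>j \<noteq> k\<close> by (intro eventually_at_in_open') auto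
      moreover have "eventually (\<lambda>z. z \<noteq> j) (at j)"
        by (simp add: eventually_at_filter)
      ultimately have "eventually (\<lambda>z. (z - j) * H z = (z - j) * (if z \<in> A then g z else H z)) (at j)"
        by eventually_elim (use g(2) in auto)
      moreover have "((\<lambda>z. (z - j) * H z) \<longlongrightarrow> 0) (at j)"
        using insert.prems j by simp
      ultimately show "((\<lambda>z. (z - j) * (if z \<in> A then g z else H z)) \<longlongrightarrow> 0) (at j)"
        by (rule Lim_transform_eventually[rotated])
    qed
    then obtain h where "h holomorphic_on A" "\<forall>z\<in>A - K. h z = (if z \<in> A then g z else H z)" by blast
    thus ?case using g(2) by (intro exI[of _ h]) auto
  qed
  then obtain g where g: "g holomorphic_on A" "\<And>z. z \<in> A - K \<Longrightarrow> g z = H z" by blast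
  have cont: "isCont g z" if "z \<in> A" for z
    using g(1) \<open>open A\<close> that holomorphic_on_imp_continuous_on continuous_on_eq_continuous_at by blast
  \<comment> \<open>Invariance is assumed only off K and its translate by p. These are finitely many
    points, so continuity of g extends it to them.\<close>
  have gper: "g (z / p) = g z" if z: "z \<in> A" "z / p \<in> A" for z
  proof -
    define B where "B = (A \<inter> (\<lambda>z. z / p) -` A) - (K \<union> (\<lambda>z. p * z) ` K) "
    have "isCont (\<lambda>z. g (z / p) - g z) z"
      using p by (intro continuous_diff cont[OF z(1)] isCont_o2[where g = g and f = "\<lambda>z. z / p", OF _ cont[OF z(2)]]) (auto intro!: continuous_intros)
    hence 1: "((\<lambda>z. g (z / p) - g z) \<longlongrightarrow> g (z / p) - g z) (at z)"
      by (simp add: isCont_def)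
    have "open (A \<inter> (\<lambda>z. z / p) -` A)"
      using \<open>open A\<close> p by (intro open_Int open_vimage continuous_intros) auto
    hence "eventually (\<lambda>w. w \<in> (A \<inter> (\<lambda>z. z / p) -` A) - ((K \<union> (\<lambda>z. p * z) ` K) - {z})) (at z)"
      using K z by (intro eventually_at_in_open' open_Diff finite_imp_closed) auto
    hence "eventually (\<lambda>w. w \<in> B) (at z)"
      using eventually_neq_at_within[of z z UNIV] unfolding B_def by eventually_elim auto
    hence "eventually (\<lambda>w. g (w / p) - g w = 0) (at z)"
    proof eventually_elim
      case (elim w)
      have "w / p \<notin> K"
      proof
        assume "w / p \<in> K"
        hence "p * (w / p) \<in> (\<lambda>z. p * z) ` K" by blast
        thus False using elim p by (auto simp: B_def)
      qed
      moreover have "norm w < r2 * norm p"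
        using elim p by (auto simp: B_def A_def norm_divide divide_less_eq)
      ultimately show ?case
        using per[of w] elim g(2)[of w] g(2)[of "w / p"] by (auto simp: B_def A_def)
    qed
    hence "((\<lambda>z. g (z / p) - g z) \<longlongrightarrow> 0) (at z)"
      by (rule tendsto_eventually)
    from LIM_unique[OF 1 this] show ?thesis by simp
  qed
  \<comment> \<open>The fundamental annulus lies between \<open>r0\<close> and
    \<open>r0 / norm p\<close>; this choice puts both bounding circles strictly inside A.\<close>
  obtain r0 where r0: "r1 < r0" "r0 < r2 * norm p" using r dense by blast
  have r0p: "r0 / norm p < r2" "0 < r0" "r0 * norm p < r0" using r0 r p by (auto simp: field_simps)
  have r0p': "r0 \<le> r0 / norm p" using r0p p by (simp add: field_simps)
  define C where "C = {z :: complex. r0 \<le> norm z \<and> norm z \<le> r0 / norm p}"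
  have "C \<subseteq> A" using r0 r0p by (auto simp: C_def A_def)
  have "compact C"
  proof -
    have "C = cball 0 (r0 / norm p) - ball 0 r0" by (auto simp: C_def)
    thus ?thesis by (simp add: compact_diff)
  qed
  have "complex_of_real r0 \<in> C" using r0p r0p' by (auto simp: C_def)
  hence "C \<noteq> {}" by auto
  have "continuous_on C (\<lambda>z. norm (g z))"
    using cont \<open>C \<subseteq> A\<close> by (intro continuous_intros continuous_at_imp_continuous_on) auto
  then obtain x where x: "x \<in> C" "\<And>z. z \<in> C \<Longrightarrow> norm (g z) \<le> norm (g x)"
    using continuous_attains_sup[OF \<open>compact C\<close> \<open>C \<noteq> {}\<close>] by blast
  \<comment> \<open>One further period on either side of C, cut down to A. A point of U outside C is
    brought into C by a single multiplication or division by p.\<close>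
  define U where "U = {z :: complex. max r1 (r0 * norm p) < norm z \<and> norm z < min r2 (r0 / norm p / norm p)}"
  have "open U"
  proof -
    have "U = {z. max r1 (r0 * norm p) < norm z} \<inter> {z. norm z < min r2 (r0 / norm p / norm p)}"
      by (auto simp: U_def)
    thus ?thesis by (simp only:) (intro open_Int open_Collect_less continuous_intros)
  qed
  have "g constant_on A"
  proof (rule maximum_modulus_principle[OF g(1) \<open>open A\<close> \<open>connected A\<close> \<open>open U\<close>])
    show "U \<subseteq> A" by (auto simp: U_def A_def)
    have "norm x \<le> r0 / norm p" using x(1) by (simp add: C_def)
    also have "r0 / norm p < r0 / norm p / norm p"
      using r0p(2) p divide_strict_left_mono[of "norm p" 1 "r0 / norm p"] by simp
    finally have "norm x < r0 / norm p / norm p" .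
    moreover have "r0 * norm p < norm x"
      using less_le_trans[OF r0p(3)] x(1) by (simp add: C_def)
    ultimately show "x \<in> U" using x(1) r0 r0p by (auto simp: U_def C_def)
    fix z assume z: "z \<in> U"
    have "z \<in> A" using z by (auto simp: U_def A_def)
    consider "norm z < r0" | "z \<in> C" | "norm z > r0 / norm p"
      by (force simp: C_def)
    thus "norm (g z) \<le> norm (g x)"
    proof cases
      case 1
      hence "z / p \<in> C"
        using z p by (auto simp: C_def U_def norm_divide field_simps)
      thus ?thesis using x(2)[of "z / p"] gper[of z] \<open>z \<in> A\<close> \<open>C \<subseteq> A\<close> by auto
    next
      case 2 thus ?thesis using x(2) by simp
    next
      case 3
      hence "z * p \<in> C"
        using z p by (auto simp: C_def U_def norm_mult field_simps)
      thus ?thesis using x(2)[of "z * p"] gper[of "z * p"] \<open>z \<in> A\<close> \<open>C \<subseteq> A\<close> p by auto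
    qed
  qed
  then obtain c where c: "\<And>z. z \<in> A \<Longrightarrow> g z = c" by (auto simp: constant_on_def)
  show ?thesis
  proof (rule that)
    show "H z = c" if "r1 < norm z" "norm z < r2" "z \<notin> K" for z
      using c[of z] g(2)[of z] that by (auto simp: A_def)
    show "(H \<longlongrightarrow> c) (at k)" if "k \<in> K" "r1 < norm k" "norm k < r2" for k
    proof (rule tendsto_eventually)
      have "eventually (\<lambda>w. w \<in> A - (K - {k})) (at k)"
        using that K \<open>open A\<close> by (intro eventually_at_in_open' open_Diff finite_imp_closed) (auto simp: A_def)
      moreover have "eventually (\<lambda>w. w \<noteq> k) (at k)"
        by (simp add: eventually_at_filter)
      ultimately show "eventually (\<lambda>w. H w = c) (at k)"
        by eventually_elim (metis DiffD1 DiffI Diff_iff c g(2) singletonD)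
    qed
  qed
qed

section \<open>Appell-Lerch sums\<close>

text \<open>The M-test on small closed discs makes the finite partial sums converge locally
  uniformly. Domination is asked for on compact sets only, since for Appell-Lerch sums the bounds
  degenerate at the boundary of the annulus.\<close>

lemma infsum_holomorphic:
  fixes f :: "'a \<Rightarrow> complex \<Rightarrow> complex"
  assumes "open A" and hol: "\<And>m. m \<in> X \<Longrightarrow> f m holomorphic_on A"
    and dom: "\<And>K. compact K \<Longrightarrow> K \<subseteq> A \<Longrightarrow> \<exists>M. M summable_on X \<and> (\<forall>m\<in>X. \<forall>w\<in>K. norm (f m w) \<le> M m)"
  shows "(\<lambda>z. \<Sum>\<^sub>\<infinity>m\<in>X. f m z) holomorphic_on A"
proof -
  have "\<exists>e>0. (\<lambda>z. \<Sum>\<^sub>\<infinity>m\<in>X. f m z) holomorphic_on ball z0 e" if "z0 \<in> A" for z0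
  proof -
    obtain e where e: "e > 0" "cball z0 e \<subseteq> A"
      using \<open>open A\<close> \<open>z0 \<in> A\<close> open_contains_cball by blast
    obtain M where M: "M summable_on X" "\<And>m w. m \<in> X \<Longrightarrow> w \<in> cball z0 e \<Longrightarrow> norm (f m w) \<le> M m"
      using dom[OF compact_cball e(2)] by blast
    have ul: "uniform_limit (cball z0 e) (\<lambda>Y w. \<Sum>m\<in>Y. f m w) (\<lambda>w. \<Sum>\<^sub>\<infinity>m\<in>X. f m w) (finite_subsets_at_top X)"
      by (rule Weierstrass_m_test_general[OF M(2,1)])
    have holY: "(\<lambda>w. \<Sum>m\<in>Y. f m w) holomorphic_on A" if "Y \<subseteq> X" for Y
      using that by (intro holomorphic_intros hol) auto
    have "eventually (\<lambda>Y. continuous_on (cball z0 e) (\<lambda>w. \<Sum>m\<in>Y. f m w) \<and>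
             (\<lambda>w. \<Sum>m\<in>Y. f m w) holomorphic_on ball z0 e) (finite_subsets_at_top X)"
      using e by (intro eventually_finite_subsets_at_top_weakI conjI
          holomorphic_on_imp_continuous_on holomorphic_on_subset[OF holY]) auto
    hence "(\<lambda>z. \<Sum>\<^sub>\<infinity>m\<in>X. f m z) holomorphic_on ball z0 e"
      by (rule holomorphic_uniform_limit[OF _ ul]) auto
    thus ?thesis using e by blast
  qed
  thus ?thesis
    unfolding holomorphic_on_open[OF \<open>open A\<close>] holomorphic_on_open[OF open_ball]
    by (meson centre_in_ball)
qed

text \<open>With n the absolute value of m, the term is \<open>(C * r ^ n) ^ n\<close>, and
  \<open>C * r ^ n\<close> tends to 0: the Gaussian factor beats every exponential.\<close>

lemma summable_on_gaussian:
  fixes r C :: real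
  assumes "0 \<le> r" "r < 1" "0 \<le> C"
  shows "(\<lambda>m::int. r ^ nat (m\<^sup>2) * C ^ nat \<bar>m\<bar>) summable_on X"
proof -
  have "(\<lambda>n. C * r ^ n) \<longlonglongrightarrow> C * 0"
    using assms by (intro tendsto_intros LIMSEQ_power_zero) auto
  hence "eventually (\<lambda>n. C * r ^ n < 1 / 2) sequentially"
    by (rule order_tendstoD) auto
  hence ev: "eventually (\<lambda>n. norm (r ^ (n\<^sup>2) * C ^ n) \<le> (1 / 2) ^ n) sequentially"
  proof eventually_elim
    case (elim n)
    have "r ^ (n\<^sup>2) * C ^ n = (C * r ^ n) ^ n"
      by (simp add: power_mult_distrib power2_eq_square power_mult mult.commute)
    also have "\<dots> \<le> (1 / 2) ^ n"
      using elim assms by (intro power_mono) auto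
    finally show ?case using assms by simp
  qed
  have "summable (\<lambda>n. norm (r ^ (n\<^sup>2) * C ^ n))"
    by (rule summable_comparison_test_ev[where g = "\<lambda>n. (1 / 2) ^ n"]) (use ev in \<open>auto intro: summable_geometric\<close>)
  hence nat: "(\<lambda>n. r ^ (n\<^sup>2) * C ^ n) summable_on UNIV"
    by (rule norm_summable_imp_summable_on)
  let ?f = "\<lambda>m::int. r ^ nat (m\<^sup>2) * C ^ nat \<bar>m\<bar>"
  have sq: "nat ((int n)\<^sup>2) = n\<^sup>2" for n by (simp add: nat_power_eq)
  have 1: "?f summable_on (range int)"
    by (subst summable_on_reindex) (use nat in \<open>auto simp: o_def sq\<close>)
  have 2: "?f summable_on (range (\<lambda>n. - int n))"
    by (subst summable_on_reindex) (use nat in \<open>auto simp: o_def sq inj_on_def\<close>)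
  have un: "range int \<union> range (\<lambda>n. - int n) = UNIV"
  proof (intro UNIV_eq_I[symmetric])
    show "x \<in> range int \<union> range (\<lambda>n. - int n)" for x
      by (cases x rule: int_cases2) auto
  qed
  have "?f summable_on UNIV"
    using summable_on_union[OF 1 2] by (simp only: un)
  thus ?thesis by (rule summable_on_subset_banach) simp
qed

lemma norm_gaussian_term_le:
  fixes Q x :: complex
  assumes "norm x \<le> C" "norm (1 / x) \<le> C" "Q \<noteq> 0"
  shows "norm ((-1) powi m * Q powi (m\<^sup>2) * x powi m) \<le> norm Q ^ nat (m\<^sup>2) * C ^ nat \<bar>m\<bar>"
proof -
  have "norm (x powi m) \<le> C ^ nat \<bar>m\<bar>"
  proof (cases "m \<ge> 0")
    case True
    thus ?thesis using assms by (simp add: power_int_def norm_power power_mono)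
  next
    case False
    hence "norm (x powi m) = norm (1 / x) ^ nat \<bar>m\<bar>"
      by (simp add: power_int_def norm_power norm_inverse norm_divide inverse_eq_divide)
    thus ?thesis using assms by (simp add: power_mono)
  qed
  moreover have "norm (Q powi (m\<^sup>2)) = norm Q ^ nat (m\<^sup>2)"
    by (simp add: power_int_def norm_power)
  moreover have "norm ((-1 :: complex) powi m) = 1"
    by (simp add: norm_power_int)
  ultimately show ?thesis
    by (simp add: norm_mult mult_left_mono)
qed

definition theta :: "complex \<Rightarrow> complex \<Rightarrow> complex" where
  "theta Q x = (\<Sum>\<^sub>\<infinity>m::int. (-1) powi m * Q powi (m\<^sup>2) * x powi m)"

text \<open>The Appell-Lerch sum with nome \<open>Q ^ 2\<close>, left undivided by
  \<open>theta Q x\<close> so that it is also available where that theta function vanishes, as for x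
  = Q in \<open>appell_self\<close>.\<close>

definition appell :: "complex \<Rightarrow> complex \<Rightarrow> complex \<Rightarrow> complex" where
  "appell Q x z = (\<Sum>\<^sub>\<infinity>m::int. (-1) powi m * Q powi (m\<^sup>2) * x powi m / (1 - z * Q powi (2 * m)))"

text \<open>The omitted term m = 0 is the only one with a pole in the annulus from
  \<open>norm Q ^ 2\<close> to \<open>1 / norm Q ^ 2\<close>, namely at z = 1. At z = 1 itself
  division by zero makes that term 0, so \<open>appell\<close> and \<open>appell0\<close> agree
  there.\<close>

definition appell0 :: "complex \<Rightarrow> complex \<Rightarrow> complex \<Rightarrow> complex" where
  "appell0 Q x z = (\<Sum>\<^sub>\<infinity>m\<in>-{0::int}. (-1) powi m * Q powi (m\<^sup>2) * x powi m / (1 - z * Q powi (2 * m)))"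

lemma theta_summable:
  fixes Q x :: complex
  assumes "norm Q < 1" "Q \<noteq> 0" "x \<noteq> 0"
  shows "(\<lambda>m::int. (-1) powi m * Q powi (m\<^sup>2) * x powi m) summable_on X"
proof (rule Infinite_Sum.abs_summable_summable[OF Infinite_Sum.abs_summable_on_comparison_test'])
  show "norm ((-1) powi m * Q powi (m\<^sup>2) * x powi m) \<le>
      norm Q ^ nat (m\<^sup>2) * (norm x + norm (1 / x)) ^ nat \<bar>m\<bar>" for m
    using assms by (intro norm_gaussian_term_le) auto
  show "(\<lambda>m. norm Q ^ nat (m\<^sup>2) * (norm x + norm (1 / x)) ^ nat \<bar>m\<bar>) summable_on X"
    using assms by (intro summable_on_gaussian) auto
qed

text \<open>For nonzero m the modulus of \<open>z * Q powi (2 * m)\<close> is at most its value at m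
  = 1 or at least its value at m = -1; the two entries are the resulting lower bounds for the
  denominators.\<close>

definition pole_gap :: "complex \<Rightarrow> complex \<Rightarrow> real" where
  "pole_gap Q z = min (1 - norm z * norm Q ^ 2) (norm z / norm Q ^ 2 - 1)"

lemma pole_gap_pos:
  assumes "Q \<noteq> 0" "norm Q ^ 2 < norm z" "norm z * norm Q ^ 2 < 1"
  shows "pole_gap Q z > 0"
  using assms by (auto simp: pole_gap_def field_simps)

lemma pole_gap_le:
  assumes "norm Q < 1" "Q \<noteq> 0" "m \<noteq> 0"
  shows "pole_gap Q z \<le> norm (1 - z * Q powi (2 * m))"
proof (cases "m > 0")
  case True
  have "norm (Q powi (2 * m)) = norm Q ^ (2 * nat m)"
    using True by (simp add: power_int_def norm_power nat_mult_distrib)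
  also have "\<dots> \<le> norm Q ^ 2"
    using True assms by (intro power_decreasing) auto
  finally have "norm (z * Q powi (2 * m)) \<le> norm z * norm Q ^ 2"
    by (simp add: norm_mult mult_left_mono)
  moreover have "1 - norm (z * Q powi (2 * m)) \<le> norm (1 - z * Q powi (2 * m))"
    by (metis norm_one norm_triangle_ineq2)
  ultimately show ?thesis by (simp add: pole_gap_def)
next
  case False
  have "2 * m = - int (2 * nat (- m))" using False by simp
  hence "norm (Q powi (2 * m)) = 1 / norm Q ^ (2 * nat (-m))"
    by (simp only: norm_power_int power_int_minus power_int_of_nat inverse_eq_divide norm_power norm_divide norm_one)
  moreover have "norm Q ^ (2 * nat (-m)) \<le> norm Q ^ 2"
    using False assms by (intro power_decreasing) auto
  ultimately have "norm z / norm Q ^ 2 \<le> norm (z * Q powi (2 * m))"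
    using assms by (simp add: norm_mult divide_left_mono)
  moreover have "norm (z * Q powi (2 * m)) - 1 \<le> norm (1 - z * Q powi (2 * m))"
    by (metis norm_minus_commute norm_one norm_triangle_ineq2)
  ultimately show ?thesis by (simp add: pole_gap_def)
qed

lemma norm_appell_term_le:
  fixes Q x z :: complex
  assumes "norm Q < 1" "Q \<noteq> 0" "norm x \<le> C" "norm (1 / x) \<le> C" "0 < d" "d \<le> pole_gap Q z" "m \<noteq> 0"
  shows "norm ((-1) powi m * Q powi (m\<^sup>2) * x powi m / (1 - z * Q powi (2 * m)))
           \<le> norm Q ^ nat (m\<^sup>2) * C ^ nat \<bar>m\<bar> * (1 / d)"
proof -
  have "d \<le> norm (1 - z * Q powi (2 * m))"
    using assms pole_gap_le[of Q m z] by simp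
  moreover have "C \<ge> 0" using assms(3) norm_ge_zero[of x] by linarith
  ultimately show ?thesis
    using norm_gaussian_term_le[of x C Q m] assms
    unfolding norm_divide[of _ "1 - z * Q powi (2 * m)"] times_divide_eq_right mult_1_right
    by (intro frac_le) auto
qed

lemma appell0_summable:
  fixes Q x z :: complex
  assumes "norm Q < 1" "Q \<noteq> 0" "x \<noteq> 0" "norm Q ^ 2 < norm z" "norm z * norm Q ^ 2 < 1"
  shows "(\<lambda>m::int. (-1) powi m * Q powi (m\<^sup>2) * x powi m / (1 - z * Q powi (2 * m))) summable_on -{0}"
proof (rule Infinite_Sum.abs_summable_summable[OF Infinite_Sum.abs_summable_on_comparison_test'])
  show "norm ((-1) powi m * Q powi (m\<^sup>2) * x powi m / (1 - z * Q powi (2 * m))) \<le>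
      norm Q ^ nat (m\<^sup>2) * (norm x + norm (1 / x)) ^ nat \<bar>m\<bar> * (1 / pole_gap Q z)" if "m \<in> -{0}" for m
    using assms that pole_gap_pos[of Q z] by (intro norm_appell_term_le) auto
  show "(\<lambda>m. norm Q ^ nat (m\<^sup>2) * (norm x + norm (1 / x)) ^ nat \<bar>m\<bar> * (1 / pole_gap Q z)) summable_on -{0}"
    using assms by (intro summable_on_cmult_left summable_on_gaussian) auto
qed

lemma appell_summable:
  fixes Q x z :: complex
  assumes "norm Q < 1" "Q \<noteq> 0" "x \<noteq> 0" "norm Q ^ 2 < norm z" "norm z * norm Q ^ 2 < 1"
  shows "(\<lambda>m::int. (-1) powi m * Q powi (m\<^sup>2) * x powi m / (1 - z * Q powi (2 * m))) summable_on UNIV"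
proof -
  have un: "insert 0 (-{0::int}) = UNIV" by auto
  show ?thesis using summable_on_insert_iff[THEN iffD2, OF appell0_summable[OF assms], of 0] by (simp only: un)
qed

lemma appell_split:
  assumes "norm Q < 1" "Q \<noteq> 0" "x \<noteq> 0" "norm Q ^ 2 < norm z" "norm z * norm Q ^ 2 < 1"
  shows "appell Q x z = 1 / (1 - z) + appell0 Q x z"
proof -
  have un: "insert 0 (-{0::int}) = UNIV" by auto
  show ?thesis unfolding appell_def appell0_def
    using infsum_insert[OF appell0_summable[OF assms], of 0] by (simp add: un)
qed

text \<open>The first argument may depend on z because the addition formula moves both arguments
  together, along \<open>(q ^ 2 * z, z)\<close>.\<close>

lemma appell0_holomorphic:
  assumes Q: "norm Q < 1" "Q \<noteq> 0" and "open A"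
    and A: "\<And>z. z \<in> A \<Longrightarrow> norm Q ^ 2 < norm z" "\<And>z. z \<in> A \<Longrightarrow> norm z * norm Q ^ 2 < 1"
    and g: "g holomorphic_on A" "\<And>z. z \<in> A \<Longrightarrow> g z \<noteq> 0"
  shows "(\<lambda>z. appell0 Q (g z) z) holomorphic_on A"
  unfolding appell0_def
proof (rule infsum_holomorphic[OF \<open>open A\<close>])
  fix m :: int assume m: "m \<in> -{0}"
  have "1 - z * Q powi (2 * m) \<noteq> 0" if "z \<in> A" for z
    using pole_gap_le[of Q m z] pole_gap_pos[of Q z] A[OF that] Q m by auto
  thus "(\<lambda>z. (-1) powi m * Q powi (m\<^sup>2) * g z powi m / (1 - z * Q powi (2 * m))) holomorphic_on A"
    using g by (intro holomorphic_intros) auto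
next
  fix K assume K: "compact K" "K \<subseteq> A"
  have cg: "continuous_on K g"
    using holomorphic_on_imp_continuous_on[OF g(1)] K(2) continuous_on_subset by blast
  have gnz: "g z \<noteq> 0" if "z \<in> K" for z using g(2) K that by auto
  have "bounded ((\<lambda>z. norm (g z) + norm (1 / g z) + 1 / pole_gap Q z) ` K)"
  proof (intro compact_imp_bounded compact_continuous_image K(1))
    have "pole_gap Q z \<noteq> 0" if "z \<in> K" for z
      using pole_gap_pos[of Q z] A[of z] Q K that by force
    thus "continuous_on K (\<lambda>z. norm (g z) + norm (1 / g z) + 1 / pole_gap Q z)"
      unfolding pole_gap_def using Q by (intro continuous_intros cg) (auto dest: gnz)
  qed
  then obtain C where C: "\<And>z. z \<in> K \<Longrightarrow> norm (norm (g z) + norm (1 / g z) + 1 / pole_gap Q z) \<le> C"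
    by (auto simp: bounded_iff)
  have gap: "pole_gap Q z > 0" if "z \<in> K" for z
    using pole_gap_pos[of Q z] A[of z] Q K that by blast
  show "\<exists>M. M summable_on - {0} \<and> (\<forall>m\<in>- {0}. \<forall>z\<in>K.
     norm ((-1) powi m * Q powi (m\<^sup>2) * g z powi m / (1 - z * Q powi (2 * m))) \<le> M m)"
  proof (cases "K = {}")
    case True
    thus ?thesis by (intro exI[of _ "\<lambda>_. 0"]) auto
  next
    case False
    then obtain z0 where z0: "z0 \<in> K" by blast
    have Cpos: "C > 0"
      using C[OF z0] gap[OF z0] by (smt (verit) divide_pos_pos norm_ge_zero real_norm_def)
    have le: "norm (g z) \<le> C" "norm (1 / g z) \<le> C" "1 / C \<le> pole_gap Q z" if "z \<in> K" for z
    proof -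
      have *: "norm (g z) + norm (1 / g z) + 1 / pole_gap Q z \<le> C"
        using C[OF that] by simp
      have "1 / pole_gap Q z > 0" using gap[OF that] by simp
      with * show "norm (g z) \<le> C" "norm (1 / g z) \<le> C"
        using norm_ge_zero[of "g z"] norm_ge_zero[of "1 / g z"] by linarith+
      have "1 / pole_gap Q z \<le> C"
        using * norm_ge_zero[of "g z"] norm_ge_zero[of "1 / g z"] by linarith
      thus "1 / C \<le> pole_gap Q z"
        using gap[OF that] Cpos by (simp add: field_simps)
    qed
    show ?thesis
    proof (intro exI conjI ballI)
      show "(\<lambda>m::int. norm Q ^ nat (m\<^sup>2) * C ^ nat \<bar>m\<bar> * (1 / (1 / C))) summable_on - {0}"
        using Q Cpos by (intro summable_on_cmult_left summable_on_gaussian) auto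
      show "norm ((-1) powi m * Q powi (m\<^sup>2) * g z powi m / (1 - z * Q powi (2 * m)))
             \<le> norm Q ^ nat (m\<^sup>2) * C ^ nat \<bar>m\<bar> * (1 / (1 / C))" if "m \<in> -{0}" "z \<in> K" for m z
        using le[OF that(2)] that(1) Q Cpos by (intro norm_appell_term_le) auto
    qed
  qed
qed

section \<open>Functional equations from shifting or reflecting the summation index\<close>

lemma infsum_int_shift:
  fixes f :: "int \<Rightarrow> 'a :: {comm_monoid_add, t2_space}"
  shows "(\<Sum>\<^sub>\<infinity>m. f (m + k)) = (\<Sum>\<^sub>\<infinity>m. f m)"
  by (rule infsum_reindex_bij_witness[of _ "\<lambda>m. m - k" "\<lambda>m. m + k"]) auto

lemma infsum_int_uminus:
  fixes f :: "int \<Rightarrow> 'a :: {comm_monoid_add, t2_space}"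
  shows "(\<Sum>\<^sub>\<infinity>m. f (- m)) = (\<Sum>\<^sub>\<infinity>m. f m)"
  by (rule infsum_reindex_bij_witness[of _ "\<lambda>m. - m" "\<lambda>m. - m"]) auto

lemma powi_square_shift:
  assumes "Q \<noteq> (0 :: complex)"
  shows "Q powi ((m + 1)\<^sup>2) = Q powi (m\<^sup>2) * (Q\<^sup>2) powi m * Q"
proof -
  have "(m + 1)\<^sup>2 = m\<^sup>2 + 2 * m + 1" by (simp add: power2_eq_square algebra_simps)
  thus ?thesis using assms by (simp add: power_int_add power_int_mult)
qed

lemma theta_shift:
  assumes "Q \<noteq> 0" "x \<noteq> 0"
  shows "theta Q (Q\<^sup>2 * x) = - theta Q x / (Q * x)"
proof -
  have "theta Q x = (\<Sum>\<^sub>\<infinity>m::int. (-1) powi (m + 1) * Q powi ((m + 1)\<^sup>2) * x powi (m + 1))"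
    unfolding theta_def
    by (rule infsum_int_shift[where f = "\<lambda>m. (-1) powi m * Q powi (m\<^sup>2) * x powi m", symmetric])
  also have "\<dots> = (\<Sum>\<^sub>\<infinity>m::int. (- (Q * x)) * ((-1) powi m * Q powi (m\<^sup>2) * (Q\<^sup>2 * x) powi m))"
    using assms by (intro infsum_cong) (simp add: powi_square_shift power_int_add power_int_mult_distrib)
  also have "\<dots> = - (Q * x) * theta Q (Q\<^sup>2 * x)"
    unfolding theta_def by (rule infsum_cmult_right')
  finally show ?thesis using assms by (simp add: field_simps)
qed

lemma theta_minus: "theta Q (1 / x) = theta Q x"
proof -
  have "theta Q (1 / x) = (\<Sum>\<^sub>\<infinity>m::int. (-1) powi (- m) * Q powi ((- m)\<^sup>2) * (1 / x) powi (- m))"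
    unfolding theta_def
    by (rule infsum_int_uminus[where f = "\<lambda>m. (-1) powi m * Q powi (m\<^sup>2) * (1 / x) powi m", symmetric])
  also have "\<dots> = theta Q x"
    unfolding theta_def
    by (intro infsum_cong) (simp add: power_int_minus power_int_one_over flip: power_int_inverse)
  finally show ?thesis .
qed

text \<open>Shifting the index multiplies z by \<open>Q ^ 2\<close> in the denominators, and the
  linear term of \<open>(m + 1) ^ 2\<close> is absorbed by x. A period in z thus costs a period in
  x, which \<open>appell_shift_x\<close> can undo.\<close>

lemma appell_shift:
  assumes "Q \<noteq> 0" "x \<noteq> 0"
  shows "appell Q x (Q\<^sup>2 * z) = - (Q / x) * appell Q (x / Q\<^sup>2) z"
proof -
  have "appell Q (x / Q\<^sup>2) z = (\<Sum>\<^sub>\<infinity>m::int. (-1) powi (m + 1) * Q powi ((m + 1)\<^sup>2) * (x / Q\<^sup>2) powi (m + 1)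
      / (1 - z * Q powi (2 * (m + 1))))"
    unfolding appell_def
    by (rule infsum_int_shift[where f = "\<lambda>m. (-1) powi m * Q powi (m\<^sup>2) * (x / Q\<^sup>2) powi m /
       (1 - z * Q powi (2 * m))", symmetric])
  also have "\<dots> = (\<Sum>\<^sub>\<infinity>m::int. (- (x / Q)) * ((-1) powi m * Q powi (m\<^sup>2) * x powi m
       / (1 - (Q\<^sup>2 * z) * Q powi (2 * m))))"
  proof (intro infsum_cong)
    fix m :: int
    have "Q powi (2 * (m + 1)) = Q\<^sup>2 * Q powi (2 * m)"
      using assms by (simp add: power_int_add distrib_left)
    thus "(-1) powi (m + 1) * Q powi ((m + 1)\<^sup>2) * (x / Q\<^sup>2) powi (m + 1)
      / (1 - z * Q powi (2 * (m + 1))) = (- (x / Q)) * ((-1) powi m * Q powi (m\<^sup>2) * x powi m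
       / (1 - (Q\<^sup>2 * z) * Q powi (2 * m)))"
      using assms
      by (simp add: powi_square_shift power_int_add power_int_divide_distrib) (simp add: power2_eq_square mult_ac)
  qed
  also have "\<dots> = - (x / Q) * appell Q x (Q\<^sup>2 * z)"
    unfolding appell_def by (rule infsum_cmult_right')
  finally show ?thesis using assms by (simp add: field_simps)
qed

lemma one_minus_powi_nonzero:
  fixes Q z :: complex
  assumes "norm Q < 1" "Q \<noteq> 0" "norm Q ^ 2 < norm z" "norm z * norm Q ^ 2 < 1" "z \<noteq> 1"
  shows "1 - z * Q powi (2 * m) \<noteq> 0"
proof (cases "m = 0")
  case False
  thus ?thesis using pole_gap_le[of Q m z] pole_gap_pos[of Q z] assms by auto
qed (use assms in auto)

text \<open>Split 1 as \<open>z * Q powi (2 * m) + (1 - z * Q powi (2 * m))\<close> in the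
  numerator: the first part restores x, the second cancels the denominator and leaves a theta
  function.\<close>

lemma appell_shift_x:
  assumes "norm Q < 1" "Q \<noteq> 0" "x \<noteq> 0" "norm Q ^ 2 < norm z" "norm z * norm Q ^ 2 < 1" "z \<noteq> 1"
  shows "appell Q (x / Q\<^sup>2) z = z * appell Q x z + theta Q (x / Q\<^sup>2)"
proof -
  have "appell Q (x / Q\<^sup>2) z = (\<Sum>\<^sub>\<infinity>m::int. z * ((-1) powi m * Q powi (m\<^sup>2) * x powi m / (1 - z * Q powi (2 * m)))
       + (-1) powi m * Q powi (m\<^sup>2) * (x / Q\<^sup>2) powi m)"
    unfolding appell_def
  proof (intro infsum_cong)
    fix m :: int
    have 1: "1 - z * Q powi (2 * m) \<noteq> 0"
      using one_minus_powi_nonzero assms by blast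
    have 2: "x powi m = (x / Q\<^sup>2) powi m * Q powi (2 * m)"
      using assms by (simp add: power_int_divide_distrib power_int_mult)
    show "(-1) powi m * Q powi (m\<^sup>2) * (x / Q\<^sup>2) powi m / (1 - z * Q powi (2 * m)) =
        z * ((-1) powi m * Q powi (m\<^sup>2) * x powi m / (1 - z * Q powi (2 * m)))
       + (-1) powi m * Q powi (m\<^sup>2) * (x / Q\<^sup>2) powi m"
      unfolding 2 using 1 by (simp add: divide_simps) (simp add: algebra_simps)
  qed
  also have "\<dots> = z * appell Q x z + theta Q (x / Q\<^sup>2)"
    unfolding appell_def theta_def using assms
    by (subst infsum_add; (intro summable_on_cmult_right appell_summable theta_summable)?)
       (auto simp only: infsum_cmult_right' divide_eq_0_iff power_eq_0_iff)
  finally show ?thesis .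
qed

text \<open>Reversing the index replaces \<open>w = z * Q powi (2 * m)\<close> by its inverse, and 1
  / (1 - 1 / w) = 1 - 1 / (1 - w).\<close>

lemma appell_minus:
  assumes "norm Q < 1" "Q \<noteq> 0" "x \<noteq> 0" "norm Q ^ 2 < norm z" "norm z * norm Q ^ 2 < 1" "z \<noteq> 1"
  shows "appell Q (1 / x) (1 / z) = theta Q x - appell Q x z"
proof -
  have "appell Q (1 / x) (1 / z) = (\<Sum>\<^sub>\<infinity>m::int. (-1) powi (-m) * Q powi ((-m)\<^sup>2) * (1 / x) powi (-m)
      / (1 - (1 / z) * Q powi (2 * (- m))))"
    unfolding appell_def
    by (rule infsum_int_uminus[where f = "\<lambda>m. (-1) powi m * Q powi (m\<^sup>2) * (1 / x) powi m
      / (1 - (1 / z) * Q powi (2 * m))", symmetric])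
  also have "\<dots> = (\<Sum>\<^sub>\<infinity>m::int. (-1) powi m * Q powi (m\<^sup>2) * x powi m
       - (-1) powi m * Q powi (m\<^sup>2) * x powi m / (1 - z * Q powi (2 * m)))"
  proof (intro infsum_cong)
    fix m :: int
    define w where "w = z * Q powi (2 * m)"
    have w: "1 - w \<noteq> 0" "w \<noteq> 0" "z \<noteq> 0"
      using one_minus_powi_nonzero[of Q z m] assms by (auto simp: w_def)
    have 1: "(1 / z) * Q powi (2 * (- m)) = 1 / w"
      by (simp add: w_def power_int_minus field_simps)
    have 2: "1 / (1 - 1 / w) = 1 - 1 / (1 - w)"
      using w by (simp add: divide_simps) (simp add: algebra_simps)
    have "(-1) powi (-m) * Q powi ((-m)\<^sup>2) * (1 / x) powi (-m) / (1 - (1 / z) * Q powi (2 * (- m)))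
        = (-1) powi m * Q powi (m\<^sup>2) * x powi m * (1 / (1 - 1 / w))"
      unfolding 1 by (simp add: power_int_minus power_int_one_over flip: power_int_inverse)
    also have "\<dots> = (-1) powi m * Q powi (m\<^sup>2) * x powi m
       - (-1) powi m * Q powi (m\<^sup>2) * x powi m / (1 - w)"
      unfolding 2 by (simp add: right_diff_distrib)
    finally show "(-1) powi (-m) * Q powi ((-m)\<^sup>2) * (1 / x) powi (-m) / (1 - (1 / z) * Q powi (2 * (- m)))
        = (-1) powi m * Q powi (m\<^sup>2) * x powi m
       - (-1) powi m * Q powi (m\<^sup>2) * x powi m / (1 - z * Q powi (2 * m))"
      unfolding w_def .
  qed
  also have "\<dots> = theta Q x - appell Q x z"
    unfolding appell_def theta_def diff_conv_add_uminus using assms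
    by (subst infsum_add) (auto intro!: summable_on_uminus[THEN iffD2] appell_summable theta_summable simp: infsum_uminus)
  finally show ?thesis .
qed

section \<open>The Jacobi triple product and its consequences\<close>

definition qfact :: "complex \<Rightarrow> nat \<Rightarrow> complex" where
  "qfact p n = (\<Prod>k<n. 1 - p * p ^ k)"

text \<open>The reciprocal of (p; p)_n, extended by 0 to negative n. The recurrence
  \<open>qfact_inv_rec\<close> then holds for all integers, and the finite triple product can be
  summed over all of them.\<close>

definition qfact_inv :: "complex \<Rightarrow> int \<Rightarrow> complex" where
  "qfact_inv p n = (if n < 0 then 0 else 1 / qfact p (nat n))"

lemma qfact_nonzero:
  assumes "norm p < 1"
  shows "qfact p n \<noteq> 0"
proof -
  have "p * p ^ k \<noteq> 1" for k
    using qpoch_self_nonzero[OF assms] qpoch_inf_eq_0_iff[OF assms] by blast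
  thus ?thesis by (auto simp: qfact_def)
qed

lemma qfact_inv_rec:
  assumes "norm p < 1"
  shows "qfact_inv p (n - 1) = (1 - p powi n) * qfact_inv p n"
proof -
  consider "n < 0" | "n = 0" | "n > 0" by linarith
  thus ?thesis
  proof cases
    case 3
    then obtain k where k: "n = int (Suc k)"
      by (metis gr0_implies_Suc zero_less_imp_eq_int)
    have "qfact p (Suc k) = qfact p k * (1 - p * p ^ k)"
      by (simp add: qfact_def)
    moreover have "p powi n = p * p ^ k"
      unfolding k power_int_of_nat by simp
    ultimately show ?thesis
      using qfact_nonzero[OF assms, of k] qfact_nonzero[OF assms, of "Suc k"]
      by (simp add: qfact_inv_def k nat_add_distrib)
  qed (auto simp: qfact_inv_def)
qed

text \<open>The coefficient of x^k in the finite triple product: (-1)^k Q^(k^2) times the Gaussian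
  binomial coefficient of 2N over N + k to the base Q^2.\<close>

definition jtp_coeff :: "complex \<Rightarrow> nat \<Rightarrow> int \<Rightarrow> complex" where
  "jtp_coeff Q N k = (-1) powi k * Q powi (k\<^sup>2) * qfact (Q\<^sup>2) (2 * N) *
     qfact_inv (Q\<^sup>2) (int N - k) * qfact_inv (Q\<^sup>2) (int N + k)"

text \<open>The effect on coefficients of multiplying by the next pair of factors, (1 - Q^(2N+1)
  x)(1 - Q^(2N+1) / x) = 1 + Q^(4N+2) - Q^(2N+1) (x + 1/x).\<close>

lemma jtp_coeff_Suc:
  assumes Q: "norm Q < 1" "Q \<noteq> 0"
  shows "jtp_coeff Q (Suc N) k = (1 + Q ^ (4 * N + 2)) * jtp_coeff Q N k
           - Q ^ (2 * N + 1) * (jtp_coeff Q N (k - 1) + jtp_coeff Q N (k + 1))"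
proof -
  define p where "p = Q\<^sup>2"
  have p: "norm p < 1" "p \<noteq> 0" using Q by (auto simp: p_def norm_power power_less_one_iff)
  define a where "a = p ^ N"
  define b where "b = p powi k"
  have [simp]: "b \<noteq> 0" using p by (simp add: b_def)
  define U where "U = qfact_inv p (int N + 1 - k)"
  define V where "V = qfact_inv p (int N + 1 + k)"
  have powi: "p powi (int N + 1 - k) = a * p / b" "p powi (int N + 1 + k) = a * p * b"
    "p powi (int N - k) = a / b" "p powi (int N + k) = a * b"
    using p by (simp_all add: a_def b_def power_int_add power_int_diff)
  have u1: "qfact_inv p (int N - k) = (1 - a * p / b) * U"
    using qfact_inv_rec[OF p(1), of "int N + 1 - k"] unfolding powi U_def
    by (simp add: algebra_simps)
  have u2: "qfact_inv p (int N + k) = (1 - a * p * b) * V"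
    using qfact_inv_rec[OF p(1), of "int N + 1 + k"] unfolding powi V_def
    by (simp add: algebra_simps)
  have u3: "qfact_inv p (int N - (k + 1)) = (1 - a / b) * ((1 - a * p / b) * U)"
    using qfact_inv_rec[OF p(1), of "int N - k"] unfolding powi u1
    by (simp add: algebra_simps)
  have u4: "qfact_inv p (int N + (k - 1)) = (1 - a * b) * ((1 - a * p * b) * V)"
    using qfact_inv_rec[OF p(1), of "int N + k"] unfolding powi u2
    by (simp add: algebra_simps)
  have u5: "qfact_inv p (int N - (k - 1)) = U" "qfact_inv p (int N + (k + 1)) = V"
    by (simp_all add: U_def V_def algebra_simps)
  have u6: "qfact_inv p (int (Suc N) - k) = U" "qfact_inv p (int (Suc N) + k) = V"
    by (simp_all add: U_def V_def algebra_simps)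
  have f: "qfact p (2 * Suc N) = qfact p (2 * N) * (1 - a\<^sup>2 * p) * (1 - a\<^sup>2 * p\<^sup>2)"
  proof -
    have "p ^ (2 * N) = a\<^sup>2" by (simp add: a_def power_mult[symmetric] mult.commute)
    hence "p * p ^ (2 * N) = a\<^sup>2 * p" "p * p ^ Suc (2 * N) = a\<^sup>2 * p\<^sup>2"
      by (simp_all add: power2_eq_square)
    moreover have "qfact p (Suc (Suc (2 * N))) =
        qfact p (2 * N) * (1 - p * p ^ (2 * N)) * (1 - p * p ^ Suc (2 * N))"
      by (simp only: qfact_def prod.lessThan_Suc)
    ultimately show ?thesis by simp
  qed
  have s1: "Q powi ((k + 1)\<^sup>2) = Q powi (k\<^sup>2) * b * Q"
    using powi_square_shift[OF Q(2), of k] by (simp add: b_def p_def)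
  have s2: "Q powi ((k - 1)\<^sup>2) = Q powi (k\<^sup>2) * Q / b"
  proof -
    have "Q powi (k\<^sup>2) = Q powi ((k - 1)\<^sup>2) * (b / p) * Q"
      using powi_square_shift[OF Q(2), of "k - 1"] p by (simp add: b_def p_def power_int_diff)
    thus ?thesis using Q by (simp add: p_def power2_eq_square field_simps)
  qed
  have e1: "(-1 :: complex) powi (k + 1) = - ((-1) powi k)" "(-1 :: complex) powi (k - 1) = - ((-1) powi k)"
    by (simp_all add: power_int_add power_int_diff)
  have q: "Q ^ (4 * N + 2) = a\<^sup>2 * p" "Q ^ (2 * N + 1) = a * Q"
  proof -
    have "a = Q ^ (2 * N)" by (simp add: a_def p_def power_mult)
    thus "Q ^ (4 * N + 2) = a\<^sup>2 * p" "Q ^ (2 * N + 1) = a * Q"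
      by (simp_all add: p_def power_mult[symmetric] power_add[symmetric])
  qed
  \<comment> \<open>All q-factorials have been reduced to \<open>U\<close> and \<open>V\<close>; in
    terms of a = p^N and b = p^k, this polynomial identity is what the recurrence amounts
    to.\<close>
  have key: "(1 - a\<^sup>2 * p) * (1 - a\<^sup>2 * p\<^sup>2) * (b * b) =
     (1 + a\<^sup>2 * p) * ((b - a * p) * (1 - a * p * b)) * b
     + a * p * ((1 - a * b) * (1 - a * p * b)) * b + a * p * ((b - a) * (b - a * p)) * b"
    by (simp add: power2_eq_square algebra_simps)
  have "jtp_coeff Q (Suc N) k * (b * b) = ((-1) powi k * Q powi (k\<^sup>2) * qfact p (2 * N) * U * V) *
      ((1 - a\<^sup>2 * p) * (1 - a\<^sup>2 * p\<^sup>2) * (b * b))"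
    unfolding jtp_coeff_def p_def[symmetric] u6 f by (simp add: mult_ac)
  also have "\<dots> = ((1 + Q ^ (4 * N + 2)) * jtp_coeff Q N k
           - Q ^ (2 * N + 1) * (jtp_coeff Q N (k - 1) + jtp_coeff Q N (k + 1))) * (b * b)"
    unfolding key q jtp_coeff_def p_def[symmetric] u1 u2 u3 u4 u5 s1 s2 e1
    by (simp add: divide_simps) (simp add: p_def power2_eq_square algebra_simps)
  finally show ?thesis by simp
qed

lemma bij_plus_int: "bij (\<lambda>k::int. k + c)" and bij_minus_int: "bij (\<lambda>k::int. k - c)"
  by (rule bij_betw_byWitness[of _ "\<lambda>k. k - c"]; simp)
     (rule bij_betw_byWitness[of _ "\<lambda>k. k + c"]; simp)

lemma finite_jacobi_triple_product:
  assumes Q: "norm Q < 1" "Q \<noteq> 0" and x: "x \<noteq> 0"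
  shows "((\<lambda>k. jtp_coeff Q N k * x powi k) has_sum
           (\<Prod>i<N. (1 - Q * x * (Q\<^sup>2) ^ i) * (1 - Q / x * (Q\<^sup>2) ^ i))) UNIV"
proof (induction N)
  case 0
  have "((\<lambda>k. jtp_coeff Q 0 k * x powi k) has_sum (\<Sum>k\<in>{0}. jtp_coeff Q 0 k * x powi k)) UNIV"
    by (rule has_sum_finite_neutralI[where B = "{0}"]) (auto simp: jtp_coeff_def qfact_inv_def)
  thus ?case by (simp add: jtp_coeff_def qfact_inv_def qfact_def)
next
  case (Suc N)
  let ?S = "\<Prod>i<N. (1 - Q * x * (Q\<^sup>2) ^ i) * (1 - Q / x * (Q\<^sup>2) ^ i)"
  let ?f = "\<lambda>k. jtp_coeff Q N k * x powi k"
  have "((\<lambda>k. ?f (k - 1)) has_sum ?S) UNIV"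
    using has_sum_reindex_bij_betw[of "\<lambda>k. k - 1" UNIV UNIV ?f ?S] Suc.IH
    by (simp add: bij_plus_int bij_minus_int)
  moreover have "((\<lambda>k. ?f (k + 1)) has_sum ?S) UNIV"
    using has_sum_reindex_bij_betw[of "\<lambda>k. k + 1" UNIV UNIV ?f ?S] Suc.IH
    by (simp add: bij_plus_int bij_minus_int)
  ultimately have "((\<lambda>k. (1 + Q ^ (4 * N + 2)) * ?f k + ((- (Q ^ (2 * N + 1)) * x) * ?f (k - 1) +
       (- (Q ^ (2 * N + 1)) / x) * ?f (k + 1)))
     has_sum ((1 + Q ^ (4 * N + 2)) * ?S + ((- (Q ^ (2 * N + 1)) * x) * ?S + (- (Q ^ (2 * N + 1)) / x) * ?S))) UNIV"
    by (intro has_sum_add has_sum_cmult_right Suc.IH)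
  also have "(\<lambda>k. (1 + Q ^ (4 * N + 2)) * ?f k + ((- (Q ^ (2 * N + 1)) * x) * ?f (k - 1) +
       (- (Q ^ (2 * N + 1)) / x) * ?f (k + 1))) = (\<lambda>k. jtp_coeff Q (Suc N) k * x powi k)"
    unfolding jtp_coeff_Suc[OF Q] using x
    by (intro ext) (simp add: power_int_add power_int_diff divide_simps, simp add: algebra_simps)
  also have "(1 + Q ^ (4 * N + 2)) * ?S + ((- (Q ^ (2 * N + 1)) * x) * ?S + (- (Q ^ (2 * N + 1)) / x) * ?S)
     = ?S * ((1 - Q * x * (Q\<^sup>2) ^ N) * (1 - Q / x * (Q\<^sup>2) ^ N))"
  proof -
    have 1: "Q * (Q\<^sup>2) ^ N = Q ^ (2 * N + 1)" by (simp add: power_mult)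
    have 2: "Q ^ (4 * N + 2) = Q ^ (2 * N + 1) * Q ^ (2 * N + 1)"
      by (simp add: power_add[symmetric])
    have "(1 - Q * x * (Q\<^sup>2) ^ N) * (1 - Q / x * (Q\<^sup>2) ^ N) =
        (1 - x * (Q * (Q\<^sup>2) ^ N)) * (1 - (Q * (Q\<^sup>2) ^ N) / x)" by (simp add: mult_ac)
    also have "\<dots> = 1 + Q ^ (4 * N + 2) - Q ^ (2 * N + 1) * x - Q ^ (2 * N + 1) / x"
      unfolding 1 2 using x by (simp add: field_simps)
    finally have 3: "(1 - Q * x * (Q\<^sup>2) ^ N) * (1 - Q / x * (Q\<^sup>2) ^ N) =
      1 + Q ^ (4 * N + 2) - Q ^ (2 * N + 1) * x - Q ^ (2 * N + 1) / x" .
    show ?thesis unfolding 3 by (simp add: ring_distribs)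
  qed
  finally show ?case by simp
qed

text \<open>The limit of the finite form by dominated convergence: the q-factorials and their
  reciprocals are bounded, so a Gaussian dominates the terms uniformly in N. The sum over k then
  converges uniformly in N and the two limits may be exchanged.\<close>

lemma jacobi_triple_product:
  assumes Q: "norm Q < 1" "Q \<noteq> 0" and x: "x \<noteq> 0"
  shows "theta Q x = jprod (Q * x) (Q\<^sup>2)"
proof -
  define p where "p = Q\<^sup>2"
  have p: "norm p < 1" "p \<noteq> 0" using Q by (auto simp: p_def norm_power power_less_one_iff)
  have lim: "qfact p \<longlonglongrightarrow> qpoch_inf p p"
    using qpoch_tendsto[OF p(1), of p] by (simp add: qfact_def[abs_def])
  have nz: "qpoch_inf p p \<noteq> 0" by (rule qpoch_self_nonzero[OF p(1)])
  have lim': "(\<lambda>n. 1 / qfact p n) \<longlonglongrightarrow> 1 / qpoch_inf p p"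
    by (intro tendsto_intros lim nz)
  obtain B1 where B1: "B1 > 0" "\<And>n. norm (qfact p n) \<le> B1"
    using convergent_imp_Bseq[OF convergentI[OF lim]] by (auto simp: Bseq_def)
  obtain B2 where B2: "B2 > 0" "\<And>n. norm (1 / qfact p n) \<le> B2"
    using convergent_imp_Bseq[OF convergentI[OF lim']] by (auto simp: Bseq_def)
  have B2': "norm (qfact_inv p n) \<le> B2" for n
    using B2 by (auto simp: qfact_inv_def)
  define C where "C = norm x + norm (1 / x)"
  define M where "M = (\<lambda>k::int. norm Q ^ nat (k\<^sup>2) * C ^ nat \<bar>k\<bar> * (B1 * B2 * B2))"
  have M: "M summable_on UNIV"
    unfolding M_def C_def using Q by (intro summable_on_cmult_left summable_on_gaussian) auto
  have le: "norm (jtp_coeff Q N k * x powi k) \<le> M k" for N k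
  proof -
    have "jtp_coeff Q N k * x powi k = ((-1) powi k * Q powi (k\<^sup>2) * x powi k) *
        (qfact p (2 * N) * qfact_inv p (int N - k) * qfact_inv p (int N + k))"
      by (simp add: jtp_coeff_def p_def)
    also have "norm \<dots> \<le> (norm Q ^ nat (k\<^sup>2) * C ^ nat \<bar>k\<bar>) * (B1 * B2 * B2)"
      unfolding norm_mult[of _ "qfact p (2 * N) * _ * _"]
    proof (intro mult_mono)
      show "norm ((-1) powi k * Q powi (k\<^sup>2) * x powi k) \<le> norm Q ^ nat (k\<^sup>2) * C ^ nat \<bar>k\<bar>"
        using Q by (intro norm_gaussian_term_le) (auto simp: C_def)
      show "norm (qfact p (2 * N) * qfact_inv p (int N - k) * qfact_inv p (int N + k)) \<le> B1 * B2 * B2"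
        unfolding norm_mult using B1 B2 B2' by (intro mult_mono) auto
    qed (auto simp: C_def)
    finally show ?thesis by (simp add: M_def)
  qed
  have ul: "uniform_limit UNIV (\<lambda>X N. \<Sum>k\<in>X. jtp_coeff Q N k * x powi k)
     (\<lambda>N. \<Prod>i<N. (1 - Q * x * p ^ i) * (1 - Q / x * p ^ i)) (finite_subsets_at_top UNIV)"
    unfolding p_def
    by (rule Weierstrass_m_test_general'[OF le _ M]) (use finite_jacobi_triple_product[OF Q x] in auto)
  define t where "t = (\<lambda>k::int. (-1) powi k * Q powi (k\<^sup>2) * x powi k)"
  have lim_u: "(\<lambda>N. qfact_inv p (int N + k)) \<longlonglongrightarrow> 1 / qpoch_inf p p" for k
  proof -
    have "filterlim (\<lambda>N. nat (int N + k)) at_top sequentially"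
      unfolding filterlim_at_top
    proof
      show "eventually (\<lambda>N. Z \<le> nat (int N + k)) sequentially" for Z
        by (rule eventually_sequentiallyI[of "nat (int Z - k)"]) auto
    qed
    hence "(\<lambda>N. 1 / qfact p (nat (int N + k))) \<longlonglongrightarrow> 1 / qpoch_inf p p"
      by (rule filterlim_compose[OF lim'])
    moreover have "eventually (\<lambda>N. 1 / qfact p (nat (int N + k)) = qfact_inv p (int N + k)) sequentially"
      by (intro eventually_sequentiallyI[of "nat (-k)"]) (auto simp: qfact_inv_def)
    ultimately show ?thesis by (rule Lim_transform_eventually)
  qed
  have lim2: "(\<lambda>N. qfact p (2 * N)) \<longlonglongrightarrow> qpoch_inf p p"
    by (rule filterlim_compose[OF lim]) (auto intro!: filterlim_subseq simp: strict_mono_def)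
  have lim_c: "(\<lambda>N. jtp_coeff Q N k * x powi k) \<longlonglongrightarrow> t k * (1 / qpoch_inf p p)" for k
  proof -
    have "(\<lambda>N. t k * (qfact p (2 * N) * qfact_inv p (int N + (- k)) * qfact_inv p (int N + k)))
       \<longlonglongrightarrow> t k * (qpoch_inf p p * (1 / qpoch_inf p p) * (1 / qpoch_inf p p))"
      by (intro tendsto_intros lim2 lim_u)
    thus ?thesis using nz by (simp add: t_def jtp_coeff_def p_def mult_ac)
  qed
  have "(\<lambda>N. \<Prod>i<N. (1 - Q * x * p ^ i) * (1 - Q / x * p ^ i)) \<longlonglongrightarrow> theta Q x * (1 / qpoch_inf p p)"
  proof (rule swap_uniform_limit'[where F = "finite_subsets_at_top UNIV" and S = UNIV])
    show "uniform_limit UNIV (\<lambda>X N. \<Sum>k\<in>X. jtp_coeff Q N k * x powi k)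
     (\<lambda>N. \<Prod>i<N. (1 - Q * x * p ^ i) * (1 - Q / x * p ^ i)) (finite_subsets_at_top UNIV)"
      by (rule ul)
    show "\<forall>\<^sub>F X in finite_subsets_at_top UNIV. (\<lambda>N. \<Sum>k\<in>X. jtp_coeff Q N k * x powi k)
       \<longlonglongrightarrow> (\<Sum>k\<in>X. t k * (1 / qpoch_inf p p))"
      by (intro always_eventually allI tendsto_sum lim_c)
    have "((\<lambda>k. t k * (1 / qpoch_inf p p)) has_sum theta Q x * (1 / qpoch_inf p p)) UNIV"
      using theta_summable[OF Q x, of UNIV] unfolding theta_def t_def
      by (intro has_sum_cmult_left has_sum_infsum)
    thus "((\<lambda>X. \<Sum>k\<in>X. t k * (1 / qpoch_inf p p)) \<longlongrightarrow> theta Q x * (1 / qpoch_inf p p))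
       (finite_subsets_at_top UNIV)"
      by (simp add: has_sum_def)
  qed auto
  moreover have "(\<lambda>N. \<Prod>i<N. (1 - Q * x * p ^ i) * (1 - Q / x * p ^ i)) \<longlonglongrightarrow>
      qpoch_inf (Q * x) p * qpoch_inf (Q / x) p"
    unfolding prod.distrib by (intro tendsto_mult qpoch_tendsto p)
  ultimately have "theta Q x * (1 / qpoch_inf p p) = qpoch_inf (Q * x) p * qpoch_inf (Q / x) p"
    by (rule LIMSEQ_unique)
  moreover have "p / (Q * x) = Q / x" using Q by (simp add: p_def power2_eq_square)
  ultimately show ?thesis using nz by (simp add: jprod_def p_def field_simps)
qed

text \<open>The partial fraction expansion of the reciprocal theta function. At x = Q the correction
  in \<open>appell_shift_x\<close> is \<open>theta Q (1 / Q)\<close>, which is zero, so the sum and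
  \<open>jprod\<close> have inverse multipliers and their product is elliptic. The pole at 1 meets
  the zero of the theta function, and the constant is read off there.\<close>

lemma appell_self:
  assumes Q: "norm Q < 1" "Q \<noteq> 0" and y: "norm Q ^ 2 < norm y" "norm y * norm Q ^ 2 < 1" "y \<noteq> 1"
  shows "appell Q Q y * jprod y (Q\<^sup>2) = qpoch_inf (Q\<^sup>2) (Q\<^sup>2) ^ 3"
proof -
  define p where "p = Q\<^sup>2"
  have p: "norm p < 1" "p \<noteq> 0" "norm p = norm Q ^ 2"
    using Q by (auto simp: p_def norm_power power_less_one_iff)
  define A where "A = {z :: complex. norm p < norm z \<and> norm z < 1 / norm p}"
  have A: "open A"
  proof -
    have "A = {z. norm p < norm z} \<inter> {z. norm z < 1 / norm p}" by (auto simp: A_def)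
    thus ?thesis by (simp only:) (intro open_Int open_Collect_less continuous_intros)
  qed
  have in_A: "norm Q ^ 2 < norm z" "norm z * norm Q ^ 2 < 1" "z \<noteq> 0" if "z \<in> A" for z
    using that p Q by (auto simp: A_def pos_less_divide_eq)
  have hol0: "(\<lambda>z. appell0 Q Q z) holomorphic_on A"
    using in_A by (intro appell0_holomorphic Q A holomorphic_intros) (use Q in auto)
  have holj: "(\<lambda>z. jprod z p) holomorphic_on A"
    using in_A by (intro holomorphic_intros p) auto
  have "1 \<in> A" using p Q by (simp add: A_def)
  define H where "H = (\<lambda>z. (1 / (1 - z) + appell0 Q Q z) * jprod z p)"
  have H_eq: "H z = appell Q Q z * jprod z p" if "z \<in> A" for z
    using appell_split[OF Q Q(2) in_A(1,2)[OF that]] by (simp add: H_def)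
  have isCont0: "isCont (\<lambda>z. appell0 Q Q z) 1" "isCont (\<lambda>z. jprod z p) 1"
    using hol0 holj A \<open>1 \<in> A\<close> by (meson continuous_on_eq_continuous_at holomorphic_on_imp_continuous_on)+
  have lim: "((\<lambda>z. (1 + (1 - z) * appell0 Q Q z) * (jprod z p / (1 - z))) \<longlongrightarrow>
       (1 + (1 - 1) * appell0 Q Q 1) * qpoch_inf p p ^ 3) (at 1)"
    by (intro tendsto_intros isCont0[unfolded isCont_def] jprod_div_tendsto p)
  have ev: "eventually (\<lambda>z. (1 + (1 - z) * appell0 Q Q z) * (jprod z p / (1 - z)) = H z) (at 1)"
    unfolding eventually_at_filter H_def by (intro always_eventually) (auto simp: field_simps)
  have limH: "(H \<longlongrightarrow> qpoch_inf p p ^ 3) (at 1)"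
    using Lim_transform_eventually[OF lim ev] by simp
  \<comment> \<open>The period shift at \<open>1 / Q\<close> combined with the symmetry under x -> 1
    / x makes this value equal to its negative.\<close>
  have th0: "theta Q (1 / Q) = 0"
    using theta_shift[of Q "1 / Q"] theta_minus[of Q Q] Q by (simp add: power2_eq_square)
  obtain c where c: "\<And>z. norm p < norm z \<Longrightarrow> norm z < 1 / norm p \<Longrightarrow> z \<notin> {1} \<Longrightarrow> H z = c"
    "\<And>k. k \<in> {1} \<Longrightarrow> norm p < norm k \<Longrightarrow> norm k < 1 / norm p \<Longrightarrow> (H \<longlongrightarrow> c) (at k)"
  proof (rule annulus_elliptic_constant[OF p(1,2), of "norm p" "1 / norm p" "{1}" H])
    show "H holomorphic_on {z. norm p < norm z \<and> norm z < 1 / norm p} - {1}"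
      unfolding A_def[symmetric] H_def
      by (intro holomorphic_intros holomorphic_on_subset[OF hol0] holomorphic_on_subset[OF holj]) auto
    show "((\<lambda>z. (z - k) * H z) \<longlongrightarrow> 0) (at k)" if "k \<in> {1}" for k
    proof -
      have "((\<lambda>z. (z - 1) * H z) \<longlongrightarrow> (1 - 1) * qpoch_inf p p ^ 3) (at 1)"
        by (intro tendsto_intros limH)
      thus ?thesis using that by simp
    qed
    fix z assume z: "norm p < norm z" "norm z < 1 / norm p * norm p" "z / p \<notin> {1}" "z \<notin> {1}"
    define w where "w = z / p"
    have zw: "z = p * w" using p by (simp add: w_def)
    have n: "0 < norm p" "norm p < 1" using p(1,2) by auto
    have z1: "norm z < 1" using z(2) n by simp
    have "1 < 1 / norm p" using n by simp
    with z1 have "norm z < 1 / norm p" by linarith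
    moreover have "norm p * norm p < norm z"
      using z(1) mult_strict_left_mono[OF n(2,1)] by simp
    ultimately have A': "z \<in> A" "w \<in> A"
      using z(1) z1 n by (simp_all add: A_def w_def norm_divide pos_less_divide_eq divide_strict_right_mono)
    have "appell Q Q z = - (Q / Q) * appell Q (Q / Q\<^sup>2) w"
      unfolding zw p_def by (rule appell_shift) (use Q in auto)
    also have "appell Q (Q / Q\<^sup>2) w = w * appell Q Q w"
      using appell_shift_x[OF Q Q(2) in_A(1,2)[OF A'(2)]] z(3) th0 Q
      by (simp add: w_def power2_eq_square)
    finally have 1: "appell Q Q z = - w * appell Q Q w" using Q by simp
    have 2: "jprod z p = - jprod w p / w"
      unfolding zw by (rule jprod_shift) (use p in_A[OF A'(2)] in auto)
    show "H (z / p) = H z"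
      unfolding w_def[symmetric] H_eq[OF A'(1)] H_eq[OF A'(2)] 1 2 using in_A(3)[OF A'(2)] by simp
  qed (use p in \<open>auto simp: power2_eq_square\<close>)
  have "c = qpoch_inf p p ^ 3"
    using LIM_unique[OF c(2)[of 1] limH] \<open>1 \<in> A\<close> by (auto simp: A_def)
  moreover have "y \<in> A" using y p Q by (auto simp: A_def pos_less_divide_eq)
  ultimately show ?thesis
    using c(1)[of y] H_eq[of y] y by (auto simp: A_def p_def)
qed

section \<open>Holomorphy, poles and half-period values of the logarithmic derivative of
  theta\<close>

lemma open_annulus: "open {z :: complex. r < norm z \<and> norm z < R}"
proof -
  have "{z :: complex. r < norm z \<and> norm z < R} = {z. r < norm z} \<inter> {z. norm z < R}" by auto
  thus ?thesis by (simp only:) (intro open_Int open_Collect_less continuous_intros)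
qed

lemma holomorphic_imp_tendsto:
  assumes "f holomorphic_on A" "open A" "z \<in> A"
  shows "(f \<longlongrightarrow> f z) (at z)"
  using assms holomorphic_on_imp_continuous_on continuous_on_eq_continuous_at isCont_def by blast

lemma logth_holomorphic:
  assumes "norm p < 1" "f holomorphic_on A" "\<And>z. z \<in> A \<Longrightarrow> f z \<noteq> 0"
    "\<And>z. z \<in> A \<Longrightarrow> norm p < norm (f z)" "\<And>z. z \<in> A \<Longrightarrow> norm (f z) * norm p < 1"
    "\<And>z. z \<in> A \<Longrightarrow> f z \<noteq> 1"
  shows "(\<lambda>z. logth p (f z)) holomorphic_on A"
  unfolding logth_def using assms
  by (intro holomorphic_intros lambert_holomorphic qpoch_nonzero_annulus qpoch_nonzero_norm)
     (auto simp: norm_divide)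

lemma logth_shift':
  assumes "norm p < 1" "p \<noteq> 0" "z \<noteq> 1" "1 \<le> norm z" "norm z * norm p < 1"
  shows "logth p (p * z) = logth p z - 1"
proof (rule logth_shift)
  show "qpoch_inf z p \<noteq> 0" using assms by (intro qpoch_nonzero_annulus) auto
  have "norm (1 / z) * norm p < 1"
    using assms by (simp add: norm_divide divide_less_eq)
  thus "qpoch_inf (1 / z) p \<noteq> 0" using assms by (intro qpoch_nonzero_annulus) auto
qed (use assms in auto)

lemma logth_minus':
  assumes "norm p < 1" "p \<noteq> 0" "z \<noteq> 1" "norm p < norm z" "norm z * norm p < 1"
  shows "logth p (1 / z) = 1 - logth p z"
proof (rule logth_minus)
  show nz: "z \<noteq> 0" using assms by auto
  show "qpoch_inf z p \<noteq> 0" using assms by (intro qpoch_nonzero_annulus) auto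
  have "norm (1 / z) * norm p < 1"
    using assms nz by (simp add: norm_divide divide_less_eq)
  thus "qpoch_inf (1 / z) p \<noteq> 0" using assms by (intro qpoch_nonzero_annulus) auto
qed (use assms in auto)

text \<open>\<open>lambert_rec\<close> splits off \<open>z / (1 - z)\<close>, the only part of
  \<open>logth p z\<close> that is singular near 1.\<close>

lemma logth_pole:
  assumes p: "norm p < 1" "p \<noteq> 0"
  shows "((\<lambda>z. (z - 1) * logth p z) \<longlongrightarrow> 1) (at 1)"
proof -
  have 1: "((\<lambda>z. lambert p z) \<longlongrightarrow> lambert p z0) (at z0)" if "norm z0 < 1" for z0
    using that by (intro holomorphic_imp_tendsto[where A = "ball 0 1"] lambert_holomorphic p qpoch_nonzero_norm
        holomorphic_intros) auto
  have 2: "((\<lambda>z. lambert p (g z)) \<longlongrightarrow> lambert p z0) F" if "norm z0 < 1" "(g \<longlongrightarrow> z0) F" for z0 g and F :: "complex filter"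
    by (rule isCont_tendsto_compose[OF _ that(2)]) (use 1[OF that(1)] in \<open>simp add: isCont_def\<close>)
  have "((\<lambda>z. (z - 1) * (lambert p (p / z) - lambert p (z * p)) + z) \<longlongrightarrow>
         (1 - 1) * (lambert p p - lambert p p) + 1) (at 1)"
    by (intro tendsto_intros 2) (use p in \<open>auto intro!: tendsto_eq_intros\<close>)
  moreover have "eventually (\<lambda>z. (z - 1) * (lambert p (p / z) - lambert p (z * p)) + z = (z - 1) * logth p z) (at 1)"
  proof -
    have "1 < 1 / norm p" using p by simp
    hence "eventually (\<lambda>z. z \<in> ball 0 (1 / norm p)) (at (1::complex))"
      by (intro eventually_at_in_open') auto
    moreover have "eventually (\<lambda>z. z \<noteq> 1) (at (1::complex))" by (simp add: eventually_at_filter)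
    ultimately show ?thesis
    proof eventually_elim
      case (elim z)
      have "qpoch_inf z p \<noteq> 0"
        using elim p by (intro qpoch_nonzero_annulus) (auto simp: pos_less_divide_eq)
      hence "lambert p z = z / (1 - z) + lambert p (z * p)" by (rule lambert_rec[OF p(1)])
      thus ?case using elim by (simp add: logth_def field_simps)
    qed
  qed
  ultimately show ?thesis by (rule Lim_transform_eventually[THEN tendsto_eq_rhs]) simp
qed

text \<open>Makes the description of \<open>logth\<close> precise; the addition formula uses it to
  expand a reciprocal theta function to first order at z = 1.\<close>

lemma jprod_has_derivative:
  assumes "norm p < 1" "z \<noteq> 0" "jprod z p \<noteq> 0"
  shows "((\<lambda>z. jprod z p) has_field_derivative (jprod z p * logth p z / z)) (at z)"
proof -
  have nz: "qpoch_inf z p \<noteq> 0" "qpoch_inf (p / z) p \<noteq> 0" "qpoch_inf p p \<noteq> 0"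
    using assms by (auto simp: jprod_def)
  have d: "((\<lambda>z. qpoch_inf z p) has_field_derivative deriv (\<lambda>z. qpoch_inf z p) a) (at a within S)" for a S
    using qpoch_inf_holomorphic[OF assms(1), of UNIV]
    by (metis UNIV_I holomorphic_derivI open_UNIV has_field_derivative_at_within)
  have 1: "z * deriv (\<lambda>z. qpoch_inf z p) z = - (lambert p z * qpoch_inf z p)"
    using lambert_logderiv[OF assms(1) nz(1)] nz by (simp add: field_simps)
  have 2: "p * deriv (\<lambda>z. qpoch_inf z p) (p / z) = - (z * lambert p (p / z) * qpoch_inf (p / z) p)"
    using lambert_logderiv[OF assms(1) nz(2)] nz assms by (simp add: field_simps)
  have "((\<lambda>z. jprod z p) has_field_derivative
      (deriv (\<lambda>z. qpoch_inf z p) z * qpoch_inf (p / z) p +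
        deriv (\<lambda>z. qpoch_inf z p) (p / z) * (- p / z\<^sup>2) * qpoch_inf z p) * qpoch_inf p p) (at z)"
    unfolding jprod_def
    by (rule derivative_eq_intros refl d DERIV_chain2[OF d] | use assms in \<open>simp add: power2_eq_square\<close>)+
  also have "(deriv (\<lambda>z. qpoch_inf z p) z * qpoch_inf (p / z) p +
        deriv (\<lambda>z. qpoch_inf z p) (p / z) * (- p / z\<^sup>2) * qpoch_inf z p) * qpoch_inf p p =
     ((z * deriv (\<lambda>z. qpoch_inf z p) z) * qpoch_inf (p / z) p / z -
        (p * deriv (\<lambda>z. qpoch_inf z p) (p / z)) * qpoch_inf z p / z\<^sup>2) * qpoch_inf p p"
    using assms by (simp add: field_simps)
  also have "\<dots> = jprod z p * logth p z / z"
    unfolding 1 2 using assms by (simp add: jprod_def logth_def field_simps power2_eq_square)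
  finally show ?thesis .
qed

text \<open>Kronecker's formula for a quotient of theta functions with -1 as second argument. Under
  y -> q y both the bracket and \<open>jprod (- y) q / jprod y q\<close> change sign, so their ratio
  is elliptic with nome q although the logarithmic derivatives have nome \<open>q ^ 2\<close>. The
  equation is cleared of denominators and so includes y = -1, where both sides vanish.\<close>

lemma kronecker_half_period:
  assumes q: "norm q < 1" "q \<noteq> 0" and y: "norm q < norm y" "norm y * norm q < 1" "y \<noteq> 1"
  shows "(1 / 2 - logth (q\<^sup>2) y + logth (q\<^sup>2) (q * y)) * jprod y q * jprod (- 1) q
           = qpoch_inf q q ^ 3 * jprod (- y) q"
proof (cases "y = -1")
  case True
  define p where "p = q\<^sup>2"
  have p: "norm p < 1" "p \<noteq> 0" "norm p = norm q ^ 2"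
    using q by (auto simp: p_def norm_power power_less_one_iff)
  \<comment> \<open>-1 is its own inverse and \<open>- q\<close> is fixed by z -> p / z, so the two
    reflections determine \<open>logth p\<close> at these points.\<close>
  have "2 * logth p (-1) = 1"
    using logth_minus'[of p "-1"] p by simp
    hence "logth p (-1) = 1 / 2"
      by (metis nonzero_mult_div_cancel_left zero_neq_numeral)
  moreover have "logth p (- q) = 0"
    using q by (simp add: logth_def p_def power2_eq_square)
  ultimately show ?thesis using True q by (simp add: p_def)
next
  case False
  define p where "p = q\<^sup>2"
  have p: "norm p < 1" "p \<noteq> 0" "norm p = norm q ^ 2"
    using q by (auto simp: p_def norm_power power_less_one_iff)
  have pq: "norm p < norm q" using p q by (simp add: power2_eq_square)
  define A where "A = {z :: complex. norm q < norm z \<and> norm z < 1 / norm q}"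
  have A: "open A" unfolding A_def by (rule open_annulus)
  have in_A: "norm q < norm z" "norm z * norm q < 1" "z \<noteq> 0" "norm p < norm z" "norm z * norm p < 1"
     "norm (q * z) < 1" "norm p < norm (q * z)" "norm (q * z) * norm p < 1" if "z \<in> A" for z
  proof -
    show 1: "norm q < norm z" "norm z * norm q < 1" "z \<noteq> 0" using that q by (auto simp: A_def pos_less_divide_eq)
    show "norm p < norm z" using 1 pq by linarith
    have "norm z * norm p \<le> norm z * norm q" using pq by (intro mult_left_mono) auto
    thus "norm z * norm p < 1" using 1 by linarith
    show 2: "norm (q * z) < 1" using 1 by (simp add: norm_mult mult.commute)
    show "norm p < norm (q * z)" using 1 q p by (simp add: norm_mult power2_eq_square)
    have "norm (q * z) * norm p \<le> norm (q * z) * 1" using p by (intro mult_left_mono) auto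
    thus "norm (q * z) * norm p < 1" using 2 by linarith
  qed
  define e where "e = (\<lambda>z. 1 / 2 - logth p z + logth p (q * z))"
  define H where "H = (\<lambda>z. e z * jprod z q / jprod (- z) q)"
  have qz: "q * z \<noteq> 1" if "z \<in> A" for z using in_A(6)[OF that] by auto
  have hol_e: "e holomorphic_on (A - {1})"
    unfolding e_def using in_A qz
    by (intro holomorphic_intros logth_holomorphic p) (auto simp: q)
  have hol_lq: "(\<lambda>z. logth p (q * z)) holomorphic_on A"
    using in_A qz by (intro holomorphic_intros logth_holomorphic p) (auto simp: q)
  have hol_j: "(\<lambda>z. jprod z q) holomorphic_on A" "(\<lambda>z. jprod (- z) q) holomorphic_on A"
    using in_A by (intro holomorphic_intros q; force)+
  have jnz: "jprod (- z) q \<noteq> 0" if "z \<in> A" "z \<noteq> -1" for z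
    using that in_A[of z] q by (intro jprod_nonzero_annulus) (auto simp: minus_equation_iff)
  have "1 < 1 / norm q" using q by simp
  hence A1: "1 \<in> A" "-1 \<in> A" using q by (auto simp: A_def)
  \<comment> \<open>This zero cancels the zero of \<open>jprod (- z) q\<close> at -1, which makes
    that singularity of H removable.\<close>
  have e_m1: "e (-1) = 0"
  proof -
    have "2 * logth p (-1) = 1"
      using logth_minus'[of p "-1"] p by simp
    hence "logth p (-1) = 1 / 2"
      by (metis nonzero_mult_div_cancel_left zero_neq_numeral)
    moreover have "logth p (- q) = 0"
      using q by (simp add: logth_def p_def power2_eq_square)
    ultimately show ?thesis by (simp add: e_def)
  qed
  have e_pole: "((\<lambda>z. (1 - z) * e z) \<longlongrightarrow> 1) (at 1)"
  proof -
    have "((\<lambda>z. (1 - z) * (1 / 2 + logth p (q * z)) + (z - 1) * logth p z) \<longlongrightarrow>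
       (1 - 1) * (1 / 2 + logth p (q * 1)) + 1) (at 1)"
      by (intro tendsto_intros logth_pole p holomorphic_imp_tendsto[OF hol_lq A A1(1)])
    thus ?thesis by (simp add: e_def algebra_simps)
  qed
  have limH: "(H \<longlongrightarrow> qpoch_inf q q ^ 3 / jprod (- 1) q) (at 1)"
  proof -
    have "((\<lambda>z. ((1 - z) * e z) * (jprod z q / (1 - z)) / jprod (- z) q) \<longlongrightarrow>
        1 * qpoch_inf q q ^ 3 / jprod (- 1) q) (at 1)"
      by (intro tendsto_intros e_pole jprod_div_tendsto q holomorphic_imp_tendsto[OF hol_j(2) A A1(1)] jnz A1) auto
    moreover have "eventually (\<lambda>z. ((1 - z) * e z) * (jprod z q / (1 - z)) / jprod (- z) q = H z) (at 1)"
      unfolding eventually_at_filter H_def by (intro always_eventually) auto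
    ultimately show ?thesis by (auto intro: Lim_transform_eventually)
  qed
  have rq: "1 / norm q * norm q = 1" using q by simp
  obtain c where c: "\<And>z. norm q < norm z \<Longrightarrow> norm z < 1 / norm q \<Longrightarrow> z \<notin> {1,-1} \<Longrightarrow> H z = c"
    "\<And>k. k \<in> {1,-1} \<Longrightarrow> norm q < norm k \<Longrightarrow> norm k < 1 / norm q \<Longrightarrow> (H \<longlongrightarrow> c) (at k)"
  proof (rule annulus_elliptic_constant[OF q, of "norm q" "1 / norm q" "{1,-1}" H])
    show "H holomorphic_on {z. norm q < norm z \<and> norm z < 1 / norm q} - {1,-1}"
      unfolding A_def[symmetric] H_def using jnz
      by (intro holomorphic_intros holomorphic_on_subset[OF hol_e] holomorphic_on_subset[OF hol_j(1)]
          holomorphic_on_subset[OF hol_j(2)]) auto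
    show "((\<lambda>z. (z - k) * H z) \<longlongrightarrow> 0) (at k)" if "k \<in> {1,-1}" for k
    proof -
      have "((\<lambda>z. (z - 1) * H z) \<longlongrightarrow> (1 - 1) * (qpoch_inf q q ^ 3 / jprod (- 1) q)) (at 1)"
        by (intro tendsto_intros limH)
      moreover have "((\<lambda>z. (z - -1) * H z) \<longlongrightarrow> 0) (at (-1))"
      proof -
        have "filterlim (\<lambda>z::complex. - z) (at 1) (at (-1))"
          by (auto simp: filterlim_at eventually_at_filter intro!: tendsto_eq_intros always_eventually)
             (metis minus_minus)
        hence "((\<lambda>z. jprod (- z) q / (1 - - z)) \<longlongrightarrow> qpoch_inf q q ^ 3) (at (-1))"
          by (rule filterlim_compose[OF jprod_div_tendsto[OF q(1)]])
        hence "((\<lambda>z. e z * jprod z q / (jprod (- z) q / (1 - - z))) \<longlongrightarrow>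
             e (-1) * jprod (-1) q / qpoch_inf q q ^ 3) (at (-1))"
          using qpoch_self_nonzero[OF q(1)] A A1
          by (intro tendsto_intros holomorphic_imp_tendsto[OF hol_j(1) A A1(2)]
               holomorphic_imp_tendsto[OF hol_e]) (auto intro: open_Diff)
        thus ?thesis by (simp add: e_m1 H_def algebra_simps)
      qed
      ultimately show ?thesis using that by auto
    qed
    fix z assume z: "norm q < norm z" "norm z < 1 / norm q * norm q" "z / q \<notin> {1,-1}" "z \<notin> {1,-1}"
    define w where "w = z / q"
    have zw: "z = q * w" using q by (simp add: w_def)
    have n: "0 < norm q" "norm q < 1" using q by auto
    have z1: "norm z < 1" using z(2) n by simp
    have nw: "norm w < 1 / norm q" "1 < norm w"
      using z1 z(1) n by (auto simp: w_def norm_divide divide_strict_right_mono)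
    have wA: "w \<in> A" using nw n by (auto simp: A_def)
    have "norm w * norm p < 1" using in_A(5)[OF wA] .
    \<comment> \<open>Two steps by q make one period of \<open>logth p\<close>. Its -1 turns the
      constant 1/2 into -1/2, which is why e changes sign under one step.\<close>
    hence l: "logth p (q * (q * w)) = logth p w - 1"
      using logth_shift'[of p w] z(3) nw p by (simp add: p_def power2_eq_square mult.assoc w_def)
    have "e z = - e w" unfolding e_def zw l by simp
    moreover have "jprod z q = - jprod w q / w" "jprod (- z) q = jprod (- w) q / w"
      using jprod_shift[OF q, of w] jprod_shift[OF q, of "- w"] in_A(3)[OF wA] by (simp_all add: zw)
    ultimately show "H (z / q) = H z"
      unfolding w_def[symmetric] H_def using in_A(3)[OF wA] by simp
  qed (use q in \<open>auto simp: rq\<close>)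
  have "c = qpoch_inf q q ^ 3 / jprod (- 1) q"
    using LIM_unique[OF c(2)[of 1] limH] A1 by (auto simp: A_def)
  moreover have yA: "y \<in> A" using y q by (auto simp: A_def pos_less_divide_eq)
  ultimately have "H y = qpoch_inf q q ^ 3 / jprod (- 1) q"
    using c(1)[of y] y False by (auto simp: A_def)
  thus ?thesis using jnz[OF yA False] jnz[OF A1(1)]
    by (simp add: H_def e_def p_def field_simps)
qed

section \<open>Lambert series for the cubic theta quotient\<close>

lemma qpoch_mult_minus:
  assumes "norm q < 1"
  shows "qpoch_inf a q * qpoch_inf (- a) q = qpoch_inf (a\<^sup>2) (q\<^sup>2)"
proof -
  have "norm (q\<^sup>2) < 1" using assms by (simp add: norm_power power_less_one_iff)
  have "(\<lambda>n. (\<Prod>k<n. 1 - a * q ^ k) * (\<Prod>k<n. 1 - (- a) * q ^ k)) \<longlonglongrightarrow> qpoch_inf a q * qpoch_inf (- a) q"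
    by (intro tendsto_mult qpoch_tendsto assms)
  also have "(\<lambda>n. (\<Prod>k<n. 1 - a * q ^ k) * (\<Prod>k<n. 1 - (- a) * q ^ k)) = (\<lambda>n. \<Prod>k<n. 1 - a\<^sup>2 * (q\<^sup>2) ^ k)"
    unfolding prod.distrib[symmetric]
    by (intro ext prod.cong refl) (simp add: algebra_simps power2_eq_square power_mult_distrib)
  finally show ?thesis
    using LIMSEQ_unique qpoch_tendsto[OF \<open>norm (q\<^sup>2) < 1\<close>] by blast
qed

lemma qpoch_even_odd:
  assumes "norm q < 1"
  shows "qpoch_inf a q = qpoch_inf a (q\<^sup>2) * qpoch_inf (a * q) (q\<^sup>2)"
proof -
  have q2: "norm (q\<^sup>2) < 1" using assms by (simp add: norm_power power_less_one_iff)
  have "(\<lambda>n. \<Prod>k<2 * n. 1 - a * q ^ k) \<longlonglongrightarrow> qpoch_inf a q"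
    by (rule filterlim_compose[OF qpoch_tendsto[OF assms]])
       (auto intro!: filterlim_subseq simp: strict_mono_def)
  also have "(\<lambda>n. \<Prod>k<2 * n. 1 - a * q ^ k) =
     (\<lambda>n. (\<Prod>k<n. 1 - a * (q\<^sup>2) ^ k) * (\<Prod>k<n. 1 - (a * q) * (q\<^sup>2) ^ k))"
  proof
    show "(\<Prod>k<2 * n. 1 - a * q ^ k) =
       (\<Prod>k<n. 1 - a * (q\<^sup>2) ^ k) * (\<Prod>k<n. 1 - (a * q) * (q\<^sup>2) ^ k)" for n
      by (induction n) (simp_all add: power_mult[symmetric] mult_ac)
  qed
  finally have "(\<lambda>n. (\<Prod>k<n. 1 - a * (q\<^sup>2) ^ k) * (\<Prod>k<n. 1 - (a * q) * (q\<^sup>2) ^ k)) \<longlonglongrightarrow> qpoch_inf a q" .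
  moreover have "(\<lambda>n. (\<Prod>k<n. 1 - a * (q\<^sup>2) ^ k) * (\<Prod>k<n. 1 - (a * q) * (q\<^sup>2) ^ k))
     \<longlonglongrightarrow> qpoch_inf a (q\<^sup>2) * qpoch_inf (a * q) (q\<^sup>2)"
    by (intro tendsto_mult qpoch_tendsto q2)
  ultimately show ?thesis by (rule LIMSEQ_unique)
qed

lemma qpoch_three:
  assumes "norm q < 1"
  shows "qpoch_inf a q = qpoch_inf a (q ^ 3) * qpoch_inf (a * q) (q ^ 3) * qpoch_inf (a * q\<^sup>2) (q ^ 3)"
proof -
  have q3: "norm (q ^ 3) < 1" using assms by (simp add: norm_power power_less_one_iff)
  have "(\<lambda>n. \<Prod>k<3 * n. 1 - a * q ^ k) \<longlonglongrightarrow> qpoch_inf a q"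
    by (rule filterlim_compose[OF qpoch_tendsto[OF assms]])
       (auto intro!: filterlim_subseq simp: strict_mono_def)
  also have "(\<lambda>n. \<Prod>k<3 * n. 1 - a * q ^ k) =
     (\<lambda>n. (\<Prod>k<n. 1 - a * (q ^ 3) ^ k) * (\<Prod>k<n. 1 - (a * q) * (q ^ 3) ^ k) * (\<Prod>k<n. 1 - (a * q\<^sup>2) * (q ^ 3) ^ k))"
  proof
    have 3: "3 * Suc n = Suc (Suc (Suc (3 * n)))" for n by simp
    show "(\<Prod>k<3 * n. 1 - a * q ^ k) =
       (\<Prod>k<n. 1 - a * (q ^ 3) ^ k) * (\<Prod>k<n. 1 - (a * q) * (q ^ 3) ^ k) * (\<Prod>k<n. 1 - (a * q\<^sup>2) * (q ^ 3) ^ k)" for n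
    proof (induction n)
      case (Suc n)
      show ?case
        unfolding 3 prod.lessThan_Suc Suc.IH
        by (simp add: power_mult[symmetric] mult_ac power2_eq_square)
    qed simp
  qed
  finally have "(\<lambda>n. (\<Prod>k<n. 1 - a * (q ^ 3) ^ k) * (\<Prod>k<n. 1 - (a * q) * (q ^ 3) ^ k) * (\<Prod>k<n. 1 - (a * q\<^sup>2) * (q ^ 3) ^ k))
     \<longlonglongrightarrow> qpoch_inf a q" .
  moreover have "(\<lambda>n. (\<Prod>k<n. 1 - a * (q ^ 3) ^ k) * (\<Prod>k<n. 1 - (a * q) * (q ^ 3) ^ k) * (\<Prod>k<n. 1 - (a * q\<^sup>2) * (q ^ 3) ^ k))
     \<longlonglongrightarrow> qpoch_inf a (q ^ 3) * qpoch_inf (a * q) (q ^ 3) * qpoch_inf (a * q\<^sup>2) (q ^ 3)"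
    by (intro tendsto_mult qpoch_tendsto q3)
  ultimately show ?thesis by (rule LIMSEQ_unique)
qed

lemma cube_root_facts:
  fixes w :: complex
  assumes "w\<^sup>2 + w + 1 = 0"
  shows "w ^ 3 = 1" "norm w = 1" "w \<noteq> 0" "w \<noteq> 1" "1 / w = w\<^sup>2" "w\<^sup>2 \<noteq> 1" "w\<^sup>2 = - 1 - w" "1 + w \<noteq> 0"
proof -
  have "w ^ 3 - 1 = (w - 1) * (w\<^sup>2 + w + 1)"
    by (simp add: power2_eq_square power3_eq_cube algebra_simps)
  thus 1: "w ^ 3 = 1" using assms by simp
  hence "norm w ^ 3 = 1" by (metis norm_one norm_power)
  thus "norm w = 1" using power_eq_imp_eq_base[of "norm w" 3 1] by simp
  show 0: "w \<noteq> 0" using assms by auto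
  show "w \<noteq> 1" using assms by auto
  show "1 / w = w\<^sup>2" using 1 0 by (simp add: field_simps power2_eq_square power3_eq_cube)
  show 2: "w\<^sup>2 = - 1 - w" using assms by (simp add: algebra_simps add_eq_0_iff)
  show "w\<^sup>2 \<noteq> 1"
  proof
    assume "w\<^sup>2 = 1"
    hence "w = 1" using 1 by (simp add: power2_eq_square power3_eq_cube)
    thus False using assms by simp
  qed
  show "1 + w \<noteq> 0"
  proof
    assume "1 + w = 0"
    hence "w\<^sup>2 = 0" using 2 by (simp add: algebra_simps add_eq_0_iff)
    thus False using 0 by simp
  qed
qed

lemma one_minus_cube:
  fixes w y :: complex
  assumes "w\<^sup>2 + w + 1 = 0"
  shows "(1 - y) * (1 - w * y) * (1 - w\<^sup>2 * y) = 1 - y ^ 3"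
proof -
  have "(1 - y) * (1 - w * y) * (1 - w\<^sup>2 * y) =
     1 - (w\<^sup>2 + w + 1) * y + (w + w\<^sup>2 + w ^ 3) * y\<^sup>2 - w ^ 3 * y ^ 3"
    by (simp add: algebra_simps power2_eq_square power3_eq_cube)
  thus ?thesis using assms cube_root_facts(1,7)[OF assms] by simp
qed

lemma qpoch_cube:
  assumes "norm q < 1" and w: "w\<^sup>2 + w + 1 = 0"
  shows "qpoch_inf a q * qpoch_inf (w * a) q * qpoch_inf (w\<^sup>2 * a) q = qpoch_inf (a ^ 3) (q ^ 3)"
proof -
  have q3: "norm (q ^ 3) < 1" using assms by (simp add: norm_power power_less_one_iff)
  have "(\<lambda>n. (\<Prod>k<n. 1 - a * q ^ k) * (\<Prod>k<n. 1 - (w * a) * q ^ k) * (\<Prod>k<n. 1 - (w\<^sup>2 * a) * q ^ k))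
     \<longlonglongrightarrow> qpoch_inf a q * qpoch_inf (w * a) q * qpoch_inf (w\<^sup>2 * a) q"
    by (intro tendsto_mult qpoch_tendsto assms)
  also have "(\<lambda>n. (\<Prod>k<n. 1 - a * q ^ k) * (\<Prod>k<n. 1 - (w * a) * q ^ k) * (\<Prod>k<n. 1 - (w\<^sup>2 * a) * q ^ k))
     = (\<lambda>n. \<Prod>k<n. 1 - a ^ 3 * (q ^ 3) ^ k)"
    unfolding prod.distrib[symmetric]
  proof (intro ext prod.cong refl)
    show "(1 - a * q ^ k) * (1 - (w * a) * q ^ k) * (1 - (w\<^sup>2 * a) * q ^ k) = 1 - a ^ 3 * (q ^ 3) ^ k" for k
      using one_minus_cube[OF w, of "a * q ^ k"]
      by (simp add: mult.assoc power_mult_distrib power_mult[symmetric] mult.commute[of k])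
  qed
  finally show ?thesis
    using LIMSEQ_unique qpoch_tendsto[OF q3] by blast
qed

lemma qpoch_euler:
  assumes "norm q < 1"
  shows "qpoch_inf q (q\<^sup>2) * qpoch_inf (- q) q = 1"
proof -
  have q2: "norm (q\<^sup>2) < 1" using assms by (simp add: norm_power power_less_one_iff)
  have 1: "qpoch_inf q q = qpoch_inf q (q\<^sup>2) * qpoch_inf (q\<^sup>2) (q\<^sup>2)"
    using qpoch_even_odd[OF assms, of q] by (simp add: power2_eq_square)
  have "qpoch_inf (q\<^sup>2) (q\<^sup>2) = (qpoch_inf q (q\<^sup>2) * qpoch_inf (- q) q) * qpoch_inf (q\<^sup>2) (q\<^sup>2)"
    using qpoch_mult_minus[OF assms, of q] unfolding 1 by (simp add: mult_ac)
  thus ?thesis using qpoch_self_nonzero[OF q2] by simp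
qed

text \<open>Gauss's product for the alternating sum of q^(n^2). It identifies
  \<open>1 / theta q 1\<close> with the generating function of all overpartitions, the empty one
  included.\<close>

lemma theta_product:
  assumes "norm q < 1" "q \<noteq> 0"
  shows "theta q 1 = qpoch_inf q q / qpoch_inf (- q) q"
proof -
  have 1: "qpoch_inf q q = qpoch_inf q (q\<^sup>2) * qpoch_inf (q\<^sup>2) (q\<^sup>2)"
    using qpoch_even_odd[OF assms(1), of q] by (simp add: power2_eq_square)
  have nz: "qpoch_inf (- q) q \<noteq> 0" using qpoch_euler[OF assms(1)] by auto
  have "theta q 1 = qpoch_inf q (q\<^sup>2) * (qpoch_inf q (q\<^sup>2) * qpoch_inf (q\<^sup>2) (q\<^sup>2))"
    using jacobi_triple_product[OF assms, of 1] assms(2)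
    by (simp add: jprod_def power2_eq_square mult_ac)
  also have "\<dots> = qpoch_inf q (q\<^sup>2) * qpoch_inf q q" by (simp only: 1)
  finally show ?thesis using qpoch_euler[OF assms(1)] nz by (simp add: field_simps)
qed

text \<open>The double series of \<open>(a * p ^ n) ^ (c * k + r)\<close>, summed over k first or
  over n first. Since c and r are at least 1, it is dominated by
  \<open>norm p ^ n * norm a ^ k\<close>.\<close>

lemma geometric_double_sum:
  fixes a p :: complex
  assumes a: "norm a < 1" and p: "norm p < 1" and c: "c \<ge> 1" "r \<ge> 1"
  obtains S where "(\<lambda>n. (a * p ^ n) ^ r / (1 - (a * p ^ n) ^ c)) sums S"
    "(\<lambda>k. a ^ (c * k + r) / (1 - p ^ (c * k + r))) sums S"
proof -
  define f where "f = (\<lambda>(n, k). (a * p ^ n) ^ (c * k + r))"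
  have geo: "((\<lambda>k. x ^ k) has_sum 1 / (1 - x)) UNIV" if "norm x < 1" for x :: complex
    using that by (intro norm_summable_imp_has_sum geometric_sums) (auto simp: norm_power summable_geometric)
  have geor: "((\<lambda>k. x ^ k) has_sum 1 / (1 - x)) UNIV" if "norm x < 1" for x :: real
    using that by (intro norm_summable_imp_has_sum geometric_sums) (auto simp: power_abs summable_geometric)
  have dom: "(\<lambda>(n, k). norm p ^ n * norm a ^ k) summable_on UNIV \<times> UNIV"
  proof (rule summable_on_SigmaI)
    show "((\<lambda>k. case (n, k) of (n, k) \<Rightarrow> norm p ^ n * norm a ^ k) has_sum norm p ^ n * (1 / (1 - norm a))) UNIV" for n
      using a by (simp only: prod.case) (intro has_sum_cmult_right geor, simp)
    show "(\<lambda>n. norm p ^ n * (1 / (1 - norm a))) summable_on UNIV"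
      using geor[of "norm p"] p by (intro summable_on_cmult_left) (auto simp: summable_on_def)
  qed auto
  have le: "norm (f x) \<le> (case x of (n, k) \<Rightarrow> norm p ^ n * norm a ^ k)" for x
  proof (cases x)
    case (Pair n k)
    have "k \<le> c * k + r" using c by (cases c) auto
    hence "norm a ^ (c * k + r) \<le> norm a ^ k" using a by (intro power_decreasing) auto
    moreover have "n \<le> n * (c * k + r)" using c by (cases r) auto
    hence "norm p ^ (n * (c * k + r)) \<le> norm p ^ n" using p by (intro power_decreasing) auto
    ultimately show ?thesis
      using Pair mult_mono[of "norm p ^ (n * (c * k + r))" "norm p ^ n" "norm a ^ (c * k + r)" "norm a ^ k"]
      by (simp add: f_def norm_mult norm_power power_mult_distrib power_mult[symmetric] mult.commute)
  qed
  have "f summable_on UNIV \<times> UNIV"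
    by (rule Infinite_Sum.abs_summable_summable[OF Infinite_Sum.abs_summable_on_comparison_test'[OF dom le]])
  then obtain S where S: "(f has_sum S) (UNIV \<times> UNIV)" by (auto simp: summable_on_def)
  have lt: "norm (a * p ^ n) < 1" for n
  proof -
    have "norm a * norm p ^ n \<le> norm a * 1" using p by (intro mult_left_mono power_le_one) auto
    thus ?thesis using a by (simp add: norm_mult norm_power)
  qed
  have 1: "((\<lambda>k. f (n, k)) has_sum (a * p ^ n) ^ r / (1 - (a * p ^ n) ^ c)) UNIV" for n
  proof -
    have "norm ((a * p ^ n) ^ c) < 1"
      using lt[of n] c unfolding norm_power by (simp add: power_less_one_iff)
    from has_sum_cmult_right[OF geo[OF this], of "(a * p ^ n) ^ r"] show ?thesis
      by (simp add: f_def power_add power_mult mult.commute[of _ "_ ^ r"])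
  qed
  have 2: "((\<lambda>n. f (n, k)) has_sum a ^ (c * k + r) / (1 - p ^ (c * k + r))) UNIV" for k
  proof -
    have "norm (p ^ (c * k + r)) < 1"
      using p c unfolding norm_power by (simp add: power_less_one_iff)
    from has_sum_cmult_right[OF geo[OF this], of "a ^ (c * k + r)"] show ?thesis
      by (simp add: f_def power_mult_distrib power_mult[symmetric] mult.commute)
  qed
  show ?thesis
  proof
    show "(\<lambda>n. (a * p ^ n) ^ r / (1 - (a * p ^ n) ^ c)) sums S"
      by (rule has_sum_imp_sums, rule has_sum_SigmaD[OF S 1])
    have S': "((\<lambda>(k, n). f (n, k)) has_sum S) (UNIV \<times> UNIV)"
      using S by (subst has_sum_swap) simp
    show "(\<lambda>k. a ^ (c * k + r) / (1 - p ^ (c * k + r))) sums S"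
      by (rule has_sum_imp_sums, rule has_sum_SigmaD[OF S']) (use 2 in simp)
  qed
qed

lemma lambert_even_odd:
  assumes "norm p < 1" "norm a < 1"
  shows "lambert p a = lambert (p\<^sup>2) a + lambert (p\<^sup>2) (a * p)"
proof -
  have p2: "norm (p\<^sup>2) < 1" using assms by (simp add: norm_power power_less_one_iff)
  have ap: "norm (a * p) < 1"
    using assms mult_strict_mono[of "norm a" 1 "norm p" 1] by (simp add: norm_mult)
  note L = lambert_sums[OF p2 qpoch_nonzero_norm[OF p2 assms(2)]] lambert_sums[OF p2 qpoch_nonzero_norm[OF p2 ap]]
    lambert_sums[OF assms(1) qpoch_nonzero_norm[OF assms]]
  have "(\<lambda>n. \<Sum>k<2 * n. a * p ^ k / (1 - a * p ^ k)) \<longlonglongrightarrow> lambert p a"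
    using L(3) unfolding sums_def
    by (rule filterlim_compose) (auto intro!: filterlim_subseq simp: strict_mono_def)
  also have "(\<lambda>n. \<Sum>k<2 * n. a * p ^ k / (1 - a * p ^ k)) =
    (\<lambda>n. (\<Sum>k<n. a * (p\<^sup>2) ^ k / (1 - a * (p\<^sup>2) ^ k)) + (\<Sum>k<n. a * p * (p\<^sup>2) ^ k / (1 - a * p * (p\<^sup>2) ^ k)))"
  proof
    show "(\<Sum>k<2 * n. a * p ^ k / (1 - a * p ^ k)) =
      (\<Sum>k<n. a * (p\<^sup>2) ^ k / (1 - a * (p\<^sup>2) ^ k)) + (\<Sum>k<n. a * p * (p\<^sup>2) ^ k / (1 - a * p * (p\<^sup>2) ^ k))" for n
      by (induction n) (simp_all add: power_mult[symmetric] mult_ac)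
  qed
  finally have "(\<lambda>n. (\<Sum>k<n. a * (p\<^sup>2) ^ k / (1 - a * (p\<^sup>2) ^ k)) + (\<Sum>k<n. a * p * (p\<^sup>2) ^ k / (1 - a * p * (p\<^sup>2) ^ k)))
     \<longlonglongrightarrow> lambert p a" .
  moreover have "(\<lambda>n. (\<Sum>k<n. a * (p\<^sup>2) ^ k / (1 - a * (p\<^sup>2) ^ k)) + (\<Sum>k<n. a * p * (p\<^sup>2) ^ k / (1 - a * p * (p\<^sup>2) ^ k)))
     \<longlonglongrightarrow> lambert (p\<^sup>2) a + lambert (p\<^sup>2) (a * p)"
    using L(1,2) unfolding sums_def by (intro tendsto_add)
  ultimately show ?thesis by (rule LIMSEQ_unique)
qed

text \<open>Expanded in powers of y = a p^n, the difference of the Lambert series at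
  \<open>w * a\<close> and \<open>w ^ 2 * a\<close> has coefficients w^k - w^(2k), that is,
  \<open>w - w ^ 2\<close> times the nontrivial character modulo 3. Exchanging the order of
  summation converts the two character classes into Lambert series with nomes \<open>q ^ 3\<close>
  and \<open>q ^ 6\<close>, and splitting by parity leaves \<open>q ^ 6\<close> only.\<close>

lemma lambert_cubic_character:
  assumes q: "norm q < 1" "q \<noteq> 0" and w: "w\<^sup>2 + w + 1 = 0"
  shows "(lambert (q\<^sup>2) (w * q\<^sup>2) - lambert (q\<^sup>2) (w\<^sup>2 * q\<^sup>2)) - (lambert (q\<^sup>2) (w * q) - lambert (q\<^sup>2) (w\<^sup>2 * q))
    = (w - w\<^sup>2) * (logth (q ^ 6) q - 3 * logth (q ^ 6) (q\<^sup>2))"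
proof -
  define p where "p = q\<^sup>2"
  have lt: "norm (q ^ n) < 1" if "n > 0" for n
    using q that by (simp add: norm_power power_less_one_iff)
  have p: "norm p < 1" unfolding p_def by (rule lt) simp
  note wf = cube_root_facts[OF w]
  have diff: "lambert p (w * a) - lambert p (w\<^sup>2 * a) = (w - w\<^sup>2) * (S1 - S2)"
    if a: "norm a < 1" and S1: "(\<lambda>n. (a * p ^ n) ^ 1 / (1 - (a * p ^ n) ^ 3)) sums S1"
     and S2: "(\<lambda>n. (a * p ^ n) ^ 2 / (1 - (a * p ^ n) ^ 3)) sums S2" for a S1 S2
  proof -
    have n: "norm (w * a) < 1" "norm (w\<^sup>2 * a) < 1" using a wf(2) by (simp_all add: norm_mult norm_power)
    have "(\<lambda>n. (w * a) * p ^ n / (1 - (w * a) * p ^ n) - (w\<^sup>2 * a) * p ^ n / (1 - (w\<^sup>2 * a) * p ^ n))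
       sums (lambert p (w * a) - lambert p (w\<^sup>2 * a))"
      by (intro sums_diff lambert_sums qpoch_nonzero_norm p n)
    moreover have "(w * a) * p ^ n / (1 - (w * a) * p ^ n) - (w\<^sup>2 * a) * p ^ n / (1 - (w\<^sup>2 * a) * p ^ n)
       = (w - w\<^sup>2) * ((a * p ^ n) ^ 1 / (1 - (a * p ^ n) ^ 3) - (a * p ^ n) ^ 2 / (1 - (a * p ^ n) ^ 3))" for n
    proof -
      define y where "y = a * p ^ n"
      have "norm a * norm p ^ n \<le> norm a * 1" using p by (intro mult_left_mono power_le_one) auto
      hence y: "norm y < 1" using a by (simp add: y_def norm_mult norm_power)
      have y3: "norm (y ^ 3) < 1" using y by (simp add: norm_power power_less_one_iff)
      have nz: "1 - y ^ 3 \<noteq> 0" using y3 by auto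
      hence nz': "1 - y \<noteq> 0" "1 - w * y \<noteq> 0" "1 - w\<^sup>2 * y \<noteq> 0"
        using one_minus_cube[OF w, of y] by auto
      have "w * y / (1 - w * y) - w\<^sup>2 * y / (1 - w\<^sup>2 * y) = (w - w\<^sup>2) * y / ((1 - w * y) * (1 - w\<^sup>2 * y))"
        using nz' by (simp add: divide_simps) (simp add: algebra_simps)
      also have "\<dots> = (w - w\<^sup>2) * (y * (1 - y) / (1 - y ^ 3))"
        unfolding one_minus_cube[OF w, of y, symmetric] using nz' by (simp add: mult.assoc)
      also have "y * (1 - y) / (1 - y ^ 3) = y ^ 1 / (1 - y ^ 3) - y ^ 2 / (1 - y ^ 3)"
        by (simp add: algebra_simps power2_eq_square diff_divide_distrib)
      finally show ?thesis by (simp add: y_def mult.assoc)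
    qed
    ultimately have "(\<lambda>n. (w - w\<^sup>2) * ((a * p ^ n) ^ 1 / (1 - (a * p ^ n) ^ 3) - (a * p ^ n) ^ 2 / (1 - (a * p ^ n) ^ 3)))
        sums (lambert p (w * a) - lambert p (w\<^sup>2 * a))" by simp
    moreover have "(\<lambda>n. (w - w\<^sup>2) * ((a * p ^ n) ^ 1 / (1 - (a * p ^ n) ^ 3) - (a * p ^ n) ^ 2 / (1 - (a * p ^ n) ^ 3)))
        sums ((w - w\<^sup>2) * (S1 - S2))" by (intro sums_mult sums_diff S1 S2)
    ultimately show ?thesis by (rule sums_unique2)
  qed
  have q2: "norm (q\<^sup>2) < 1" by (rule lt) simp
  obtain S1 where S1: "(\<lambda>n. (q * p ^ n) ^ 1 / (1 - (q * p ^ n) ^ 3)) sums S1"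
    "(\<lambda>k. q ^ (3 * k + 1) / (1 - p ^ (3 * k + 1))) sums S1"
    by (rule geometric_double_sum[OF q(1) p, of 3 1]) auto
  obtain S2 where S2: "(\<lambda>n. (q * p ^ n) ^ 2 / (1 - (q * p ^ n) ^ 3)) sums S2"
    "(\<lambda>k. q ^ (3 * k + 2) / (1 - p ^ (3 * k + 2))) sums S2"
    by (rule geometric_double_sum[OF q(1) p, of 3 2]) auto
  obtain T1 where T1: "(\<lambda>n. (q\<^sup>2 * p ^ n) ^ 1 / (1 - (q\<^sup>2 * p ^ n) ^ 3)) sums T1"
    "(\<lambda>k. (q\<^sup>2) ^ (3 * k + 1) / (1 - p ^ (3 * k + 1))) sums T1"
    by (rule geometric_double_sum[OF q2 p, of 3 1]) auto
  obtain T2 where T2: "(\<lambda>n. (q\<^sup>2 * p ^ n) ^ 2 / (1 - (q\<^sup>2 * p ^ n) ^ 3)) sums T2"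
    "(\<lambda>k. (q\<^sup>2) ^ (3 * k + 2) / (1 - p ^ (3 * k + 2))) sums T2"
    by (rule geometric_double_sum[OF q2 p, of 3 2]) auto
  have "T1 - S1 = 2 * lambert (q ^ 6) (q\<^sup>2) - lambert (q ^ 3) q"
    and "T2 - S2 = 2 * lambert (q ^ 6) (q ^ 4) - lambert (q ^ 3) (q\<^sup>2)"
  proof -
    \<comment> \<open>With y = q^m both sides are \<open>- y / (1 + y)\<close>; the form on the
      right consists of summands of \<open>lambert\<close>.\<close>
    have gen: "(q\<^sup>2) ^ m / (1 - p ^ m) - q ^ m / (1 - p ^ m) = 2 * ((q\<^sup>2) ^ m / (1 - (q\<^sup>2) ^ m)) - q ^ m / (1 - q ^ m)"
      if "m > 0" for m
    proof -
      define y where "y = q ^ m"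
      have "norm y < 1" unfolding y_def by (rule lt[OF that])
      hence nz: "1 - y \<noteq> 0" "1 + y \<noteq> 0"
        by (auto, metis add_cancel_right_right add_eq_0_iff norm_minus_cancel norm_one order_less_irrefl)
      have sq: "(q\<^sup>2) ^ m = y\<^sup>2" "p ^ m = y\<^sup>2"
        by (simp_all add: y_def p_def power_mult[symmetric] mult.commute)
      have f: "1 - y\<^sup>2 = (1 - y) * (1 + y)" by (simp add: power2_eq_square algebra_simps)
      show ?thesis unfolding sq y_def[symmetric] f using nz
        by (simp add: divide_simps) (simp add: power2_eq_square algebra_simps)
    qed
    have "norm (q ^ 6) < 1" "norm (q ^ 3) < 1" "norm (q ^ 4) < 1" by (rule lt; simp)+
    note L = lambert_sums[OF this(1) qpoch_nonzero_norm[OF this(1) q2]]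
      lambert_sums[OF this(1) qpoch_nonzero_norm[OF this(1) this(3)]]
      lambert_sums[OF this(2) qpoch_nonzero_norm[OF this(2) q(1)]]
      lambert_sums[OF this(2) qpoch_nonzero_norm[OF this(2) q2]]
    have e: "q\<^sup>2 * (q ^ 6) ^ k = (q\<^sup>2) ^ (3 * k + 1)" "q ^ 4 * (q ^ 6) ^ k = (q\<^sup>2) ^ (3 * k + 2)"
      "q * (q ^ 3) ^ k = q ^ (3 * k + 1)" "q\<^sup>2 * (q ^ 3) ^ k = q ^ (3 * k + 2)" for k
    proof -
      show "q\<^sup>2 * (q ^ 6) ^ k = (q\<^sup>2) ^ (3 * k + 1)" "q ^ 4 * (q ^ 6) ^ k = (q\<^sup>2) ^ (3 * k + 2)"
        unfolding power_mult[symmetric] power_add[symmetric]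
        by (rule arg_cong[where f = "\<lambda>m. q ^ m"]; simp)+
      show "q * (q ^ 3) ^ k = q ^ (3 * k + 1)" "q\<^sup>2 * (q ^ 3) ^ k = q ^ (3 * k + 2)"
        by (simp_all add: power_mult[symmetric] power2_eq_square)
    qed
    have "(\<lambda>k. 2 * (q\<^sup>2 * (q ^ 6) ^ k / (1 - q\<^sup>2 * (q ^ 6) ^ k)) - q * (q ^ 3) ^ k / (1 - q * (q ^ 3) ^ k))
       sums (2 * lambert (q ^ 6) (q\<^sup>2) - lambert (q ^ 3) q)"
      by (intro sums_diff sums_mult L)
    moreover have "(\<lambda>k. (q\<^sup>2) ^ (3 * k + 1) / (1 - p ^ (3 * k + 1)) - q ^ (3 * k + 1) / (1 - p ^ (3 * k + 1)))
       sums (T1 - S1)" by (intro sums_diff S1 T1)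
    moreover have "2 * (q\<^sup>2 * (q ^ 6) ^ k / (1 - q\<^sup>2 * (q ^ 6) ^ k)) - q * (q ^ 3) ^ k / (1 - q * (q ^ 3) ^ k)
       = (q\<^sup>2) ^ (3 * k + 1) / (1 - p ^ (3 * k + 1)) - q ^ (3 * k + 1) / (1 - p ^ (3 * k + 1))" for k
      unfolding e by (rule gen[symmetric]) simp
    ultimately show "T1 - S1 = 2 * lambert (q ^ 6) (q\<^sup>2) - lambert (q ^ 3) q"
      using sums_unique2 by (simp only:) blast
    have "(\<lambda>k. 2 * (q ^ 4 * (q ^ 6) ^ k / (1 - q ^ 4 * (q ^ 6) ^ k)) - q\<^sup>2 * (q ^ 3) ^ k / (1 - q\<^sup>2 * (q ^ 3) ^ k))
       sums (2 * lambert (q ^ 6) (q ^ 4) - lambert (q ^ 3) (q\<^sup>2))"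
      by (intro sums_diff sums_mult L)
    moreover have "(\<lambda>k. (q\<^sup>2) ^ (3 * k + 2) / (1 - p ^ (3 * k + 2)) - q ^ (3 * k + 2) / (1 - p ^ (3 * k + 2)))
       sums (T2 - S2)" by (intro sums_diff S2 T2)
    moreover have "2 * (q ^ 4 * (q ^ 6) ^ k / (1 - q ^ 4 * (q ^ 6) ^ k)) - q\<^sup>2 * (q ^ 3) ^ k / (1 - q\<^sup>2 * (q ^ 3) ^ k)
       = (q\<^sup>2) ^ (3 * k + 2) / (1 - p ^ (3 * k + 2)) - q ^ (3 * k + 2) / (1 - p ^ (3 * k + 2))" for k
      unfolding e by (rule gen[symmetric]) simp
    ultimately show "T2 - S2 = 2 * lambert (q ^ 6) (q ^ 4) - lambert (q ^ 3) (q\<^sup>2)"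
      using sums_unique2 by (simp only:) blast
  qed
  moreover have "lambert (q ^ 3) q = lambert (q ^ 6) q + lambert (q ^ 6) (q ^ 4)"
    "lambert (q ^ 3) (q\<^sup>2) = lambert (q ^ 6) (q\<^sup>2) + lambert (q ^ 6) (q ^ 5)"
    using lambert_even_odd[of "q ^ 3" q] lambert_even_odd[of "q ^ 3" "q\<^sup>2"] lt[of 3] lt[of 2] q
    by (simp_all add: power_mult[symmetric] power_add[symmetric] power_Suc[symmetric] del: power_Suc)
  moreover have "logth (q ^ 6) q = lambert (q ^ 6) (q ^ 5) - lambert (q ^ 6) q"
    "logth (q ^ 6) (q\<^sup>2) = lambert (q ^ 6) (q ^ 4) - lambert (q ^ 6) (q\<^sup>2)"
  proof -
    have "q ^ 6 / q = q ^ 5" "q ^ 6 / q\<^sup>2 = q ^ 4"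
      using q by (simp_all add: power_eq_if)
    thus "logth (q ^ 6) q = lambert (q ^ 6) (q ^ 5) - lambert (q ^ 6) q"
      "logth (q ^ 6) (q\<^sup>2) = lambert (q ^ 6) (q ^ 4) - lambert (q ^ 6) (q\<^sup>2)"
      by (simp_all add: logth_def)
  qed
  ultimately have TS: "(T1 - S1) - (T2 - S2) = logth (q ^ 6) q - 3 * logth (q ^ 6) (q\<^sup>2)"
    by simp
  have "(lambert (q\<^sup>2) (w * q\<^sup>2) - lambert (q\<^sup>2) (w\<^sup>2 * q\<^sup>2)) - (lambert (q\<^sup>2) (w * q) - lambert (q\<^sup>2) (w\<^sup>2 * q))
      = (w - w\<^sup>2) * (T1 - T2) - (w - w\<^sup>2) * (S1 - S2)"
    using diff[OF q(1) S1(1) S2(1)] diff[OF q2 T1(1) T2(1)] unfolding p_def by simp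
  also have "\<dots> = (w - w\<^sup>2) * ((T1 - S1) - (T2 - S2))" by (simp only: ring_distribs) simp
  finally show ?thesis unfolding TS .
qed

text \<open>This is \<open>kronecker_half_period\<close> at y = w. There the products over q, w q
  and w^2 q collapse to products in \<open>q ^ 3\<close>, and the bracket becomes the character sum.
  The coefficient 6 arises because \<open>w - w ^ 2\<close> is 6 times
  \<open>(1 + w) / (2 * (1 - w))\<close>, the value of the remaining elementary part of the
  bracket.\<close>

lemma theta_cube_lambert:
  assumes q: "norm q < 1" "q \<noteq> 0"
  shows "theta q 1 ^ 3 = theta (q ^ 3) 1 * (1 + 6 * logth (q ^ 6) q - 18 * logth (q ^ 6) (q\<^sup>2))"
proof -
  define w where "w = Complex (- 1 / 2) (sqrt 3 / 2)"
  have w: "w\<^sup>2 + w + 1 = 0"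
    by (simp add: w_def complex_eq_iff power2_eq_square)
  note wf = cube_root_facts[OF w]
  define L where "L = logth (q ^ 6) q - 3 * logth (q ^ 6) (q\<^sup>2)"
  define E1 E3 m1 m3 where "E1 = qpoch_inf q q" and "E3 = qpoch_inf (q ^ 3) (q ^ 3)"
    and "m1 = qpoch_inf (- q) q" and "m3 = qpoch_inf (- (q ^ 3)) (q ^ 3)"
  have q3: "norm (q ^ 3) < 1" "norm (q\<^sup>2) < 1" using q by (simp_all add: norm_power power_less_one_iff)
  have nz: "E1 \<noteq> 0" "E3 \<noteq> 0" "m1 \<noteq> 0" "m3 \<noteq> 0"
    unfolding E1_def E3_def m1_def m3_def using q(1) q3(1)
    by (intro qpoch_nonzero_norm; simp only: norm_minus_cancel)+
  have jw: "jprod w q = (1 - w) * E3"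
  proof -
    have "jprod w q = (1 - w) * (qpoch_inf (w * q) q * qpoch_inf (q * (1 / w)) q * qpoch_inf q q)"
      unfolding jprod_def by (subst qpoch_inf_rec[OF q(1), of w]) simp
    also have "qpoch_inf (w * q) q * qpoch_inf (q * (1 / w)) q * qpoch_inf q q = E3"
      unfolding wf(5) E3_def using qpoch_cube[OF q(1) w, of q] by (simp add: mult_ac)
    finally show ?thesis .
  qed
  have jmw: "jprod (- w) q * m1 = (1 + w) * m3 * E1"
  proof -
    have "jprod (- w) q = (1 + w) * (qpoch_inf (w * (- q)) q * qpoch_inf (- q * (1 / w)) q * qpoch_inf q q)"
      unfolding jprod_def by (subst qpoch_inf_rec[OF q(1), of "- w"]) simp
    also have "\<dots> * m1 = (1 + w) * (qpoch_inf (- q) q * qpoch_inf (w * (- q)) q * qpoch_inf (w\<^sup>2 * (- q)) q) * E1"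
      unfolding wf(5) m1_def E1_def by (simp add: mult_ac)
    also have "\<dots> = (1 + w) * m3 * E1"
      unfolding qpoch_cube[OF q(1) w] m3_def by simp
    finally show ?thesis .
  qed
  have jm1: "jprod (- 1) q = 2 * m1\<^sup>2 * E1"
    unfolding jprod_def m1_def E1_def
    by (subst qpoch_inf_rec[OF q(1), of "-1"]) (simp add: power2_eq_square mult_ac)
  define X where "X = 1 / 2 - logth (q\<^sup>2) w + logth (q\<^sup>2) (q * w)"
  have K: "X * jprod w q * jprod (- 1) q = E1 ^ 3 * jprod (- w) q"
    unfolding X_def E1_def using wf q by (intro kronecker_half_period) auto
  have X: "X = (1 + w) / (2 * (1 - w)) * (1 + 6 * L)"
  proof -
    have nzw: "qpoch_inf w (q\<^sup>2) \<noteq> 0"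
      using q3 wf by (intro qpoch_nonzero_annulus) auto
    have 1: "lambert (q\<^sup>2) w = w / (1 - w) + lambert (q\<^sup>2) (w * q\<^sup>2)"
      by (rule lambert_rec[OF q3(2) nzw])
    have 2: "q\<^sup>2 / w = w\<^sup>2 * q\<^sup>2" "q\<^sup>2 / (q * w) = w\<^sup>2 * q"
      using wf(5) wf(3) q by (simp_all add: power2_eq_square field_simps)
    have "X = 1 / 2 + w / (1 - w) + ((lambert (q\<^sup>2) (w * q\<^sup>2) - lambert (q\<^sup>2) (w\<^sup>2 * q\<^sup>2))
       - (lambert (q\<^sup>2) (w * q) - lambert (q\<^sup>2) (w\<^sup>2 * q)))"
      unfolding X_def logth_def 1 2 by (simp add: mult.commute)
    also have "\<dots> = 1 / 2 + w / (1 - w) + (w - w\<^sup>2) * L"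
      unfolding lambert_cubic_character[OF q w] L_def ..
    also have "1 / 2 + w / (1 - w) = (1 + w) / (2 * (1 - w))"
      using wf by (simp add: divide_simps)
    also have "w - w\<^sup>2 = (1 + w) / (2 * (1 - w)) * 6"
    proof -
      \<comment> \<open>Division with remainder by the minimal polynomial of w: \<open>w - 3\<close>
        is the quotient and \<open>3 * (1 + w)\<close> the remainder.\<close>
      have "(w - w\<^sup>2) * (1 - w) = 3 * (1 + w) + (w - 3) * (w\<^sup>2 + w + 1)"
        by (simp add: algebra_simps power2_eq_square)
      hence "(w - w\<^sup>2) * (1 - w) = 3 * (1 + w)" using w by simp
      hence "w - w\<^sup>2 = 3 * (1 + w) / (1 - w)" using wf(4) by (simp add: eq_divide_eq)
      also have "\<dots> = (1 + w) / (2 * (1 - w)) * 6" using wf(4) by (simp add: divide_simps) (simp add: algebra_simps)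
      finally show ?thesis .
    qed
    finally show ?thesis by (simp only: distrib_left mult_1_right mult.assoc)
  qed
  have th: "theta q 1 = E1 / m1" "theta (q ^ 3) 1 = E3 / m3"
    using theta_product[OF q] theta_product[OF q3(1)] q by (simp_all add: E1_def E3_def m1_def m3_def)
  have "(1 + 6 * L) * E3 * m1 ^ 3 * E1 * (1 + w) = X * jprod w q * jprod (- 1) q * m1"
    unfolding X jw jm1 using wf(4) by (simp add: power2_eq_square power3_eq_cube divide_simps)
  also have "\<dots> = E1 ^ 3 * m3 * E1 * (1 + w)"
    unfolding K using jmw by (simp add: mult_ac)
  finally have "(1 + 6 * L) * E3 * m1 ^ 3 = E1 ^ 3 * m3"
    using nz wf by simp
  hence "(E1 / m1) ^ 3 = E3 / m3 * (1 + 6 * L)"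
    using nz by (simp add: field_simps)
  thus ?thesis unfolding th L_def by (simp add: algebra_simps)
qed

section \<open>Addition formula for the Appell-Lerch sums\<close>

lemma lambert_tendsto:
  assumes "norm p < 1" "norm a < 1" "(g \<longlongrightarrow> a) F"
  shows "((\<lambda>z. lambert p (g z)) \<longlongrightarrow> lambert p a) F"
proof -
  have "((\<lambda>z. lambert p z) \<longlongrightarrow> lambert p a) (at a)"
    using assms by (intro holomorphic_imp_tendsto[where A = "ball 0 1"] lambert_holomorphic qpoch_nonzero_norm
        holomorphic_intros) auto
  thus ?thesis
    by (intro isCont_tendsto_compose[OF _ assms(3)]) (simp add: isCont_def)
qed

text \<open>Along \<open>(q ^ 2 * z, z)\<close> the Appell-Lerch sum has the multiplier of the theta
  function T, so their quotient is elliptic, with simple poles at 1 and q. The difference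
  \<open>logth p z - logth p (z / q)\<close>, scaled by \<open>1 / Om\<close>, is elliptic with
  opposite residues at the same points. The sum H is thus constant; the two claims compare its value
  at 1 with those at \<open>q ^ 2\<close> and \<open>1 / q ^ 2\<close>.\<close>

lemma appell_addition:
  assumes q: "norm q < 1" "q \<noteq> 0"
  defines "Q \<equiv> q ^ 3" and "p \<equiv> q ^ 6"
  shows "appell0 Q (q\<^sup>2) 1 = - q * appell Q (q ^ 4) (q\<^sup>2) + logth p (q\<^sup>2) - logth p q" (is ?th1)
    and "appell0 Q (q\<^sup>2) 1 * theta Q 1 =
           (theta Q 1 - appell Q 1 (q\<^sup>2)) * theta Q (q\<^sup>2) - logth p (q\<^sup>2) * theta Q 1" (is ?th2)
proof -
  define n where "n = norm q"
  have n: "0 < n" "n < 1" using q by (auto simp: n_def)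
  have pw: "n ^ a \<le> n ^ b" if "b \<le> a" for a b using n that by (intro power_decreasing) auto
  have pws: "n ^ a < n ^ b" if "b < a" for a b using n that by (intro power_strict_decreasing) auto
  have Q: "norm Q < 1" "Q \<noteq> 0" "norm Q ^ 2 = n ^ 6" "Q\<^sup>2 = p"
    using q by (auto simp: Q_def p_def norm_power power_less_one_iff n_def power_mult[symmetric])
  have p: "norm p < 1" "p \<noteq> 0" "norm p = n ^ 6"
    using q by (auto simp: p_def norm_power power_less_one_iff n_def)
  \<comment> \<open>The annulus contains 1, q, q^2 and 1/q^2, avoids the translates of the poles 1
    and q by other powers of p, and has radius ratio \<open>n ^ 9\<close>, against
    \<open>n ^ 6\<close> for a period.\<close>
  define A where "A = {z :: complex. n ^ 5 < norm z \<and> norm z < 1 / n ^ 4}"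
  have A: "open A" unfolding A_def by (rule open_annulus)
  have Aup: "norm z * n ^ k < 1" if "z \<in> A" "k \<ge> 4" for z k
  proof -
    have "norm z * n ^ k \<le> norm z * n ^ 4" using that pw by (intro mult_left_mono) auto
    also have "\<dots> < 1" using that n by (simp add: A_def pos_less_divide_eq)
    finally show ?thesis .
  qed
  have Alo: "n ^ k < norm z" if "z \<in> A" "k \<ge> 5" for z k
    using pw[OF that(2)] that by (auto simp: A_def)
  have A0: "z \<noteq> 0" if "z \<in> A" for z using that n by (auto simp: A_def)
  have A1: "1 \<in> A"
    using pws[of 0 5] pws[of 0 4] n by (auto simp: A_def)
  have Aq: "q \<in> A"
  proof -
    have "n * n ^ 4 < 1" using pws[of 0 5] by (simp flip: power_Suc)
    thus ?thesis using pws[of 1 5] n by (auto simp: A_def pos_less_divide_eq n_def[symmetric])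
  qed
  have q1: "q \<noteq> 1" using q by auto
  \<comment> \<open>The shift by \<open>q ^ 5\<close> gives T the multiplier of the Appell-Lerch
    sum; its zero in the annulus is z = q.\<close>
  define T where "T = (\<lambda>z. jprod (q ^ 5 * z) p)"
  define Om where "Om = jprod (q ^ 5) p"
  have qz: "p / (q ^ 5 * z) = q / z" for z
    using q by (simp add: p_def power_eq_if)
  have Om_alt: "Om = jprod q p"
    using jprod_reflect[of p q] q p by (simp add: Om_def p_def power_eq_if)
  have Om_theta: "theta Q (q\<^sup>2) = Om"
  proof -
    have "Q * q\<^sup>2 = q ^ 5" by (simp add: Q_def flip: power_add)
    thus ?thesis using jacobi_triple_product[OF Q(1,2), of "q\<^sup>2"] q Q(4) by (simp add: Om_def)
  qed
  have T_nz: "T z \<noteq> 0" if z: "z \<in> A" "z \<noteq> q" for z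
  proof -
    have "qpoch_inf (q ^ 5 * z) p \<noteq> 0"
      using Aup[OF z(1), of 5] p by (intro qpoch_nonzero_norm) (auto simp: norm_mult norm_power n_def mult.commute)
    moreover have "qpoch_inf (q / z) p \<noteq> 0"
    proof (rule qpoch_nonzero_annulus[OF p(1)])
      have "n * n ^ 6 < norm z" using Alo[OF z(1), of 7] by (simp flip: power_Suc)
      thus "norm (q / z) * norm p < 1"
        using A0[OF z(1)] p by (simp add: norm_divide pos_divide_less_eq n_def)
      show "q / z \<noteq> 1" using z A0[OF z(1)] by simp
    qed
    ultimately show ?thesis
      unfolding T_def jprod_def qz using qpoch_self_nonzero[OF p(1)] by simp
  qed
  have Om_nz: "Om \<noteq> 0" using T_nz[OF A1] q1 by (auto simp: T_def Om_def)
  define N0 where "N0 = (\<lambda>z. appell0 Q (q\<^sup>2 * z) z)"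
  have N_eq: "1 / (1 - z) + N0 z = appell Q (q\<^sup>2 * z) z" if "z \<in> A" for z
    using appell_split[OF Q(1,2), of "q\<^sup>2 * z" z] A0[OF that] q Alo[OF that, of 6] Aup[OF that, of 6] Q(3)
    by (simp add: N0_def)
  have hol_N0: "N0 holomorphic_on A"
    unfolding N0_def using A0 q Alo[of _ 6] Aup[of _ 6] Q(3)
    by (intro appell0_holomorphic Q A holomorphic_intros) auto
  have hol_T: "T holomorphic_on A"
    unfolding T_def using A0 q by (intro holomorphic_intros p) auto
  have hol_D: "(\<lambda>z. logth p z) holomorphic_on A - {1}"
    using A0 Alo[of _ 6] Aup[of _ 6] p by (intro logth_holomorphic holomorphic_intros) auto
  have zq: "norm p < norm (z / q)" "norm (z / q) * norm p < 1" if "z \<in> A" for z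
  proof -
    have "n ^ 6 * n < norm z" using Alo[OF that, of 7] by (simp flip: power_Suc2)
    thus "norm p < norm (z / q)" using n p by (simp add: norm_divide pos_less_divide_eq n_def)
    have "norm z * n ^ 5 < 1" using Aup[OF that, of 5] by simp
    moreover have "n ^ 6 = n ^ 5 * n" by (simp flip: power_Suc2)
    ultimately show "norm (z / q) * norm p < 1" using n p by (simp add: norm_divide n_def[symmetric])
  qed
  have hol_Dq: "(\<lambda>z. logth p (z / q)) holomorphic_on A - {q}"
    using A0 zq p q by (intro logth_holomorphic holomorphic_intros) auto
  define H where "H = (\<lambda>z. (1 / (1 - z) + N0 z) / T z + (logth p z - logth p (z / q)) / Om)"
  define D1 where "D1 = logth p q"
  define D2 where "D2 = logth p (q\<^sup>2)"
  define V where "V = N0 1"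
  have D1q: "logth p (1 / q) = 1 - D1"
    unfolding D1_def using q1 p q pws[of 1 6] pws[of 0 7]
    by (intro logth_minus') (auto simp: n_def[symmetric] simp flip: power_Suc)
  have limH1: "(H \<longlongrightarrow> V / Om) (at 1)"
  proof -
    \<comment> \<open>g isolates the finite part at the pole: \<open>z / Om\<close> has the right
      singular part for \<open>logth\<close>, and the slope of g at 1 is
      \<open>(D1 - 1) / Om\<close>. It is compensated by the value \<open>1 - D1\<close> of
      \<open>logth p (1 / q)\<close>, so that only V remains in the limit.\<close>
    define g where "g = (\<lambda>z. 1 / T z - z / Om)"
    have T1: "T 1 = Om" by (simp add: T_def Om_def)
    have "logth p (q ^ 5) = - D1"
      using q by (simp add: logth_def D1_def p_def power_eq_if)
    have "((\<lambda>z. jprod z p) has_field_derivative (Om * logth p (q ^ 5) / q ^ 5)) (at (q ^ 5 * 1))"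
      using jprod_has_derivative[OF p(1), of "q ^ 5"] q Om_nz by (simp add: Om_def)
    hence "(T has_field_derivative (Om * logth p (q ^ 5) / q ^ 5) * (q ^ 5 * 1)) (at 1)"
      unfolding T_def by (rule DERIV_chain2) (auto intro!: derivative_eq_intros)
    hence dT: "(T has_field_derivative (- D1 * Om)) (at 1)"
      using q \<open>logth p (q ^ 5) = - D1\<close> by (simp add: mult_ac)
    have "(g has_field_derivative ((0 * T 1 - 1 * (- D1 * Om)) / (T 1 * T 1) - 1 / Om)) (at 1)"
      unfolding g_def using Om_nz T1 by (intro DERIV_diff DERIV_divide DERIV_const dT DERIV_cdivide DERIV_ident) auto
    hence "((\<lambda>z. (g z - g 1) / (z - 1)) \<longlongrightarrow> (0 * T 1 - 1 * (- D1 * Om)) / (T 1 * T 1) - 1 / Om) (at 1)"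
      by (simp add: has_field_derivative_iff)
    hence gl: "((\<lambda>z. (g z - g 1) / (z - 1)) \<longlongrightarrow> (D1 - 1) / Om) (at 1)"
      using Om_nz T1 by (simp add: diff_divide_distrib)
    have g1: "g 1 = 0" by (simp add: g_def T1)
    have "((\<lambda>z. - ((g z - g 1) / (z - 1)) + N0 z / T z + (lambert p (p / z) - lambert p (z * p) - logth p (z / q)) / Om)
      \<longlongrightarrow> - ((D1 - 1) / Om) + N0 1 / T 1 + (lambert p p - lambert p p - logth p (1 / q)) / Om) (at 1)"
      using A1 q1 T_nz[OF A1] A p
      by (intro tendsto_intros gl lambert_tendsto holomorphic_imp_tendsto[OF hol_N0 A A1]
           holomorphic_imp_tendsto[OF hol_T A A1] holomorphic_imp_tendsto[OF hol_Dq])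
         (auto intro!: tendsto_eq_intros open_Diff simp: Om_nz)
    moreover have "- ((D1 - 1) / Om) + N0 1 / T 1 + (lambert p p - lambert p p - logth p (1 / q)) / Om = V / Om"
      unfolding D1q T1 V_def by (simp add: diff_divide_distrib)
    moreover have "eventually (\<lambda>z. - ((g z - g 1) / (z - 1)) + N0 z / T z +
        (lambert p (p / z) - lambert p (z * p) - logth p (z / q)) / Om = H z) (at 1)"
    proof -
      have "eventually (\<lambda>z. z \<in> A) (at 1)" using A A1 by (intro eventually_at_in_open') auto
      moreover have "eventually (\<lambda>z. z \<noteq> 1) (at (1::complex))" by (simp add: eventually_at_filter)
      ultimately show ?thesis
      proof eventually_elim
        case (elim z)
        have "qpoch_inf z p \<noteq> 0"
          using elim Aup[of z 6] p by (intro qpoch_nonzero_annulus) auto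
        hence l: "lambert p z = z / (1 - z) + lambert p (z * p)" by (rule lambert_rec[OF p(1)])
        have "H z = 1 / (1 - z) * (1 / T z) + N0 z / T z +
            (lambert p (p / z) - lambert p (z * p) - logth p (z / q)) / Om - z / (1 - z) / Om"
          unfolding H_def logth_def[of p z] l by (simp add: add_divide_distrib diff_divide_distrib)
        also have "1 / (1 - z) * (1 / T z) = z / (1 - z) / Om - (g z - g 1) / (z - 1)"
        proof -
          have m: "y / (z - 1) = - (y / (1 - z))" for y by (simp add: minus_divide_right)
          show ?thesis unfolding g1 g_def m by (simp add: diff_divide_distrib mult.commute T1)
        qed
        finally show ?case by simp
      qed
    qed
    ultimately show ?thesis by (auto intro: Lim_transform_eventually)
  qed
  have limHq: "((\<lambda>z. (z - q) * H z) \<longlongrightarrow> 0) (at q)"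
  proof -
    have f: "filterlim (\<lambda>z. q / z) (at 1) (at q)" "filterlim (\<lambda>z. z / q) (at 1) (at q)"
      using q by (auto simp: filterlim_at eventually_at_filter divide_eq_1_iff intro!: tendsto_eq_intros always_eventually)
    have "((\<lambda>z. jprod (q / z) p / (1 - q / z)) \<longlongrightarrow> qpoch_inf p p ^ 3) (at q)"
      by (rule filterlim_compose[OF jprod_div_tendsto[OF p(1)] f(1)])
    moreover have "((\<lambda>z. (z / q - 1) * logth p (z / q)) \<longlongrightarrow> 1) (at q)"
      by (rule filterlim_compose[OF logth_pole[OF p(1,2)] f(2)])
    ultimately have "((\<lambda>z. z * (1 / (1 - z) + N0 z) / (jprod (q / z) p / (1 - q / z)) +
          ((z - q) * logth p z - q * ((z / q - 1) * logth p (z / q))) / Om) \<longlongrightarrow>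
       q * (1 / (1 - q) + N0 q) / qpoch_inf p p ^ 3 + ((q - q) * logth p q - q * 1) / Om) (at q)"
      using q1 Aq A Om_nz qpoch_self_nonzero[OF p(1)]
      by (intro tendsto_intros holomorphic_imp_tendsto[OF hol_N0 A Aq] holomorphic_imp_tendsto[OF hol_D])
         (auto intro!: open_Diff)
    \<comment> \<open>At z = q the first argument becomes Q, and \<open>appell_self\<close> gives
      exactly the value that cancels the residue of the logarithmic derivative.\<close>
    moreover have "1 / (1 - q) + N0 q = qpoch_inf p p ^ 3 / Om"
    proof -
      have "q\<^sup>2 * q = Q" by (simp add: Q_def power2_eq_square power3_eq_cube)
      hence "1 / (1 - q) + N0 q = appell Q Q q" using N_eq[OF Aq] by simp
      moreover have "appell Q Q q * jprod q p = qpoch_inf p p ^ 3"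
        using appell_self[OF Q(1,2), of q] Alo[OF Aq, of 6] Aup[OF Aq, of 6] q1 Q(3,4) by simp
      ultimately show ?thesis using Om_nz unfolding Om_alt by (simp add: eq_divide_eq)
    qed
    moreover have "eventually (\<lambda>z. z * (1 / (1 - z) + N0 z) / (jprod (q / z) p / (1 - q / z)) +
          ((z - q) * logth p z - q * ((z / q - 1) * logth p (z / q))) / Om = (z - q) * H z) (at q)"
    proof -
      have "eventually (\<lambda>z. z \<in> A) (at q)" using A Aq by (intro eventually_at_in_open') auto
      thus ?thesis
      proof eventually_elim
        case (elim z)
        have "jprod (q ^ 5 * z) p = jprod (q / z) p"
          using jprod_reflect[of p "q ^ 5 * z"] p q A0[OF elim] qz[of z] by simp
        moreover have e: "z * (1 - q / z) = z - q" "q * (z / q - 1) = z - q"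
          using A0[OF elim] q by (simp_all add: right_diff_distrib)
        have "z * X / (J / (1 - q / z)) + ((z - q) * D - q * ((z / q - 1) * E)) / Om
                = (z - q) * (X / J + (D - E) / Om)" for X J D E
        proof -
          have "z * X / (J / (1 - q / z)) = (z * (1 - q / z)) * X / J" by simp
          moreover have "q * ((z / q - 1) * E) = (q * (z / q - 1)) * E" by simp
          ultimately show ?thesis
            unfolding e by (simp only: times_divide_eq_right distrib_left right_diff_distrib[symmetric])
        qed
        ultimately show ?case
          unfolding H_def T_def by simp
      qed
    qed
    ultimately show ?thesis
      using Lim_transform_eventually qpoch_self_nonzero[OF p(1)] by fastforce
  qed
  obtain c where c: "\<And>z. n ^ 5 < norm z \<Longrightarrow> norm z < 1 / n ^ 4 \<Longrightarrow> z \<notin> {1,q} \<Longrightarrow> H z = c"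
    "\<And>k. k \<in> {1,q} \<Longrightarrow> n ^ 5 < norm k \<Longrightarrow> norm k < 1 / n ^ 4 \<Longrightarrow> (H \<longlongrightarrow> c) (at k)"
  proof (rule annulus_elliptic_constant[OF p(1,2), of "n ^ 5" "1 / n ^ 4" "{1,q}" H])
    have r2: "1 / n ^ 4 * norm p = n ^ 2"
      using n p by (simp add: power_eq_if)
    show "n ^ 5 < 1 / n ^ 4 * norm p" unfolding r2 by (rule pws) simp
    show "H holomorphic_on {z. n ^ 5 < norm z \<and> norm z < 1 / n ^ 4} - {1, q}"
      unfolding A_def[symmetric] H_def using T_nz Om_nz
      by (intro holomorphic_intros holomorphic_on_subset[OF hol_N0] holomorphic_on_subset[OF hol_T]
          holomorphic_on_subset[OF hol_D] holomorphic_on_subset[OF hol_Dq]) auto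
    show "((\<lambda>z. (z - k) * H z) \<longlongrightarrow> 0) (at k)" if "k \<in> {1,q}" for k
    proof -
      have "((\<lambda>z. (z - 1) * H z) \<longlongrightarrow> (1 - 1) * (V / Om)) (at 1)"
        by (intro tendsto_intros limH1)
      thus ?thesis using that limHq by auto
    qed
    fix z assume z: "n ^ 5 < norm z" "norm z < 1 / n ^ 4 * norm p" "z / p \<notin> {1,q}" "z \<notin> {1,q}"
    define w where "w = z / p"
    have zw: "z = p * w" using p by (simp add: w_def)
    have z2: "norm z < n ^ 2" using z(2) r2 by simp
    have nw: "norm w = norm z / n ^ 6" using p by (simp add: w_def norm_divide)
    have w4: "norm w < 1 / n ^ 4"
    proof -
      have "norm w < n ^ 2 / n ^ 6" unfolding nw using z2 n by (intro divide_strict_right_mono) auto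
      also have "\<dots> = 1 / n ^ 4" using n by (simp add: divide_simps flip: power_add)
      finally show ?thesis .
    qed
    have w1: "1 < norm w * n"
    proof -
      have "1 < norm z / n ^ 5" using z(1) n by simp
      also have "\<dots> = norm w * n" unfolding nw using n by (simp add: divide_simps flip: power_Suc)
      finally show ?thesis .
    qed
    have wn: "1 < norm w"
    proof -
      have "norm w * n \<le> norm w * 1" using n by (intro mult_left_mono) auto
      thus ?thesis using w1 by linarith
    qed
    have wA: "w \<in> A" using w4 wn pws[of 0 5] by (auto simp: A_def)
    have "1 < 1 / n ^ 4" using pws[of 0 4] n by simp
    hence zA: "z \<in> A" using z(1) z2 pws[of 0 2] by (simp add: A_def)
    have w0: "w \<noteq> 0" using A0[OF wA] .
    have "appell Q (q\<^sup>2 * z) z = - (Q / (q\<^sup>2 * z)) * appell Q (q\<^sup>2 * z / Q\<^sup>2) w"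
      using appell_shift[OF Q(2), of "q\<^sup>2 * z" w] A0[OF zA] q Q(4) zw by simp
    also have "q\<^sup>2 * z / Q\<^sup>2 = q\<^sup>2 * w" using p Q(4) zw by simp
    also have "Q / (q\<^sup>2 * z) = 1 / (q ^ 5 * w)"
      using q w0 unfolding zw Q_def p_def by (simp add: power_eq_if)
    finally have 1: "appell Q (q\<^sup>2 * z) z = - appell Q (q\<^sup>2 * w) w / (q ^ 5 * w)" by simp
    have 2: "T z = - T w / (q ^ 5 * w)"
      using jprod_shift[OF p(1,2), of "q ^ 5 * w"] w0 q by (simp add: T_def zw mult.left_commute)
    have 3: "logth p z = logth p w - 1"
      unfolding zw using Aup[OF wA, of 6] p wn z(3) by (intro logth_shift') (auto simp: w_def)
    have 4: "logth p (z / q) = logth p (w / q) - 1"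
    proof -
      have "norm (w / q) \<ge> 1" using wn n by (simp add: norm_divide n_def[symmetric] pos_le_divide_eq)
      moreover have "w / q \<noteq> 1" using z(3) q by (auto simp: w_def)
      ultimately have "logth p (p * (w / q)) = logth p (w / q) - 1"
        using zq(2)[OF wA] p by (intro logth_shift') auto
      thus ?thesis by (simp add: zw)
    qed
    show "H (z / p) = H z"
      unfolding w_def[symmetric] H_def N_eq[OF wA] N_eq[OF zA] 1 2 3 4 using w0 q by simp
  qed (use n in auto)
  have cV: "c = V / Om"
    using LIM_unique[OF c(2)[of 1] limH1] A1 by (auto simp: A_def)
  have V: "V = appell0 Q (q\<^sup>2) 1" by (simp add: V_def N0_def)
  have nq2: "norm (q\<^sup>2) = n\<^sup>2" by (simp add: n_def norm_power)
  have q2A: "q\<^sup>2 \<in> A"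
  proof -
    have "n\<^sup>2 * n ^ 4 < 1" using pws[of 0 6] by (simp flip: power_add)
    thus ?thesis using pws[of 2 5] n by (auto simp: A_def nq2 pos_less_divide_eq)
  qed
  have q2: "q\<^sup>2 \<noteq> 1" "q\<^sup>2 \<noteq> q"
    using pws[of 0 2] nq2 q q1 by (auto simp: power2_eq_square)
  have Hq2: "H (q\<^sup>2) = V / Om" using c(1)[of "q\<^sup>2"] q2A q2 cV by (auto simp: A_def)
  have T2: "T (q\<^sup>2) = - Om / q"
  proof -
    have "q ^ 5 * q\<^sup>2 = p * q" by (simp add: p_def flip: power_add power_Suc2)
    thus ?thesis using jprod_shift[OF p(1,2) q(2)] by (simp add: T_def Om_alt)
  qed
  have e: "q\<^sup>2 * q\<^sup>2 = q ^ 4" "q\<^sup>2 / q = q"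
    using q by (simp flip: power_add) (simp add: power2_eq_square)
  have "V / Om = appell Q (q ^ 4) (q\<^sup>2) / (- Om / q) + (D2 - D1) / Om"
    unfolding Hq2[symmetric] H_def N_eq[OF q2A] T2 D1_def D2_def e ..
  also have "\<dots> = (- q * appell Q (q ^ 4) (q\<^sup>2) + D2 - D1) / Om"
    using q by (simp add: add_divide_distrib diff_divide_distrib mult.commute)
  finally have "V = - q * appell Q (q ^ 4) (q\<^sup>2) + D2 - D1"
    using Om_nz by simp
  thus ?th1 by (simp add: V D1_def D2_def)
  have n2: "norm (1 / q\<^sup>2) = 1 / n\<^sup>2" by (simp add: nq2 norm_divide)
  have qi: "1 / q\<^sup>2 \<in> A" "1 / q\<^sup>2 \<noteq> 1" "1 / q\<^sup>2 \<noteq> q"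
  proof -
    have "1 < 1 / n\<^sup>2" using n pws[of 0 2] by simp
    moreover have "1 / n\<^sup>2 < 1 / n ^ 4" using n pws[of 2 4] by (intro divide_strict_left_mono) auto
    ultimately show "1 / q\<^sup>2 \<in> A" using pws[of 0 5] by (simp add: A_def n2)
    show "1 / q\<^sup>2 \<noteq> 1" "1 / q\<^sup>2 \<noteq> q"
      using \<open>1 < 1 / n\<^sup>2\<close> n2 n by (metis norm_one order_less_irrefl) (metis \<open>1 < 1 / n\<^sup>2\<close> n(2) n2 n_def not_less_iff_gr_or_eq order.strict_trans)
  qed
  have Hqi: "H (1 / q\<^sup>2) = V / Om" using c(1)[of "1 / q\<^sup>2"] qi cV by (auto simp: A_def)
  have T3: "T (1 / q\<^sup>2) = theta Q 1"
    using jacobi_triple_product[OF Q(1,2), of 1] q Q(4) by (simp add: T_def Q_def power_eq_if)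
  have t_nz: "theta Q 1 \<noteq> 0" using T_nz[OF qi(1,3)] T3 by simp
  have ap: "appell Q (q\<^sup>2 * (1 / q\<^sup>2)) (1 / q\<^sup>2) = theta Q 1 - appell Q 1 (q\<^sup>2)"
    using appell_minus[OF Q(1,2), of 1 "q\<^sup>2"] q2 q Alo[OF q2A, of 6] Aup[OF q2A, of 6] Q(3) by simp
  have l2: "logth p (1 / q\<^sup>2) = 1 - D2"
    unfolding D2_def using p q2 Alo[OF q2A, of 6] Aup[OF q2A, of 6] by (intro logth_minus') auto
  \<comment> \<open>\<open>q ^ 3\<close> is a square root of p and hence fixed by z -> p / z, so
    \<open>logth p\<close> vanishes there; the reflection z -> 1 / z contributes the 1.\<close>
  have l3: "logth p (1 / q\<^sup>2 / q) = 1"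
  proof -
    have "norm (q ^ 3) = n ^ 3" by (simp add: n_def norm_power)
    moreover have "n ^ 3 * n ^ 6 < 1" using pws[of 0 9] by (simp flip: power_add)
    moreover have "q ^ 3 \<noteq> 1" using pws[of 0 3] calculation(1) by auto
    ultimately have "logth p (1 / q ^ 3) = 1 - logth p (q ^ 3)"
      using p pws[of 3 6] by (intro logth_minus') auto
    also have "logth p (q ^ 3) = 0" using q by (simp add: logth_def p_def power_eq_if)
    finally show ?thesis using q by (simp add: power2_eq_square power3_eq_cube mult.assoc)
  qed
  have "V / Om = (theta Q 1 - appell Q 1 (q\<^sup>2)) / theta Q 1 + ((1 - D2) - 1) / Om"
    unfolding Hqi[symmetric] H_def N_eq[OF qi(1)] T3 ap l2 l3 ..
  hence "V * theta Q 1 = (theta Q 1 - appell Q 1 (q\<^sup>2)) * Om - D2 * theta Q 1"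
    using Om_nz t_nz by (simp add: field_simps)
  thus ?th2 by (simp add: V D2_def Om_theta)
qed

text \<open>In \<open>1 + 6 * D1 - 18 * D2\<close> the first addition formula eliminates D1 and the
  second D2. What appears is the same combination of the first two sums that the dissection of the
  rank series produces.\<close>

lemma theta_cube_appell:
  assumes q: "norm q < 1" "q \<noteq> 0"
  defines "Q \<equiv> q ^ 3"
  shows "theta q 1 ^ 3 = theta Q 1 * (1 + 6 * appell0 Q (q\<^sup>2) 1 - 6 * q * appell Q (q ^ 4) (q\<^sup>2))
           + 12 * q\<^sup>2 * theta Q (q\<^sup>2) * appell Q (q ^ 6) (q\<^sup>2)"
proof -
  define t Om V A4 A0 A6 D1 D2 where "t = theta Q 1" and "Om = theta Q (q\<^sup>2)" and "V = appell0 Q (q\<^sup>2) 1"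
    and "A4 = appell Q (q ^ 4) (q\<^sup>2)" and "A0 = appell Q 1 (q\<^sup>2)" and "A6 = appell Q (q ^ 6) (q\<^sup>2)"
    and "D1 = logth (q ^ 6) q" and "D2 = logth (q ^ 6) (q\<^sup>2)"
  have a: "V = - q * A4 + D2 - D1" and b: "V * t = (t - A0) * Om - D2 * t"
    using appell_addition[OF q] unfolding V_def A4_def D1_def D2_def t_def A0_def Om_def Q_def by blast+
  have c: "theta q 1 ^ 3 = t * (1 + 6 * D1 - 18 * D2)"
    using theta_cube_lambert[OF q] by (simp add: t_def Q_def D1_def D2_def)
  \<comment> \<open>Trading \<open>A0\<close> for \<open>A6\<close> absorbs t in the factor
    \<open>t - A0\<close>, so no separate product \<open>t * Om\<close> is left over.\<close>
  have d: "A0 = q\<^sup>2 * A6 + t"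
  proof -
    have Q: "norm Q < 1" "Q \<noteq> 0" "norm Q ^ 2 = norm q ^ 6" "Q\<^sup>2 = q ^ 6"
      using q by (auto simp: Q_def norm_power power_less_one_iff power_mult[symmetric])
    have 1: "norm q ^ 6 < norm q ^ 2" "norm q ^ 8 < norm q ^ 0"
      using q by (intro power_strict_decreasing; simp)+
    have 2: "norm (q\<^sup>2) * norm Q ^ 2 < 1" using 1(2) unfolding Q(3) by (simp add: norm_power flip: power_add)
    have 3: "q\<^sup>2 \<noteq> 1" using q by (metis norm_one norm_power power2_eq_1_iff power_less_one_iff zero_neq_numeral less_irrefl norm_ge_zero pos2)
    show ?thesis
      using appell_shift_x[OF Q(1,2), of "q ^ 6" "q\<^sup>2"] 1 2 3 q Q(3,4)
      by (simp add: norm_power A0_def A6_def t_def)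
  qed
  have e: "q * A4 = D2 - D1 - V" using a by simp
  have "t * (1 + 6 * V - 6 * q * A4) + 12 * q\<^sup>2 * Om * A6 = t + 6 * (V * t) - 6 * t * (q * A4) + 12 * Om * (A0 - t)"
    unfolding d by (simp add: algebra_simps)
  also have "\<dots> = t + 6 * (V * t) - 6 * t * (D2 - D1 - V) - 12 * (V * t + D2 * t)"
    unfolding e by (simp add: b algebra_simps)
  also have "\<dots> = t * (1 + 6 * D1 - 18 * D2)"
    by (simp add: algebra_simps)
  finally show ?thesis unfolding c t_def V_def A4_def Om_def A6_def by simp
qed

section \<open>The rank generating function as an Appell-Lerch sum\<close>

definition qpoch_fin :: "complex \<Rightarrow> complex \<Rightarrow> nat \<Rightarrow> complex" where
  "qpoch_fin a q n = (\<Prod>k<n. 1 - a * q ^ k)"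

lemma qpoch_fin_0 [simp]: "qpoch_fin a q 0 = 1"
  by (simp add: qpoch_fin_def)

lemma qpoch_fin_Suc: "qpoch_fin a q (Suc n) = qpoch_fin a q n * (1 - a * q ^ n)"
  by (simp add: qpoch_fin_def)

lemma qpoch_fin_Suc_shift: "qpoch_fin a q (Suc n) = (1 - a) * qpoch_fin (a * q) q n"
  unfolding qpoch_fin_def by (subst prod.lessThan_Suc_shift) (simp add: mult_ac)

lemma qpoch_fin_upper:
  assumes "norm q < 1" "norm a \<le> R"
  shows "norm (qpoch_fin a q n) \<le> exp (R / (1 - norm q))"
proof -
  have R: "R \<ge> 0" using assms(2) norm_ge_zero[of a] by linarith
  have "norm (qpoch_fin a q n) = (\<Prod>k<n. norm (1 - a * q ^ k))"
    by (simp add: qpoch_fin_def prod_norm)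
  also have "\<dots> \<le> (\<Prod>k<n. exp (R * norm q ^ k))"
  proof (intro prod_mono conjI norm_ge_zero)
    fix k
    have "norm (1 - a * q ^ k) \<le> 1 + norm a * norm q ^ k"
      by (metis norm_mult norm_one norm_power norm_triangle_ineq4)
    also have "\<dots> \<le> 1 + R * norm q ^ k" using assms by (intro add_left_mono mult_right_mono) auto
    also have "\<dots> \<le> exp (R * norm q ^ k)" by (rule exp_ge_add_one_self)
    finally show "norm (1 - a * q ^ k) \<le> exp (R * norm q ^ k)" .
  qed
  also have "\<dots> = exp (R * (\<Sum>k<n. norm q ^ k))"
    by (simp add: exp_sum sum_distrib_left)
  also have "(\<Sum>k<n. norm q ^ k) \<le> (\<Sum>k. norm q ^ k)"
    using assms by (intro sum_le_suminf summable_geometric) auto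
  also have "(\<Sum>k. norm q ^ k) = 1 / (1 - norm q)"
    using assms by (intro suminf_geometric) auto
  finally show ?thesis using R by (simp add: mult_left_mono)
qed

text \<open>Factor by factor, the reciprocal is at most that of the positive product built from s
  and \<open>norm q\<close>. These reciprocals converge, which gives one bound for all a and
  n.\<close>

lemma qpoch_fin_lower:
  assumes q: "norm q < 1" and s: "0 \<le> s" "s < 1"
  obtains M where "M > 0" "\<And>a n. norm a \<le> s \<Longrightarrow> norm (1 / qpoch_fin a q n) \<le> M"
proof -
  define r where "r = norm q"
  have r: "0 \<le> r" "r < 1" using q by (auto simp: r_def)
  have sr: "s * r ^ k < 1" for k
  proof -
    have "s * r ^ k \<le> s * 1" using r s by (intro mult_left_mono power_le_one) auto
    thus ?thesis using s by linarith
  qed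
  have lim: "(\<lambda>n. \<Prod>k<n. 1 - complex_of_real s * of_real r ^ k) \<longlonglongrightarrow> qpoch_inf (of_real s) (of_real r)"
    using r by (intro qpoch_tendsto) auto
  have nz: "qpoch_inf (of_real s) (of_real r) \<noteq> 0"
    using r s by (intro qpoch_nonzero_norm) auto
  have "(\<lambda>n. 1 / (\<Prod>k<n. 1 - complex_of_real s * of_real r ^ k)) \<longlonglongrightarrow> 1 / qpoch_inf (of_real s) (of_real r)"
    by (intro tendsto_intros lim nz)
  from convergent_imp_Bseq[OF convergentI[OF this]]
  obtain M where M: "M > 0" "\<And>n. norm (1 / (\<Prod>k<n. 1 - complex_of_real s * of_real r ^ k)) \<le> M"
    by (auto simp: Bseq_def)
  show ?thesis
  proof
    fix a :: complex and n
    assume a: "norm a \<le> s"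
    have "norm (1 / qpoch_fin a q n) = (\<Prod>k<n. 1 / norm (1 - a * q ^ k))"
      by (simp add: qpoch_fin_def norm_divide prod_norm[symmetric] prod_dividef)
    also have "\<dots> \<le> (\<Prod>k<n. 1 / (1 - s * r ^ k))"
    proof (intro prod_mono conjI)
      fix k
      have "1 - s * r ^ k \<le> 1 - norm (a * q ^ k)"
        using a r by (simp add: norm_mult norm_power r_def mult_right_mono)
      also have "\<dots> \<le> norm (1 - a * q ^ k)" by (metis norm_one norm_triangle_ineq2)
      finally show "1 / norm (1 - a * q ^ k) \<le> 1 / (1 - s * r ^ k)"
        using sr[of k] by (intro divide_left_mono mult_pos_pos) auto
    qed auto
    also have "\<dots> = norm (1 / (\<Prod>k<n. 1 - complex_of_real s * of_real r ^ k))"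
    proof -
      have "1 - complex_of_real s * of_real r ^ k = of_real (1 - s * r ^ k)" for k by simp
      hence "norm (1 - complex_of_real s * of_real r ^ k) = 1 - s * r ^ k" for k
        using sr[of k] by (simp only: norm_of_real)
      thus ?thesis by (simp add: norm_divide prod_norm[symmetric] prod_dividef)
    qed
    also have "\<dots> \<le> M" by (rule M)
    finally show "norm (1 / qpoch_fin a q n) \<le> M" .
  qed (rule M)
qed

lemma qpoch_fin_nonzero:
  assumes "norm q < 1" "norm a < 1"
  shows "qpoch_fin a q n \<noteq> 0"
  using qpoch_nonzero_norm[OF assms] qpoch_inf_eq_0_iff[OF assms(1), of a]
  by (auto simp: qpoch_fin_def)

text \<open>Up to the factor \<open>2 * q * (1 + q)\<close>, the contribution of the overpartitions with largest part
  \<open>2 * n + 1\<close> or \<open>2 * n + 2\<close>.\<close>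

definition rank_term :: "complex \<Rightarrow> complex \<Rightarrow> nat \<Rightarrow> complex" where
  "rank_term q z n = (z * q\<^sup>2) ^ n * qpoch_fin (- q / z) q (2 * n)
     / (qpoch_fin q (q\<^sup>2) (Suc n) * qpoch_fin (q\<^sup>2 / z) (q\<^sup>2) (Suc n))"

text \<open>The finite products are bounded uniformly for \<open>a \<le> norm z\<close> and
  \<open>norm z \<le> b\<close>, leaving the geometric factor. The condition on a keeps
  \<open>q ^ 2 / z\<close> inside a fixed smaller disc, away from zeros of the denominator.\<close>

lemma rank_term_bound:
  assumes q: "norm q < 1" and a: "norm q ^ 2 < a" and b: "a \<le> b"
  obtains C where "C > 0" "\<And>z n. a \<le> norm z \<Longrightarrow> norm z \<le> b \<Longrightarrow> norm (rank_term q z n) \<le> C * (b * norm q ^ 2) ^ n"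
proof -
  have q2: "norm (q\<^sup>2) < 1" using q by (simp add: norm_power power_less_one_iff)
  have apos: "a > 0" using a by (smt (verit) zero_le_power2)
  obtain M1 where M1: "M1 > 0" "\<And>x n. norm x \<le> norm q \<Longrightarrow> norm (1 / qpoch_fin x (q\<^sup>2) n) \<le> M1"
    by (rule qpoch_fin_lower[OF q2, of "norm q"]) (use q in auto)
  obtain M2 where M2: "M2 > 0" "\<And>x n. norm x \<le> norm q ^ 2 / a \<Longrightarrow> norm (1 / qpoch_fin x (q\<^sup>2) n) \<le> M2"
    by (rule qpoch_fin_lower[OF q2, of "norm q ^ 2 / a"]) (use a apos in auto)
  define E where "E = exp (norm q / a / (1 - norm q))"
  show ?thesis
  proof
    show "E * M1 * M2 > 0" using M1 M2 by (simp add: E_def)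
    fix z :: complex and n
    assume z: "a \<le> norm z" "norm z \<le> b"
    have "rank_term q z n = (z * q\<^sup>2) ^ n * (qpoch_fin (- q / z) q (2 * n)
      * (1 / qpoch_fin q (q\<^sup>2) (Suc n)) * (1 / qpoch_fin (q\<^sup>2 / z) (q\<^sup>2) (Suc n)))"
      by (simp add: rank_term_def)
    also have "norm \<dots> \<le> (b * norm q ^ 2) ^ n * (E * M1 * M2)"
      unfolding norm_mult
    proof (intro mult_mono)
      show "norm ((z * q\<^sup>2) ^ n) \<le> (b * norm q ^ 2) ^ n"
        using z by (simp add: norm_power norm_mult power_mono mult_right_mono)
      have "norm (- q / z) \<le> norm q / a"
        using z apos by (simp add: norm_divide frac_le)
      thus "norm (qpoch_fin (- q / z) q (2 * n)) \<le> E" unfolding E_def by (rule qpoch_fin_upper[OF q])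
      show "norm (1 / qpoch_fin q (q\<^sup>2) (Suc n)) \<le> M1" by (rule M1) simp
      have "norm (q\<^sup>2 / z) \<le> norm q ^ 2 / a"
        using z apos by (simp add: norm_divide norm_power frac_le)
      thus "norm (1 / qpoch_fin (q\<^sup>2 / z) (q\<^sup>2) (Suc n)) \<le> M2" by (rule M2)
    qed (use M1 M2 z apos b in \<open>auto simp: E_def\<close>)
    finally show "norm (rank_term q z n) \<le> E * M1 * M2 * (b * norm q ^ 2) ^ n" by (simp add: mult_ac)
  qed
qed

lemma rank_term_summable:
  assumes q: "norm q < 1" and z: "norm q ^ 2 < norm z" "norm z * norm q ^ 2 < 1"
  shows "(\<lambda>n. norm (rank_term q z n)) summable_on UNIV"
proof -
  obtain C where C: "C > 0" "\<And>w n. norm z \<le> norm w \<Longrightarrow> norm w \<le> norm z \<Longrightarrow> norm (rank_term q w n) \<le> C * (norm z * norm q ^ 2) ^ n"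
    using rank_term_bound[OF q z(1) order_refl] by blast
  have "summable (\<lambda>n. C * (norm z * norm q ^ 2) ^ n)"
    using z by (intro summable_mult summable_geometric) auto
  hence "summable (\<lambda>n. norm (rank_term q z n))"
    by (rule summable_comparison_test'[of _ 0]) (use C(2)[of z] in auto)
  thus ?thesis by (intro summable_nonneg_imp_summable_on) auto
qed

definition rank_sum :: "complex \<Rightarrow> complex \<Rightarrow> complex" where
  "rank_sum q z = (\<Sum>\<^sub>\<infinity>n. rank_term q z n)"

lemma rank_sum_sums:
  assumes "norm q < 1" "norm q ^ 2 < norm z" "norm z * norm q ^ 2 < 1"
  shows "rank_term q z sums rank_sum q z"
  unfolding rank_sum_def
  by (rule has_sum_imp_sums[OF has_sum_infsum[OF Infinite_Sum.abs_summable_summable[OF rank_term_summable[OF assms]]]])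

lemma rank_sum_holomorphic:
  assumes q: "norm q < 1" and "open A"
    and A: "\<And>z. z \<in> A \<Longrightarrow> norm q ^ 2 < norm z" "\<And>z. z \<in> A \<Longrightarrow> norm z * norm q ^ 2 < 1"
  shows "rank_sum q holomorphic_on A"
  unfolding rank_sum_def[abs_def]
proof (rule infsum_holomorphic[OF \<open>open A\<close>])
  have q2: "norm (q\<^sup>2) < 1" using q by (simp add: norm_power power_less_one_iff)
  fix n :: nat
  have "qpoch_fin q (q\<^sup>2) (Suc n) \<noteq> 0"
    using q q2 by (intro qpoch_fin_nonzero) auto
  moreover have "qpoch_fin (q\<^sup>2 / z) (q\<^sup>2) (Suc n) \<noteq> 0" "z \<noteq> 0" if "z \<in> A" for z
  proof -
    show "z \<noteq> 0" using A[OF that] by (auto simp: not_less)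
    hence "norm (q\<^sup>2 / z) < 1" using A[OF that] by (simp add: norm_divide norm_power)
    thus "qpoch_fin (q\<^sup>2 / z) (q\<^sup>2) (Suc n) \<noteq> 0" using q2 by (intro qpoch_fin_nonzero)
  qed
  ultimately show "(\<lambda>z. rank_term q z n) holomorphic_on A"
    unfolding rank_term_def qpoch_fin_def by (intro holomorphic_intros) auto
next
  fix K :: "complex set" assume K: "compact K" "K \<subseteq> A"
  show "\<exists>M. M summable_on UNIV \<and> (\<forall>n\<in>UNIV. \<forall>z\<in>K. norm (rank_term q z n) \<le> M n)"
  proof (cases "K = {}")
    case True
    thus ?thesis by (intro exI[of _ "\<lambda>_. 0"]) auto
  next
    case False
    obtain x where x: "x \<in> K" "\<And>z. z \<in> K \<Longrightarrow> norm x \<le> norm z"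
      using continuous_attains_inf[OF K(1) False, of norm] by (auto intro: continuous_intros)
    obtain y where y: "y \<in> K" "\<And>z. z \<in> K \<Longrightarrow> norm z \<le> norm y"
      using continuous_attains_sup[OF K(1) False, of norm] by (auto intro: continuous_intros)
    have xA: "norm q ^ 2 < norm x" "norm x \<le> norm y" using A(1)[of x] x y K by auto
    obtain C where C: "C > 0" "\<And>w n. norm x \<le> norm w \<Longrightarrow> norm w \<le> norm y \<Longrightarrow> norm (rank_term q w n) \<le> C * (norm y * norm q ^ 2) ^ n"
      using rank_term_bound[OF q xA] by blast
    have "summable (\<lambda>n. C * (norm y * norm q ^ 2) ^ n)"
      using A(2)[of y] y K by (intro summable_mult summable_geometric) auto
    hence "(\<lambda>n. C * (norm y * norm q ^ 2) ^ n) summable_on UNIV"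
      using C(1) by (intro summable_nonneg_imp_summable_on) auto
    thus ?thesis using C(2) x(2) y(2) by (intro exI[of _ "\<lambda>n. C * (norm y * norm q ^ 2) ^ n"]) auto
  qed
qed

text \<open>The certificate \<open>c\<close> was found by the \<open>q\<close>-analogue of Gosper summation.\<close>

lemma rank_sum_contiguous:
  assumes q: "norm q < 1" "q \<noteq> 0" and z: "1 < norm z" "norm z * norm q < 1"
  shows "(1 + z * q\<^sup>2) * (1 - 1 / z) * rank_sum q (z * q\<^sup>2) - (1 - z * q\<^sup>2) * (1 + z) * q * rank_sum q z = 1 - q * z"
proof -
  have q2: "norm (q\<^sup>2) < 1" "q\<^sup>2 \<noteq> 0" using q by (auto simp: norm_power power_less_one_iff)
  have z0: "z \<noteq> 0" "z \<noteq> 1" using z by auto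
  have zq: "norm z * norm q ^ 2 < 1"
  proof -
    have "norm z * norm q * norm q < 1 * norm q" using z q by (intro mult_strict_right_mono) auto
    also have "\<dots> < 1" using q by simp
    finally show ?thesis by (simp only: power2_eq_square mult.assoc)
  qed
  have qz: "norm q ^ 2 < norm z" using q2(1) z by (simp add: norm_power)
  have zq2: "norm q ^ 2 < norm (z * q\<^sup>2)" "norm (z * q\<^sup>2) * norm q ^ 2 < 1"
    using z q zq mult_strict_mono[of "norm z * norm q ^ 2" 1 "norm q ^ 2" 1] q2
    by (simp_all add: norm_mult norm_power)
  \<comment> \<open>A common hypergeometric term: up to factors depending only on q and z, both rank
    terms and \<open>V (Suc n)\<close> are rational multiples of \<open>V n\<close>, so the
    telescoping relation reduces to the rational identity \<open>key\<close>.\<close>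
  define V where "V = (\<lambda>n. (z * q\<^sup>2) ^ n * qpoch_fin (- 1 / (q * z)) q (2 * n)
     / (qpoch_fin q (q\<^sup>2) n * qpoch_fin (q\<^sup>2 / z) (q\<^sup>2) n))"
  define c where "c = (\<lambda>n. 1 - (q\<^sup>2) ^ n / (q\<^sup>2 * z\<^sup>2))"
  define A0 where "A0 = (1 + z * q\<^sup>2) * (1 + q * z) / (q\<^sup>2 * z\<^sup>2)"
  have nq2z: "norm (q\<^sup>2 / z) < 1" using qz z0 by (simp add: norm_divide norm_power)
  have nz: "qpoch_fin q (q\<^sup>2) n \<noteq> 0" "qpoch_fin (q\<^sup>2 / z) (q\<^sup>2) n \<noteq> 0" for n
    by (rule qpoch_fin_nonzero[OF q2(1) q(1)], rule qpoch_fin_nonzero[OF q2(1) nq2z])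
  have tel: "A0 * (1 - 1 / z) * rank_term q (z * q\<^sup>2) n
      + (z * q\<^sup>2 - 1) * ((1 + 1 / (q * z)) * (1 + 1 / z)) * rank_term q z n
      = c (Suc n) * V (Suc n) - c n * V n" for n
  proof -
    define X where "X = (q\<^sup>2) ^ n"
    define u where "u = 1 + X / (q * z)"
    define v where "v = 1 + X / z"
    define d where "d = 1 - q * X"
    define e where "e = 1 - q\<^sup>2 / z * X"
    have X2: "q ^ (2 * n) = X" by (simp add: X_def power_mult)
    have d: "qpoch_fin q (q\<^sup>2) (Suc n) = qpoch_fin q (q\<^sup>2) n * d"
      and e: "qpoch_fin (q\<^sup>2 / z) (q\<^sup>2) (Suc n) = qpoch_fin (q\<^sup>2 / z) (q\<^sup>2) n * e"
      by (simp_all add: qpoch_fin_Suc d_def e_def X_def)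
    have de: "d \<noteq> 0" "e \<noteq> 0" using nz[of "Suc n"] unfolding d e by auto
    have uv: "qpoch_fin (- 1 / (q * z)) q (2 * Suc n) = qpoch_fin (- 1 / (q * z)) q (2 * n) * (u * v)"
      using q z0 by (simp add: qpoch_fin_Suc X2 u_def v_def)
    have uv': "qpoch_fin (- 1 / (q * z)) q (2 * Suc n) = (1 + 1 / (q * z)) * (1 + 1 / z) * qpoch_fin (- q / z) q (2 * n)"
    proof -
      have "- 1 / (q * z) * q = - 1 / z" "- 1 / z * q = - q / z" using q by simp_all
      thus ?thesis using qpoch_fin_Suc_shift[of "-1 / (q * z)" q "Suc (2 * n)"]
        qpoch_fin_Suc_shift[of "-1 / z" q "2 * n"] by simp
    qed
    have sh: "qpoch_fin (1 / z) (q\<^sup>2) (Suc n) = (1 - 1 / z) * qpoch_fin (q\<^sup>2 / z) (q\<^sup>2) n"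
      using qpoch_fin_Suc_shift[of "1 / z" "q\<^sup>2" n] by simp
    have VS: "V (Suc n) = V n * (z * q\<^sup>2 * (u * v) / (d * e))"
      unfolding V_def uv d e by (simp add: mult_ac)
    have r1: "(1 - 1 / z) * rank_term q (z * q\<^sup>2) n = V n * (X / d)"
    proof -
      have a: "- q / (z * q\<^sup>2) = - 1 / (q * z)" "q\<^sup>2 / (z * q\<^sup>2) = 1 / z"
        using q by (simp_all add: power2_eq_square)
      have b: "(z * q\<^sup>2 * q\<^sup>2) ^ n = (z * q\<^sup>2) ^ n * X" by (simp add: X_def power_mult_distrib)
      show ?thesis unfolding rank_term_def V_def a b sh d using z0 by (simp add: mult_ac)
    qed
    have r2: "((1 + 1 / (q * z)) * (1 + 1 / z)) * rank_term q z n = V n * ((u * v) / (d * e))"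
    proof -
      have "((1 + 1 / (q * z)) * (1 + 1 / z)) * rank_term q z n = (z * q\<^sup>2) ^ n *
        ((1 + 1 / (q * z)) * (1 + 1 / z) * qpoch_fin (- q / z) q (2 * n)) /
        (qpoch_fin q (q\<^sup>2) (Suc n) * qpoch_fin (q\<^sup>2 / z) (q\<^sup>2) (Suc n))"
        by (simp add: rank_term_def)
      also have "\<dots> = V n * ((u * v) / (d * e))"
        unfolding uv'[symmetric] uv d e V_def by (simp add: mult_ac)
      finally show ?thesis .
    qed
    have key: "A0 * X * e + (z * q\<^sup>2 - 1) * (u * v) = c (Suc n) * (z * q\<^sup>2 * (u * v)) - c n * (d * e)"
      using q z0 unfolding A0_def c_def u_def v_def d_def e_def power_Suc X_def[symmetric]
      by (simp add: divide_simps) (simp add: power2_eq_square algebra_simps)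
    have "A0 * (1 - 1 / z) * rank_term q (z * q\<^sup>2) n
      + (z * q\<^sup>2 - 1) * ((1 + 1 / (q * z)) * (1 + 1 / z)) * rank_term q z n
      = V n * ((A0 * X * e + (z * q\<^sup>2 - 1) * (u * v)) / (d * e))"
      unfolding mult.assoc[of A0] r1 mult.assoc[of "z * q\<^sup>2 - 1"] r2 using de by (simp add: divide_simps) (simp add: algebra_simps)
    also have "\<dots> = c (Suc n) * V (Suc n) - c n * V n"
      unfolding key VS using de by (simp add: divide_simps) (simp add: algebra_simps)
    finally show ?thesis .
  qed
  have lim: "(\<lambda>n. c n * V n) \<longlonglongrightarrow> 0"
  proof -
    obtain M1 where M1: "M1 > 0" "\<And>x n. norm x \<le> norm q \<Longrightarrow> norm (1 / qpoch_fin x (q\<^sup>2) n) \<le> M1"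
      by (rule qpoch_fin_lower[OF q2(1), of "norm q"]) (use q in auto)
    obtain M2 where M2: "M2 > 0" "\<And>x n. norm x \<le> norm (q\<^sup>2 / z) \<Longrightarrow> norm (1 / qpoch_fin x (q\<^sup>2) n) \<le> M2"
      by (rule qpoch_fin_lower[OF q2(1), of "norm (q\<^sup>2 / z)"]) (use nq2z in auto)
    define E where "E = exp (norm (- 1 / (q * z)) / (1 - norm q))"
    have le: "norm (V n) \<le> E * M1 * M2 * (norm z * norm q ^ 2) ^ n" for n
    proof -
      have "V n = (z * q\<^sup>2) ^ n * (qpoch_fin (- 1 / (q * z)) q (2 * n)
        * (1 / qpoch_fin q (q\<^sup>2) n) * (1 / qpoch_fin (q\<^sup>2 / z) (q\<^sup>2) n))"
        by (simp add: V_def)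
      also have "norm \<dots> \<le> (norm z * norm q ^ 2) ^ n * (E * M1 * M2)"
        unfolding norm_mult using M1 M2 qpoch_fin_upper[OF q(1), of "- 1 / (q * z)"]
        by (intro mult_mono) (auto simp: E_def norm_power norm_mult)
      finally show ?thesis by (simp add: mult_ac)
    qed
    have "(\<lambda>n. E * M1 * M2 * (norm z * norm q ^ 2) ^ n) \<longlonglongrightarrow> E * M1 * M2 * 0"
      using zq by (intro tendsto_intros LIMSEQ_power_zero) auto
    hence V0: "V \<longlonglongrightarrow> 0"
      by (intro Lim_null_comparison[OF always_eventually[OF allI[OF le]]]) simp
    have "c \<longlonglongrightarrow> 1 - 0 / (q\<^sup>2 * z\<^sup>2)"
      unfolding c_def using q2 q z0 by (intro tendsto_intros LIMSEQ_power_zero) auto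
    from tendsto_mult[OF this V0] show ?thesis by simp
  qed
  \<comment> \<open>Only the boundary term at n = 0 survives; after the common factor is cancelled
    it becomes the inhomogeneity \<open>1 - q * z\<close>.\<close>
  have "(\<lambda>n. c (Suc n) * V (Suc n) - c n * V n) sums (0 - c 0 * V 0)"
    using lim by (rule telescope_sums)
  moreover have "(\<lambda>n. c (Suc n) * V (Suc n) - c n * V n) sums (A0 * (1 - 1 / z) * rank_sum q (z * q\<^sup>2)
      + (z * q\<^sup>2 - 1) * ((1 + 1 / (q * z)) * (1 + 1 / z)) * rank_sum q z)"
    unfolding tel[symmetric] using zq qz zq2 q by (intro sums_add sums_mult rank_sum_sums) auto
  ultimately have "A0 * (1 - 1 / z) * rank_sum q (z * q\<^sup>2)
      + (z * q\<^sup>2 - 1) * ((1 + 1 / (q * z)) * (1 + 1 / z)) * rank_sum q z = - (c 0 * V 0)"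
    by (simp add: sums_unique2)
  moreover have "c 0 * V 0 = (q * z - 1) * (q * z + 1) / (q\<^sup>2 * z\<^sup>2)"
    using q z0 by (simp add: c_def V_def divide_simps) (simp add: power2_eq_square algebra_simps)
  moreover have "(1 + 1 / (q * z)) * (1 + 1 / z) = (1 + q * z) * q * (1 + z) / (q\<^sup>2 * z\<^sup>2)"
    using q z0 by (simp add: divide_simps) (simp add: power2_eq_square algebra_simps)
  ultimately have "A0 * (1 - 1 / z) * rank_sum q (z * q\<^sup>2)
      + (z * q\<^sup>2 - 1) * ((1 + q * z) * q * (1 + z) / (q\<^sup>2 * z\<^sup>2)) * rank_sum q z
      = - ((q * z - 1) * (q * z + 1) / (q\<^sup>2 * z\<^sup>2))" by simp
  moreover have "K / D * (P * m * R1 - (1 - z * q\<^sup>2) * (1 + z) * q * R2) =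
      P * K / D * m * R1 + (z * q\<^sup>2 - 1) * (K * q * (1 + z) / D) * R2" if "D \<noteq> 0" for K D P m R1 R2
    using that by (simp add: divide_simps) (simp add: algebra_simps)
  moreover have "- ((q * z - 1) * (q * z + 1) / D) = ((1 + q * z) / D) * (1 - q * z)" if "D \<noteq> 0" for D
    using that by (simp add: divide_simps) (simp add: algebra_simps)
  moreover have "q\<^sup>2 * z\<^sup>2 \<noteq> 0" using q z0 by simp
  ultimately have "((1 + q * z) / (q\<^sup>2 * z\<^sup>2)) * ((1 + z * q\<^sup>2) * (1 - 1 / z) * rank_sum q (z * q\<^sup>2)
      - (1 - z * q\<^sup>2) * (1 + z) * q * rank_sum q z) = ((1 + q * z) / (q\<^sup>2 * z\<^sup>2)) * (1 - q * z)"
    unfolding A0_def by simp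
  moreover have "1 + q * z \<noteq> 0"
  proof
    assume "1 + q * z = 0"
    hence "q * z = - 1" by (simp add: add_eq_0_iff)
    hence "norm q * norm z = 1" by (metis norm_minus_cancel norm_mult norm_one)
    thus False using z by (simp add: mult.commute)
  qed
  ultimately show ?thesis using q z0 by simp
qed

definition rank_gf :: "complex \<Rightarrow> complex \<Rightarrow> complex" where
  "rank_gf q z = 2 * q * (1 + q) * rank_sum q z"

text \<open>The prefactor \<open>(1 + z) / (1 - z)\<close> absorbs the coefficients of
  \<open>rank_sum_contiguous\<close>, so that the multiplier becomes the monomial
  \<open>- q * z\<close>, which a theta function can compensate.\<close>

lemma rank_gf_shift:
  assumes q: "norm q < 1" "q \<noteq> 0" and z: "1 < norm z" "norm z * norm q < 1"
  shows "(1 + z * q\<^sup>2) / (1 - z * q\<^sup>2) * (1 + rank_gf q (z * q\<^sup>2))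
       = 1 - q * z - q * z * ((1 + z) / (1 - z) * (1 + rank_gf q z))"
proof -
  have z0: "z \<noteq> 0" "1 - z \<noteq> 0" using z by auto
  have "norm z * norm q * norm q < 1 * 1" using z q by (intro mult_strict_mono) auto
  hence z1: "1 - z * q\<^sup>2 \<noteq> 0"
    by (metis eq_iff_diff_eq_0 less_irrefl mult.assoc mult_1 norm_mult norm_one power2_eq_square)
  define G where "G = rank_sum q z"
  have c: "(1 + z * q\<^sup>2) * (1 - 1 / z) * rank_sum q (z * q\<^sup>2) = 1 - q * z + (1 - z * q\<^sup>2) * (1 + z) * q * G"
    using rank_sum_contiguous[OF assms] by (simp add: G_def algebra_simps)
  have "(1 + z * q\<^sup>2) * (1 - z) * rank_sum q (z * q\<^sup>2) = - z * ((1 + z * q\<^sup>2) * (1 - 1 / z) * rank_sum q (z * q\<^sup>2))"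
    using z0 by (simp add: field_simps)
  hence c': "(1 + z * q\<^sup>2) * (1 - z) * rank_sum q (z * q\<^sup>2) = - z * (1 - q * z + (1 - z * q\<^sup>2) * (1 + z) * q * G)"
    unfolding c .
  have "((1 + z * q\<^sup>2) * (1 + rank_gf q (z * q\<^sup>2))) * (1 - z) =
      (1 + z * q\<^sup>2) * (1 - z) + 2 * q * (1 + q) * ((1 + z * q\<^sup>2) * (1 - z) * rank_sum q (z * q\<^sup>2))"
    by (simp add: rank_gf_def algebra_simps)
  also have "\<dots> = (1 - z * q\<^sup>2) * ((1 - q * z) * (1 - z) - q * z * ((1 + z) * (1 + rank_gf q z)))"
    unfolding c' rank_gf_def G_def[symmetric] by (simp add: algebra_simps power2_eq_square)
  finally have "(1 + z * q\<^sup>2) * (1 + rank_gf q (z * q\<^sup>2)) =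
     (1 - z * q\<^sup>2) * ((1 - q * z) * (1 - z) - q * z * ((1 + z) * (1 + rank_gf q z))) / (1 - z)"
    using z0 by (simp add: eq_divide_eq)
  also have "\<dots> = (1 - z * q\<^sup>2) * (1 - q * z - q * z * ((1 + z) / (1 - z) * (1 + rank_gf q z)))"
  proof -
    have "((1 - q * z) * (1 - z) - q * z * ((1 + z) * W)) / (1 - z) = 1 - q * z - q * z * ((1 + z) / (1 - z) * W)" for W
      using z0 by (simp add: diff_divide_distrib)
    thus ?thesis by (simp only: times_divide_eq_right[symmetric])
  qed
  finally show ?thesis using z1 by (simp add: divide_eq_eq mult.commute)
qed

text \<open>At z = 1 the terms are differences of the finite overpartition products P and telescope.
  The value fixes the residue at z = 1 in the comparison with the Appell-Lerch sum.\<close>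

lemma rank_gf_1:
  assumes q: "norm q < 1" "q \<noteq> 0"
  shows "1 + rank_gf q 1 = 1 / theta q 1"
proof -
  have q2: "norm (q\<^sup>2) < 1" using q by (auto simp: norm_power power_less_one_iff)
  define P where "P = (\<lambda>n. qpoch_fin (- q) q (2 * n) / qpoch_fin q q (2 * n))"
  have even: "qpoch_fin q q (2 * n) = qpoch_fin q (q\<^sup>2) n * qpoch_fin (q\<^sup>2) (q\<^sup>2) n" for n
  proof (induction n)
    case (Suc n)
    have e: "2 * Suc n = Suc (Suc (2 * n))" "q ^ (2 * n) = (q\<^sup>2) ^ n" by (simp_all add: power_mult)
    show ?case unfolding e(1) qpoch_fin_Suc Suc.IH power_Suc e(2) by (simp add: power2_eq_square mult_ac)
  qed simp
  have nz: "qpoch_fin q (q\<^sup>2) n \<noteq> 0" "qpoch_fin (q\<^sup>2) (q\<^sup>2) n \<noteq> 0" for n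
    by (rule qpoch_fin_nonzero[OF q2 q(1)], rule qpoch_fin_nonzero[OF q2 q2])
  have tel: "2 * q * (1 + q) * rank_term q 1 n = P (Suc n) - P n" for n
  proof -
    define y where "y = q * (q\<^sup>2) ^ n"
    have y: "q * q ^ (2 * n) = y" by (simp add: y_def power_mult)
    define N where "N = qpoch_fin (- q) q (2 * n)"
    define D where "D = qpoch_fin q (q\<^sup>2) n * qpoch_fin (q\<^sup>2) (q\<^sup>2) n"
    have a: "qpoch_fin (- q) q (2 * Suc n) = N * ((1 + y) * (1 + q * y))"
    proof -
      have "2 * Suc n = Suc (Suc (2 * n))" by simp
      thus ?thesis unfolding N_def
        by (simp only: qpoch_fin_Suc power_Suc mult_minus_left mult.assoc y diff_minus_eq_add)
    qed
    have b: "qpoch_fin q (q\<^sup>2) (Suc n) * qpoch_fin (q\<^sup>2) (q\<^sup>2) (Suc n) = D * ((1 - y) * (1 - q * y))"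
      by (simp add: qpoch_fin_Suc D_def y_def power2_eq_square mult_ac)
    have nz': "D \<noteq> 0" "1 - y \<noteq> 0" "1 - q * y \<noteq> 0"
      using b nz[of n] nz[of "Suc n"] by (auto simp: D_def)
    have P: "P (Suc n) = N * ((1 + y) * (1 + q * y)) / (D * ((1 - y) * (1 - q * y)))" "P n = N / D"
      unfolding P_def even a b N_def D_def by simp_all
    have "2 * q * (1 + q) * rank_term q 1 n = 2 * (1 + q) * y * N / (D * ((1 - y) * (1 - q * y)))"
      unfolding b[symmetric] by (simp add: rank_term_def N_def y_def mult_ac)
    also have "\<dots> = P (Suc n) - P n"
      unfolding P using nz' by (simp add: divide_simps) (simp add: algebra_simps)
    finally show ?thesis .
  qed
  have nzE: "qpoch_inf q q \<noteq> 0" using qpoch_self_nonzero[OF q(1)] .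
  have sub: "filterlim (\<lambda>n. 2 * n) at_top sequentially" for n :: nat
    by (auto intro!: filterlim_subseq simp: strict_mono_def)
  have "P \<longlonglongrightarrow> qpoch_inf (- q) q / qpoch_inf q q"
    unfolding P_def qpoch_fin_def
    by (intro tendsto_divide nzE filterlim_compose[OF qpoch_tendsto[OF q(1)]] sub)
  hence "(\<lambda>n. P (Suc n) - P n) sums (qpoch_inf (- q) q / qpoch_inf q q - P 0)"
    by (rule telescope_sums)
  moreover have "(\<lambda>n. P (Suc n) - P n) sums rank_gf q 1"
    unfolding tel[symmetric] rank_gf_def using q q2
    by (intro sums_mult rank_sum_sums) (auto simp: norm_power)
  ultimately have "rank_gf q 1 = qpoch_inf (- q) q / qpoch_inf q q - P 0"
    by (rule sums_unique2[symmetric])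
  thus ?thesis using theta_product[OF q] by (simp add: P_def)
qed

text \<open>The inhomogeneous parts of the two q-difference equations agree, so the difference is
  multiplied by \<open>- q * z\<close> and \<open>jprod (q * z) p\<close> by the inverse. The poles
  at 1 cancel by \<open>rank_gf_1\<close>. The vanishing point is z = q, where the theta factor
  becomes \<open>jprod p p\<close>.\<close>

lemma rank_gf_appell:
  assumes q: "norm q < 1" "q \<noteq> 0" and y: "norm y = 1" "y \<noteq> 1"
  shows "(1 + y) * (1 + rank_gf q y) * theta q 1 = (1 - y) * (2 * appell q 1 y - theta q 1)"
proof -
  define p where "p = q\<^sup>2"
  have p: "norm p < 1" "p \<noteq> 0" "norm p = norm q ^ 2"
    using q by (auto simp: p_def norm_power power_less_one_iff)
  have pq: "norm q ^ 2 < norm q" using p q by (simp add: power2_eq_square)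
  define t where "t = theta q 1"
  have t: "t \<noteq> 0"
    using theta_product[OF q] qpoch_self_nonzero[OF q(1)] qpoch_nonzero_norm[OF q(1), of "-q"] q
    by (simp add: t_def)
  \<comment> \<open>The inner radius is where \<open>q ^ 2 / z\<close> leaves the unit disc, the
    outer one where the hypothesis of \<open>rank_gf_shift\<close> ends; the ratio of the radii
    still exceeds a period of p.\<close>
  define A where "A = {z :: complex. norm q ^ 2 < norm z \<and> norm z < 1 / norm q}"
  have A: "open A" unfolding A_def by (rule open_annulus)
  have in_A: "norm q ^ 2 < norm z" "norm z * norm q < 1" "norm z * norm q ^ 2 < 1" "z \<noteq> 0" if "z \<in> A" for z
  proof -
    show 1: "norm q ^ 2 < norm z" "norm z * norm q < 1" "z \<noteq> 0"
      using that q by (auto simp: A_def pos_less_divide_eq)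
    have "norm z * norm q ^ 2 \<le> norm z * norm q" using pq by (intro mult_left_mono) auto
    thus "norm z * norm q ^ 2 < 1" using 1 by linarith
  qed
  have "1 < 1 / norm q" using q by simp
  hence A1: "1 \<in> A" using p by (auto simp: A_def)
  define J where "J = (\<lambda>z. jprod (q * z) p)"
  define N0 where "N0 = (\<lambda>z. appell0 q 1 z)"
  define H where "H = (\<lambda>z. ((1 + z) / (1 - z) * (1 + rank_gf q z) - (2 * (1 / (1 - z) + N0 z) / t - 1)) * J z)"
  have N_eq: "1 / (1 - z) + N0 z = appell q 1 z" if "z \<in> A" for z
    using appell_split[OF q, of 1 z] in_A[OF that] by (simp add: N0_def)
  have hol_N0: "N0 holomorphic_on A"
    unfolding N0_def using in_A by (intro appell0_holomorphic q A holomorphic_intros) auto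
  have hol_J: "J holomorphic_on A"
    unfolding J_def using in_A q by (intro holomorphic_intros p) auto
  have hol_F: "rank_gf q holomorphic_on A"
    unfolding rank_gf_def[abs_def] using in_A by (intro holomorphic_intros rank_sum_holomorphic q A) auto
  have lim1: "((\<lambda>z. (z - 1) * H z) \<longlongrightarrow> 0) (at 1)"
  proof -
    have "((\<lambda>z. - ((1 + z) * (1 + rank_gf q z) - (2 * (1 + (1 - z) * N0 z) / t - (1 - z))) * J z)
       \<longlongrightarrow> - ((1 + 1) * (1 + rank_gf q 1) - (2 * (1 + (1 - 1) * N0 1) / t - (1 - 1))) * J 1) (at 1)"
      using t by (intro tendsto_intros holomorphic_imp_tendsto[OF hol_F A A1] holomorphic_imp_tendsto[OF hol_N0 A A1]
         holomorphic_imp_tendsto[OF hol_J A A1])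
    moreover have "- ((1 + 1) * (1 + rank_gf q 1) - (2 * (1 + (1 - 1) * N0 1) / t - (1 - 1))) * J 1 = 0"
      unfolding rank_gf_1[OF q] t_def by simp
    moreover have "eventually (\<lambda>z. - ((1 + z) * (1 + rank_gf q z) - (2 * (1 + (1 - z) * N0 z) / t - (1 - z))) * J z
       = (z - 1) * H z) (at 1)"
      unfolding eventually_at_filter
    proof (intro always_eventually allI impI)
      fix z :: complex assume "z \<noteq> 1"
      hence z: "1 - z \<noteq> 0" by simp
      have "(1 + z) * (1 + rank_gf q z) = (1 - z) * ((1 + z) / (1 - z) * (1 + rank_gf q z))"
        "1 + (1 - z) * N0 z = (1 - z) * (1 / (1 - z) + N0 z)"
        using z distrib_left[of "1 - z" "1 / (1 - z)" "N0 z"] by simp_all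
      moreover have "- ((1 - z) * a - (2 * ((1 - z) * b) / t - (1 - z))) * j = (z - 1) * ((a - (2 * b / t - 1)) * j)" for a b j
        using t by (simp add: divide_simps) (simp add: algebra_simps)
      ultimately show "- ((1 + z) * (1 + rank_gf q z) - (2 * (1 + (1 - z) * N0 z) / t - (1 - z))) * J z = (z - 1) * H z"
        unfolding H_def by (simp only:)
    qed
    ultimately show ?thesis by (auto intro: Lim_transform_eventually)
  qed
  obtain c where c: "\<And>z. norm q ^ 2 < norm z \<Longrightarrow> norm z < 1 / norm q \<Longrightarrow> z \<notin> {1} \<Longrightarrow> H z = c"
  proof (rule annulus_elliptic_constant[OF p(1,2), of "norm q ^ 2" "1 / norm q" "{1}" H])
    have r2: "1 / norm q * norm p = norm q"
      using q p by (simp add: power2_eq_square)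
    show "norm q ^ 2 < 1 / norm q * norm p" unfolding r2 by (rule pq)
    show "H holomorphic_on {z. norm q ^ 2 < norm z \<and> norm z < 1 / norm q} - {1}"
      unfolding A_def[symmetric] H_def using t
      by (intro holomorphic_intros holomorphic_on_subset[OF hol_N0] holomorphic_on_subset[OF hol_J]
          holomorphic_on_subset[OF hol_F]) auto
    show "((\<lambda>z. (z - k) * H z) \<longlongrightarrow> 0) (at k)" if "k \<in> {1}" for k
      using that lim1 by auto
    fix z assume z: "norm q ^ 2 < norm z" "norm z < 1 / norm q * norm p" "z / p \<notin> {1}" "z \<notin> {1}"
    define w where "w = z / p"
    have zw: "z = w * q\<^sup>2" "z = p * w" using p by (simp_all add: w_def p_def)
    have nw: "norm w = norm z / norm q ^ 2" using p by (simp add: w_def norm_divide)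
    have zlt: "norm z < norm q" using z(2) r2 by simp
    have w1: "1 < norm w" unfolding nw using z(1) q by simp
    have w2: "norm w * norm q < 1"
      unfolding nw using zlt q by (simp add: power2_eq_square divide_simps)
    have wA: "w \<in> A" using w1 w2 q p by (auto simp: A_def pos_less_divide_eq)
    have "norm q < 1 / norm q" using q \<open>1 < 1 / norm q\<close> by linarith
    hence zA: "z \<in> A" using z(1) zlt by (simp add: A_def)
    have 1: "(1 + z) / (1 - z) * (1 + rank_gf q z) = 1 - q * w - q * w * ((1 + w) / (1 - w) * (1 + rank_gf q w))"
      unfolding zw(1) by (rule rank_gf_shift[OF q w1 w2])
    have 2: "appell q 1 z = t - q * w * appell q 1 w"
    proof -
      have "theta q (q\<^sup>2 * (1 / q\<^sup>2)) = - theta q (1 / q\<^sup>2) / (q * (1 / q\<^sup>2))"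
        using q by (intro theta_shift) auto
      hence th: "theta q (1 / q\<^sup>2) = - t / q"
        using q by (simp add: t_def power2_eq_square field_simps)
      have "appell q 1 z = - q * appell q (1 / q\<^sup>2) w"
        using appell_shift[OF q(2), of 1 w] by (simp add: zw(2) p_def)
      also have "appell q (1 / q\<^sup>2) w = w * appell q 1 w + theta q (1 / q\<^sup>2)"
        using in_A[OF wA] w1 z(3) by (intro appell_shift_x q) (auto simp: w_def)
      finally show ?thesis using q by (simp add: th algebra_simps)
    qed
    have 3: "J z = - J w / (q * w)"
      using jprod_shift[OF p(1,2), of "q * w"] in_A[OF wA] q by (simp add: J_def zw(2) mult_ac)
    have "q * w \<noteq> 0" using q in_A[OF wA] by simp
    have "H z = (- (q * w)) * ((1 + w) / (1 - w) * (1 + rank_gf q w) - (2 * appell q 1 w / t - 1)) * (- J w / (q * w))"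
    proof -
      have "1 - u - u * X - (2 * (t - u * a) / t - 1) = (- u) * (X - (2 * a / t - 1))" for u X a
        using t by (simp add: divide_simps) (simp add: algebra_simps)
      thus ?thesis unfolding H_def N_eq[OF zA] 1 2 3 by (simp only:)
    qed
    also have "\<dots> = H w" unfolding H_def N_eq[OF wA] using \<open>q * w \<noteq> 0\<close> by simp
    finally show "H (z / p) = H z" by (simp add: w_def)
  qed (use q in auto)
  have "H q = c" using c[of q] pq q \<open>1 < 1 / norm q\<close> by fastforce
  moreover have "J q = 0"
  proof -
    have "jprod p p = 0" using jprod_shift[OF p(1,2), of 1] p by simp
    thus ?thesis by (simp add: J_def p_def power2_eq_square)
  qed
  ultimately have c0: "c = 0" by (simp add: H_def)
  have yA: "y \<in> A" using y p \<open>1 < 1 / norm q\<close> by (simp add: A_def)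
  have "H y = 0" using c[of y] c0 y yA by (simp add: A_def)
  moreover have "J y \<noteq> 0"
  proof -
    have "norm (q * y) < 1" using y q by (simp add: norm_mult)
    moreover have "norm p < norm (q * y)" using y pq p by (simp add: norm_mult)
    moreover have "norm (q * y) * norm p < 1" using calculation p(1) mult_strict_mono[of "norm (q * y)" 1 "norm p" 1] by simp
    ultimately show ?thesis unfolding J_def by (intro jprod_nonzero_annulus p) auto
  qed
  ultimately have "(1 + y) / (1 - y) * (1 + rank_gf q y) = 2 * appell q 1 y / t - 1"
    unfolding H_def N_eq[OF yA] by simp
  moreover have "(1 + y) * (1 + rank_gf q y) = (1 - y) * ((1 + y) / (1 - y) * (1 + rank_gf q y))"
    using y by simp
  moreover have "(2 * appell q 1 y / t - 1) * t = 2 * appell q 1 y - t"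
    using t by (simp add: left_diff_distrib)
  ultimately show ?thesis by (simp only: mult.assoc t_def[symmetric])
qed

section \<open>Dissection modulo 3\<close>

text \<open>The class of 2 is parametrised as the negative of \<open>3 * m + 1\<close>, so that an
  even summand yields the same series for both nonzero classes; this gives the factor 2 in
  \<open>theta_dissection\<close>.\<close>

lemma infsum_int_mod3:
  fixes f :: "int \<Rightarrow> 'a :: banach"
  assumes "f summable_on UNIV"
  shows "(\<Sum>\<^sub>\<infinity>n. f n) = (\<Sum>\<^sub>\<infinity>m. f (3 * m)) + (\<Sum>\<^sub>\<infinity>m. f (3 * m + 1)) + (\<Sum>\<^sub>\<infinity>m. f (- 3 * m - 1))"
proof -
  define A B C where "A = range (\<lambda>m::int. 3 * m)" and "B = range (\<lambda>m::int. 3 * m + 1)" and "C = range (\<lambda>m::int. - 3 * m - 1)"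
  have s: "f summable_on X" for X using assms summable_on_subset_banach by blast
  have dj: "A \<inter> B = {}" "(A \<union> B) \<inter> C = {}" unfolding A_def B_def C_def by (auto; presburger)+
  have un: "A \<union> B \<union> C = UNIV"
  proof (intro UNIV_eq_I[symmetric])
    fix n :: int
    have "n mod 3 = 0 \<or> n mod 3 = 1 \<or> n mod 3 = 2" by presburger
    moreover have "n = 3 * (n div 3) + n mod 3" by simp
    ultimately have "n = 3 * (n div 3) \<or> n = 3 * (n div 3) + 1 \<or> n = - 3 * (- (n div 3) - 1) - 1" by presburger
    thus "n \<in> A \<union> B \<union> C" unfolding A_def B_def C_def by blast
  qed
  have "infsum f UNIV = infsum f A + infsum f B + infsum f C"
    unfolding un[symmetric] by (subst infsum_Un_disjoint; (intro s dj)?) (subst infsum_Un_disjoint; (intro s dj)?; simp)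
  moreover have "infsum f A = (\<Sum>\<^sub>\<infinity>m. f (3 * m))" "infsum f B = (\<Sum>\<^sub>\<infinity>m. f (3 * m + 1))"
    "infsum f C = (\<Sum>\<^sub>\<infinity>m. f (- 3 * m - 1))"
    unfolding A_def B_def C_def by (subst infsum_reindex; simp add: inj_on_def o_def)+
  ultimately show ?thesis by simp
qed

lemma minus_one_powi_mod3:
  "(-1 :: complex) powi (3 * m) = (-1) powi m"
  "(-1 :: complex) powi (3 * m + 1) = - ((-1) powi m)"
  "(-1 :: complex) powi (- 3 * m - 1) = - ((-1) powi m)"
proof -
  show 1: "(-1 :: complex) powi (3 * m) = (-1) powi m" for m
    by (simp add: power_int_mult)
  show "(-1 :: complex) powi (3 * m + 1) = - ((-1) powi m)"
    by (simp add: power_int_add 1)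
  have "(-1 :: complex) powi (- 3 * m - 1) = - ((-1) powi (3 * (- m)))"
    by (simp add: power_int_diff)
  thus "(-1 :: complex) powi (- 3 * m - 1) = - ((-1) powi m)"
    unfolding 1 power_int_minus_one_minus .
qed

lemma theta_dissection:
  assumes q: "norm q < 1" "q \<noteq> 0"
  shows "theta q 1 = theta (q ^ 9) 1 - 2 * q * theta (q ^ 9) (q ^ 6)"
proof -
  define f where "f = (\<lambda>n::int. (-1) powi n * q powi (n\<^sup>2))"
  have th: "theta q 1 = infsum f UNIV" by (simp add: theta_def f_def)
  have summ: "f summable_on UNIV"
    using theta_summable[OF q, of 1 UNIV] by (simp add: f_def)
  have pw: "(q ^ k) powi m = q powi (int k * m)" for k m by (simp add: power_int_power)
  have 0: "f (3 * m) = (-1) powi m * (q ^ 9) powi (m\<^sup>2) * 1 powi m" for m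
    unfolding f_def minus_one_powi_mod3 pw by (simp add: power2_eq_square)
  have e: "q powi ((3 * m + 1)\<^sup>2) = q * ((q ^ 9) powi (m\<^sup>2) * (q ^ 6) powi m)" for m
  proof -
    have "(3 * m + 1)\<^sup>2 = 9 * m\<^sup>2 + 6 * m + 1" by (simp add: power2_eq_square algebra_simps)
    thus ?thesis unfolding pw using q by (simp add: power_int_add mult_ac)
  qed
  have 1: "f (3 * m + 1) = - q * ((-1) powi m * (q ^ 9) powi (m\<^sup>2) * (q ^ 6) powi m)" for m
    unfolding f_def minus_one_powi_mod3 e by simp
  have 2: "f (- 3 * m - 1) = - q * ((-1) powi m * (q ^ 9) powi (m\<^sup>2) * (q ^ 6) powi m)" for m
  proof -
    have "(- 3 * m - 1)\<^sup>2 = (3 * m + 1)\<^sup>2" by (simp add: power2_eq_square algebra_simps)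
    thus ?thesis unfolding f_def minus_one_powi_mod3 by (simp only: e) simp
  qed
  show ?thesis
    unfolding th infsum_int_mod3[OF summ] 0 1 2 infsum_cmult_right' by (simp add: theta_def)
qed

definition rank_lambert :: "complex \<Rightarrow> int \<Rightarrow> complex" where
  "rank_lambert q n = (-1) powi n * q powi (n\<^sup>2 + 2 * n) / (1 - q powi (6 * n))"

text \<open>The term \<open>n = 0\<close> of \<^const>\<open>rank_lambert\<close> is \<open>1 / 0 = 0\<close>, so it may be included in sums.\<close>

lemma rank_lambert_summable:
  assumes q: "norm q < 1" "q \<noteq> 0"
  shows "rank_lambert q summable_on UNIV"
proof -
  have q3: "norm (q ^ 3) < 1" "q ^ 3 \<noteq> 0" using q by (auto simp: norm_power power_less_one_iff)
  have q6: "norm (q ^ 3) ^ 2 < 1" using q by (simp add: norm_power power_less_one_iff flip: power_mult)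
  define C where "C = norm (q\<^sup>2) + norm (1 / q\<^sup>2)"
  define d where "d = pole_gap (q ^ 3) 1"
  have d: "d > 0" unfolding d_def using q6 q3 by (intro pole_gap_pos) auto
  have "rank_lambert q summable_on -{0}"
  proof (rule Infinite_Sum.abs_summable_summable[OF Infinite_Sum.abs_summable_on_comparison_test'])
    show "(\<lambda>m::int. norm q ^ nat (m\<^sup>2) * C ^ nat \<bar>m\<bar> * (1 / d)) summable_on -{0}"
      unfolding C_def using q by (intro summable_on_cmult_left summable_on_gaussian) auto
    fix m :: int assume m: "m \<in> -{0}"
    have "(q ^ 3) powi (2 * m) = q powi (6 * m)" by (simp add: power_int_power)
    hence "d \<le> norm (1 - q powi (6 * m))"
      using pole_gap_le[OF q3, of m 1] m by (simp add: d_def)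
    moreover have "q powi (m\<^sup>2 + 2 * m) = q powi (m\<^sup>2) * (q\<^sup>2) powi m"
      using q by (simp add: power_int_add power_int_power)
    moreover have "norm ((-1) powi m * q powi (m\<^sup>2) * (q\<^sup>2) powi m) \<le> norm q ^ nat (m\<^sup>2) * C ^ nat \<bar>m\<bar>"
      using q by (intro norm_gaussian_term_le) (auto simp: C_def)
    moreover have "C \<ge> 0" by (simp add: C_def)
    ultimately show "norm (rank_lambert q m) \<le> norm q ^ nat (m\<^sup>2) * C ^ nat \<bar>m\<bar> * (1 / d)"
      unfolding rank_lambert_def norm_divide[of _ "1 - _"] times_divide_eq_right mult_1_right
      using d by (intro frac_le) (auto simp: mult.assoc)
  qed
  moreover have un: "insert 0 (-{0::int}) = UNIV" by auto
  ultimately show ?thesis using summable_on_insert_iff[of "rank_lambert q" 0 "-{0}"] by (simp only: un)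
qed

text \<open>Every class produces the nome \<open>q ^ 9\<close>, with z = 1 for the multiples of 3
  and z = \<open>q ^ 6\<close> otherwise. In the class \<open>- 3 * m - 1\<close> this requires
  multiplying numerator and denominator by \<open>q powi (18 * m + 6)\<close>; the sign change of
  the denominator makes the coefficient \<open>q ^ 5\<close> positive.\<close>

lemma rank_lambert_dissection:
  assumes q: "norm q < 1" "q \<noteq> 0"
  shows "infsum (rank_lambert q) UNIV = appell0 (q ^ 9) (q ^ 6) 1 - q ^ 3 * appell (q ^ 9) (q ^ 12) (q ^ 6)
     + q ^ 5 * appell (q ^ 9) (q ^ 18) (q ^ 6)"
proof -
  have pw: "(q ^ k) powi m = q powi (int k * m)" for k m by (simp add: power_int_power)
  have nzm: "1 - q powi (18 * m + 6) \<noteq> 0" for m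
  proof -
    have n: "norm (q ^ 9) < 1" "q ^ 9 \<noteq> 0" using q by (auto simp: norm_power power_less_one_iff)
    have "norm q ^ 18 < norm q ^ 6" "norm q ^ 24 < norm q ^ 0"
      using q by (intro power_strict_decreasing; simp)+
    hence "norm (q ^ 9) ^ 2 < norm (q ^ 6)" "norm (q ^ 6) * norm (q ^ 9) ^ 2 < 1"
      by (simp_all add: norm_power flip: power_mult power_add)
    moreover have "q ^ 6 \<noteq> 1"
    proof
      assume "q ^ 6 = 1"
      hence "norm q ^ 6 = 1" by (metis norm_one norm_power)
      thus False using q power_less_one_iff[of "norm q" 6] by simp
    qed
    ultimately have "1 - q ^ 6 * (q ^ 9) powi (2 * m) \<noteq> 0" by (intro one_minus_powi_nonzero n)
    thus ?thesis unfolding pw using q by (simp add: power_int_add mult.commute)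
  qed
  have p0: "rank_lambert q (3 * m) = (-1) powi m * (q ^ 9) powi (m\<^sup>2) * (q ^ 6) powi m / (1 - 1 * (q ^ 9) powi (2 * m))" for m
  proof -
    have "(3 * m)\<^sup>2 + 2 * (3 * m) = 9 * m\<^sup>2 + 6 * m" "6 * (3 * m) = 18 * m" by (simp_all add: power2_eq_square)
    thus ?thesis unfolding rank_lambert_def minus_one_powi_mod3 pw using q by (simp add: power_int_add)
  qed
  have p1: "rank_lambert q (3 * m + 1) = - (q ^ 3) * ((-1) powi m * (q ^ 9) powi (m\<^sup>2) * (q ^ 12) powi m
      / (1 - q ^ 6 * (q ^ 9) powi (2 * m)))" for m
  proof -
    have "(3 * m + 1)\<^sup>2 + 2 * (3 * m + 1) = 9 * m\<^sup>2 + 12 * m + 3" "6 * (3 * m + 1) = 18 * m + 6"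
      by (simp_all add: power2_eq_square algebra_simps)
    hence e: "q powi ((3 * m + 1)\<^sup>2 + 2 * (3 * m + 1)) = q powi (9 * m\<^sup>2) * q powi (12 * m) * q ^ 3"
      "q powi (6 * (3 * m + 1)) = q ^ 6 * q powi (18 * m)"
      using q by (simp_all add: power_int_add)
    show ?thesis unfolding rank_lambert_def minus_one_powi_mod3 pw e by simp
  qed
  have p2: "rank_lambert q (- 3 * m - 1) = q ^ 5 * ((-1) powi m * (q ^ 9) powi (m\<^sup>2) * (q ^ 18) powi m
      / (1 - q ^ 6 * (q ^ 9) powi (2 * m)))" for m
  proof -
    define y where "y = q powi (18 * m + 6)"
    have y: "y \<noteq> 0" "1 - y \<noteq> 0" using q nzm[of m] by (simp_all add: y_def)
    have h: "(- 3 * m - 1)\<^sup>2 + 2 * (- 3 * m - 1) = (9 * m\<^sup>2 + 5 + 18 * m) - (18 * m + 6)"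
      "6 * (- 3 * m - 1) = - (18 * m + 6)"
      by (simp_all add: power2_eq_square algebra_simps)
    have e: "q powi ((- 3 * m - 1)\<^sup>2 + 2 * (- 3 * m - 1)) = q powi (9 * m\<^sup>2 + 5 + 18 * m) / y"
      "q powi (6 * (- 3 * m - 1)) = 1 / y"
      unfolding h y_def power_int_minus inverse_eq_divide using q by (subst power_int_diff) auto
    have e2: "q powi (9 * m\<^sup>2 + 5 + 18 * m) = q powi (9 * m\<^sup>2) * q ^ 5 * q powi (18 * m)"
      "q ^ 6 * q powi (18 * m) = y"
      using q by (simp_all add: power_int_add y_def)
    have "- s * (X / y) / (1 - 1 / y) = s * X / (1 - y)" for s X
    proof -
      have "1 - 1 / y = - ((1 - y) / y)" using y by (simp add: diff_divide_distrib)
      thus ?thesis using y by simp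
    qed
    thus ?thesis unfolding rank_lambert_def minus_one_powi_mod3 pw e by (simp add: e2)
  qed
  have q9: "norm (q ^ 9) < 1" "q ^ 9 \<noteq> 0" "norm (q ^ 9) ^ 2 < 1"
    using q by (auto simp: norm_power power_less_one_iff simp flip: power_mult)
  have "infsum (rank_lambert q) UNIV = appell (q ^ 9) (q ^ 6) 1 - q ^ 3 * appell (q ^ 9) (q ^ 12) (q ^ 6)
     + q ^ 5 * appell (q ^ 9) (q ^ 18) (q ^ 6)"
    unfolding infsum_int_mod3[OF rank_lambert_summable[OF q]] p0 p1 p2 infsum_cmult_right'
    by (simp add: appell_def)
  also have "appell (q ^ 9) (q ^ 6) 1 = appell0 (q ^ 9) (q ^ 6) 1"
    using appell_split[OF q9(1,2), of "q ^ 6" 1] q q9 by simp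
  finally show ?thesis .
qed

text \<open>The summands g and h agree only after the terms for n and -n are added, so twice the
  sums are compared. With \<open>x = q powi (2 * n)\<close> the pair has denominators
  \<open>1 - w * x\<close> and \<open>1 - w ^ 2 * x\<close>, which the factor \<open>1 - x\<close>
  completes to \<open>1 - x ^ 3\<close>; this is how the denominators in q^(6n) arise.\<close>

lemma rank_gf_lambert:
  assumes q: "norm q < 1" "q \<noteq> 0" and w: "w\<^sup>2 + w + 1 = 0"
  shows "(1 + rank_gf q w) * theta q 1 = 1 + 6 * infsum (rank_lambert q) UNIV"
proof -
  note wf = cube_root_facts[OF w]
  have q2: "norm q ^ 2 < 1" using q by (simp add: power_less_one_iff)
  define s where "s = (\<lambda>n::int. (-1) powi n * q powi (n\<^sup>2))"
  define g where "g = (\<lambda>n. 2 * (s n / (1 - w * q powi (2 * n))) + (- s n))"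
  define k where "k = (1 + w) / (1 - w)"
  have k: "k \<noteq> 0" using wf by (simp add: k_def)
  have sa: "(\<lambda>n. s n / (1 - w * q powi (2 * n))) summable_on UNIV" "s summable_on UNIV"
    using appell_summable[OF q, of 1 w] theta_summable[OF q, of 1 UNIV] wf q2 by (simp_all add: s_def)
  have g_sum: "infsum g UNIV = 2 * appell q 1 w - theta q 1"
  proof -
    have "infsum g UNIV = (\<Sum>\<^sub>\<infinity>n. 2 * (s n / (1 - w * q powi (2 * n)))) + (\<Sum>\<^sub>\<infinity>n. - s n)"
      unfolding g_def using sa by (intro infsum_add summable_on_cmult_right summable_on_uminus[THEN iffD2])
    thus ?thesis
      unfolding infsum_cmult_right' infsum_uminus by (simp add: appell_def theta_def s_def)
  qed
  have g_summ: "g summable_on UNIV"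
    unfolding g_def using sa by (intro summable_on_add summable_on_cmult_right summable_on_uminus[THEN iffD2])
  \<comment> \<open>The central value is inserted by hand, since \<open>rank_lambert q 0\<close> is
    a division by zero and equals 0.\<close>
  define h where "h = (\<lambda>n. k * (if n = 0 then 1 else 6 * rank_lambert q n))"
  have "((\<lambda>n::int. if n = 0 then 1 else 0 :: complex) has_sum 1) UNIV"
    by (rule has_sum_finite_neutralI[where B = "{0}"]) auto
  moreover have "(rank_lambert q has_sum infsum (rank_lambert q) UNIV) UNIV"
    using rank_lambert_summable[OF q] by (rule has_sum_infsum)
  ultimately have "((\<lambda>n. k * ((if n = 0 then 1 else 0) + 6 * rank_lambert q n)) has_sum
       (k * (1 + 6 * infsum (rank_lambert q) UNIV))) UNIV"
    by (intro has_sum_cmult_right has_sum_add)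
  also have "(\<lambda>n. k * ((if n = 0 then 1 else 0) + 6 * rank_lambert q n)) = h"
    by (auto simp: h_def rank_lambert_def fun_eq_iff)
  finally have h_sum: "(h has_sum (k * (1 + 6 * infsum (rank_lambert q) UNIV))) UNIV" .
  have sym: "g n + g (- n) = h n + h (- n)" for n
  proof (cases "n = 0")
    case True
    have "2 * (1 / (1 - w)) - 1 = (1 + w) / (1 - w)" using wf by (simp add: divide_simps)
    thus ?thesis using True by (simp add: g_def h_def s_def k_def)
  next
    case False
    define x where "x = q powi (2 * n)"
    have x0: "x \<noteq> 0" using q by (simp add: x_def)
    have "norm (q ^ 3) < 1" "q ^ 3 \<noteq> 0" "norm (q ^ 3) ^ 2 < 1"
      using q by (auto simp: norm_power power_less_one_iff simp flip: power_mult)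
    hence "1 - 1 * (q ^ 3) powi (2 * n) \<noteq> 0"
      using pole_gap_le[of "q ^ 3" n 1] pole_gap_pos[of "q ^ 3" 1] False by auto
    moreover have "(q ^ 3) powi (2 * n) = x ^ 3"
      by (simp add: x_def power_int_power power_int_power')
    ultimately have x3: "1 - x ^ 3 \<noteq> 0" by simp
    hence nz: "1 - x \<noteq> 0" "1 - w * x \<noteq> 0" "1 - w\<^sup>2 * x \<noteq> 0"
      using one_minus_cube[OF w, of x] by auto
    have q6: "q powi (6 * n) = x ^ 3" by (simp add: x_def power_int_power')
    have sm: "s (- n) = s n" by (simp add: s_def power_int_minus flip: power_int_inverse)
    have xm: "q powi (2 * (- n)) = 1 / x" "q powi (6 * (- n)) = 1 / x ^ 3"
      unfolding q6[symmetric] by (simp_all add: x_def power_int_minus inverse_eq_divide)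
    have rl: "rank_lambert q n = s n * x / (1 - x ^ 3)" "rank_lambert q (- n) = s n * (1 / x) / (1 - 1 / x ^ 3)"
    proof -
      show "rank_lambert q n = s n * x / (1 - x ^ 3)"
        unfolding rank_lambert_def q6 using q by (simp add: s_def x_def power_int_add)
      have "(- n)\<^sup>2 + 2 * (- n) = n\<^sup>2 - 2 * n" by simp
      hence "q powi ((- n)\<^sup>2 + 2 * (- n)) = q powi (n\<^sup>2) * (1 / x)"
        using q by (simp add: power_int_diff x_def)
      thus "rank_lambert q (- n) = s n * (1 / x) / (1 - 1 / x ^ 3)"
        unfolding rank_lambert_def xm by (simp add: s_def power_int_minus flip: power_int_inverse)
    qed
    have "1 - w / x = - ((w - x) / x)" using x0 by (simp add: diff_divide_distrib)
    moreover have "w - x = w * (1 - w\<^sup>2 * x)"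
      using wf(1) by (simp add: algebra_simps power2_eq_square power3_eq_cube)
    ultimately have "1 - w * (1 / x) = - (w * (1 - w\<^sup>2 * x) / x)" by simp
    hence "1 / (1 - w * (1 / x)) = - (x * (1 / w)) / (1 - w\<^sup>2 * x)"
      using x0 wf(3) nz by simp
    hence e1: "1 / (1 - w * (1 / x)) = - (x * w\<^sup>2) / (1 - w\<^sup>2 * x)"
      by (simp only: wf(5))
    have e2: "(1 / x) / (1 - 1 / x ^ 3) = - (x\<^sup>2) / (1 - x ^ 3)"
    proof -
      have "1 - 1 / x ^ 3 = - ((1 - x ^ 3) / x ^ 3)" using x0 by (simp add: diff_divide_distrib)
      thus ?thesis using x0 by (simp add: power2_eq_square power3_eq_cube)
    qed
    have key: "2 * (1 / (1 - w * x)) + 2 * (- (x * w\<^sup>2) / (1 - w\<^sup>2 * x)) - 2 = k * (6 * (x / (1 - x ^ 3)) + 6 * (- (x\<^sup>2) / (1 - x ^ 3)))"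
    proof -
      have "2 * (1 / (1 - w * x)) + 2 * (- (x * w\<^sup>2) / (1 - w\<^sup>2 * x)) - 2 =
          (2 * (1 - w\<^sup>2 * x) - 2 * (x * w\<^sup>2) * (1 - w * x) - 2 * ((1 - w * x) * (1 - w\<^sup>2 * x))) / ((1 - w * x) * (1 - w\<^sup>2 * x))"
        using nz by (simp add: divide_simps)
      also have "2 * (1 - w\<^sup>2 * x) - 2 * (x * w\<^sup>2) * (1 - w * x) - 2 * ((1 - w * x) * (1 - w\<^sup>2 * x)) = 2 * (w - w\<^sup>2) * x"
        by (simp add: algebra_simps)
      also have "2 * (w - w\<^sup>2) * x / ((1 - w * x) * (1 - w\<^sup>2 * x)) = 2 * (w - w\<^sup>2) * x * (1 - x) / (1 - x ^ 3)"
        unfolding one_minus_cube[OF w, of x, symmetric] using nz by simp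
      also have "2 * (w - w\<^sup>2) = 6 * k"
      proof -
        have "(w - w\<^sup>2) * (1 - w) = 3 * (1 + w) + (w - 3) * (w\<^sup>2 + w + 1)"
          by (simp add: algebra_simps power2_eq_square)
        hence "(w - w\<^sup>2) * (1 - w) = 3 * (1 + w)" using w by simp
        hence "w - w\<^sup>2 = 3 * (1 + w) / (1 - w)" using wf(4) by (simp add: eq_divide_eq)
        thus ?thesis by (simp add: k_def)
      qed
      also have "6 * k * x * (1 - x) / (1 - x ^ 3) = k * (6 * (x / (1 - x ^ 3)) + 6 * (- (x\<^sup>2) / (1 - x ^ 3)))"
        using x3 by (simp add: divide_simps) (simp add: algebra_simps power2_eq_square)
      finally show ?thesis .
    qed
    have "g n + g (- n) = s n * (2 * (1 / (1 - w * x)) + 2 * (1 / (1 - w * (1 / x))) - 2)"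
      unfolding g_def sm xm x_def[symmetric] by (simp add: algebra_simps)
    also have "\<dots> = s n * (k * (6 * (x / (1 - x ^ 3)) + 6 * ((1 / x) / (1 - 1 / x ^ 3))))"
      unfolding e1 e2 key ..
    also have "\<dots> = h n + h (- n)"
      using False unfolding h_def rl by (simp add: algebra_simps)
    finally show ?thesis .
  qed
  have refl: "((\<lambda>n. f (- n)) has_sum S) UNIV" if "(f has_sum S) UNIV" for f :: "int \<Rightarrow> complex" and S
    using that has_sum_reindex_bij_betw[of "\<lambda>n::int. - n" UNIV UNIV f S]
    by (simp add: bij_uminus)
  have gs: "(g has_sum (2 * appell q 1 w - theta q 1)) UNIV"
    unfolding g_sum[symmetric] using g_summ by (rule has_sum_infsum)
  have "((\<lambda>n. g n + g (- n)) has_sum (2 * appell q 1 w - theta q 1 + (2 * appell q 1 w - theta q 1))) UNIV"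
    by (intro has_sum_add gs refl)
  moreover have "((\<lambda>n. g n + g (- n)) has_sum (k * (1 + 6 * infsum (rank_lambert q) UNIV) + k * (1 + 6 * infsum (rank_lambert q) UNIV))) UNIV"
    unfolding sym by (intro has_sum_add h_sum refl)
  ultimately have "2 * appell q 1 w - theta q 1 + (2 * appell q 1 w - theta q 1) =
      k * (1 + 6 * infsum (rank_lambert q) UNIV) + k * (1 + 6 * infsum (rank_lambert q) UNIV)"
    by (rule has_sum_unique)
  hence "2 * appell q 1 w - theta q 1 = k * (1 + 6 * infsum (rank_lambert q) UNIV)"
    by (simp only: mult_2[symmetric] mult_cancel_left) simp
  hence "(1 + w) * ((1 + rank_gf q w) * theta q 1) = (1 + w) * (1 + 6 * infsum (rank_lambert q) UNIV)"
    using rank_gf_appell[OF q wf(2,4)] wf(4) by (simp add: k_def mult.assoc)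
  thus ?thesis using wf(8) by simp
qed

text \<open>\<open>theta_cube_appell\<close> at \<open>q ^ 3\<close> removes the first two sums of
  the dissection. Its term with \<open>12 * q ^ 6 * Om\<close> is the part \<open>2 * q * Om\<close>
  of \<open>theta q 1\<close> that is missing for the last sum to carry the full factor
  \<open>theta q 1\<close>. The right-hand side does not involve w.\<close>

lemma rank_gf_cubic:
  assumes q: "norm q < 1" "q \<noteq> 0" and w: "w\<^sup>2 + w + 1 = 0"
  shows "(1 + rank_gf q w) * theta q 1 * theta (q ^ 9) 1 =
    theta (q ^ 3) 1 ^ 3 + 6 * q ^ 5 * theta q 1 * appell (q ^ 9) (q ^ 18) (q ^ 6)"
proof -
  have q3: "norm (q ^ 3) < 1" "q ^ 3 \<noteq> 0" using q by (auto simp: norm_power power_less_one_iff)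
  define V A4 A6 Om t9 where "V = appell0 (q ^ 9) (q ^ 6) 1" and "A4 = appell (q ^ 9) (q ^ 12) (q ^ 6)"
    and "A6 = appell (q ^ 9) (q ^ 18) (q ^ 6)" and "Om = theta (q ^ 9) (q ^ 6)" and "t9 = theta (q ^ 9) 1"
  have *: "theta (q ^ 3) 1 ^ 3 = t9 * (1 + 6 * V - 6 * q ^ 3 * A4) + 12 * q ^ 6 * Om * A6"
    using theta_cube_appell[OF q3]
    by (simp add: V_def A4_def A6_def Om_def t9_def flip: power_mult)
  have th: "theta q 1 = t9 - 2 * q * Om"
    using theta_dissection[OF q] by (simp add: t9_def Om_def)
  have gf: "(1 + rank_gf q w) * theta q 1 = 1 + 6 * (V - q ^ 3 * A4 + q ^ 5 * A6)"
    unfolding rank_gf_lambert[OF assms] rank_lambert_dissection[OF q] V_def A4_def A6_def ..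
  have q6: "q ^ 6 = q * q ^ 5" by (simp flip: power_Suc)
  have "(1 + 6 * (V - c * A4 + d * A6)) * t9 =
      t9 * (1 + 6 * V - 6 * c * A4) + 12 * (q * d) * Om * A6 + 6 * d * (t9 - 2 * q * Om) * A6" for c d
    by (simp add: algebra_simps)
  thus ?thesis
    unfolding * gf A6_def[symmetric] t9_def[symmetric] unfolding q6 th by simp
qed

section \<open>Counting overpartitions by rank\<close>

lemma has_sum_prod_mult:
  fixes f :: "'a \<Rightarrow> complex" and g :: "'b \<Rightarrow> complex"
  assumes f: "(f has_sum a) A" "(\<lambda>x. norm (f x)) summable_on A"
    and g: "(g has_sum b) B" "(\<lambda>x. norm (g x)) summable_on B"
  shows "((\<lambda>(x, y). f x * g y) has_sum (a * b)) (A \<times> B)"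
    and "(\<lambda>(x, y). norm (f x * g y)) summable_on (A \<times> B)"
proof -
  show 1: "(\<lambda>(x, y). norm (f x * g y)) summable_on (A \<times> B)"
  proof (rule summable_on_SigmaI)
    show "((\<lambda>y. case (x, y) of (x, y) \<Rightarrow> norm (f x * g y)) has_sum norm (f x) * infsum (\<lambda>y. norm (g y)) B) B" for x
      unfolding prod.case norm_mult using g(2) by (intro has_sum_cmult_right has_sum_infsum)
    show "(\<lambda>x. norm (f x) * infsum (\<lambda>y. norm (g y)) B) summable_on A"
      using f(2) by (rule summable_on_cmult_left)
  qed auto
  have "(\<lambda>z. norm ((\<lambda>(x, y). f x * g y) z)) summable_on (A \<times> B)"
    using 1 by (simp add: case_prod_unfold)
  hence 2: "(\<lambda>(x, y). f x * g y) summable_on (A \<times> B)"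
    by (rule Infinite_Sum.abs_summable_summable)
  show "((\<lambda>(x, y). f x * g y) has_sum (a * b)) (A \<times> B)"
  proof (rule has_sum_SigmaI[OF _ _ 2])
    show "((\<lambda>y. case (x, y) of (x, y) \<Rightarrow> f x * g y) has_sum f x * b) B" for x
      unfolding prod.case by (intro has_sum_cmult_right g)
    show "((\<lambda>x. f x * b) has_sum a * b) A" by (intro has_sum_cmult_left f)
  qed
qed

section \<open>Overpartitions built up by largest part, and their weights\<close>

definition overpartitions_le :: "nat \<Rightarrow> overpartition set" where
  "overpartitions_le m = {(P, S). set_mset P \<subseteq> {1..m} \<and> S \<subseteq> set_mset P}"

definition overpartitions_max :: "nat \<Rightarrow> overpartition set" where
  "overpartitions_max m = {(P, S). set_mset P \<subseteq> {1..Suc m} \<and> S \<subseteq> set_mset P \<and> Suc m \<in># P}"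

text \<open>Counts all parts except the odd non-overlined ones, that is, \<open>n - n_o\<close> in
  the rank. Overlined parts are distinct, so the odd ones among them are counted in the set
  S.\<close>

definition nontrivial_parts :: "overpartition \<Rightarrow> nat" where
  "nontrivial_parts = (\<lambda>(P, S). size (filter_mset even P) + card {k \<in> S. odd k})"

definition weight :: "complex \<Rightarrow> complex \<Rightarrow> overpartition \<Rightarrow> complex" where
  "weight q y = (\<lambda>(P, S). y ^ nontrivial_parts (P, S) * q ^ \<Sum>\<^sub># P)"

text \<open>There is always at least one copy of the new part k, hence \<open>Suc c\<close>; b
  decides whether its first occurrence is overlined. An overpartition with largest part k arises
  exactly once from its smaller parts, c and b.\<close>

definition add_parts :: "nat \<Rightarrow> overpartition \<times> nat \<times> bool \<Rightarrow> overpartition" where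
  "add_parts k = (\<lambda>((P, S), c, b). (P + replicate_mset (Suc c) k, if b then insert k S else S))"

definition remove_parts :: "nat \<Rightarrow> overpartition \<Rightarrow> overpartition \<times> nat \<times> bool" where
  "remove_parts k = (\<lambda>(P, S). ((filter_mset (\<lambda>x. x \<noteq> k) P, S - {k}), count P k - 1, k \<in> S))"

definition plain_factor :: "complex \<Rightarrow> complex \<Rightarrow> nat \<Rightarrow> complex" where
  "plain_factor q y k = (if even k then y * q ^ k else q ^ k)"

lemma size_odd_nonoverlined:
  assumes "S \<subseteq> set_mset P"
  shows "int (num_parts (P, S)) - int (size (odd_nonoverlined (P, S))) = int (nontrivial_parts (P, S))"
proof -
  have fin: "finite S" using assms finite_subset by blast
  have "mset_set S \<subseteq># P"
    using assms fin unfolding subseteq_mset_def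
    by (metis count_greater_eq_one_iff count_mset_set(1) count_mset_set(3) le0 subsetD)
  hence sub: "filter_mset odd (mset_set S) \<subseteq># filter_mset odd P" by (rule multiset_filter_mono)
  have "odd_nonoverlined (P, S) = filter_mset odd P - filter_mset odd (mset_set S)"
    by (simp add: odd_nonoverlined_def)
  moreover have "size (filter_mset odd (mset_set S)) = card {k \<in> S. odd k}"
    using fin by (simp add: filter_mset_mset_set)
  ultimately have "size (odd_nonoverlined (P, S)) + card {k \<in> S. odd k} = size (filter_mset odd P)"
    using size_Diff_submset[OF sub] size_mset_mono[OF sub] by simp
  moreover have "size P = size (filter_mset even P) + size (filter_mset odd P)"
  proof -
    have "size P = size (filter_mset even P + filter_mset odd P)"
      by (rule arg_cong[OF multiset_partition])
    thus ?thesis by (simp only: size_union)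
  qed
  ultimately show ?thesis by (simp add: num_parts_def nontrivial_parts_def)
qed

lemma add_parts_bij:
  "bij_betw (add_parts (Suc m)) (overpartitions_le m \<times> UNIV) (overpartitions_max m)"
proof (rule bij_betw_byWitness[where f' = "remove_parts (Suc m)"])
  show "\<forall>a\<in>overpartitions_le m \<times> UNIV. remove_parts (Suc m) (add_parts (Suc m) a) = a"
  proof
    fix a :: "overpartition \<times> nat \<times> bool"
    assume a: "a \<in> overpartitions_le m \<times> UNIV"
    obtain P S c b where abc: "a = ((P, S), c, b)" by (metis prod.exhaust)
    have P: "set_mset P \<subseteq> {1..m}" "S \<subseteq> set_mset P" using a abc by (auto simp: overpartitions_le_def)
    hence n: "Suc m \<notin># P" "Suc m \<notin> S" by auto
    have "filter_mset (\<lambda>x. x \<noteq> Suc m) P = P"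
      using n by (auto simp: multiset_eq_iff not_in_iff)
    thus "remove_parts (Suc m) (add_parts (Suc m) a) = a"
      using n by (auto simp: abc remove_parts_def add_parts_def not_in_iff)
  qed
  show "\<forall>x\<in>overpartitions_max m. add_parts (Suc m) (remove_parts (Suc m) x) = x"
  proof
    fix x :: overpartition
    assume x: "x \<in> overpartitions_max m"
    obtain P S where PS: "x = (P, S)" by (metis prod.exhaust)
    have "count P (Suc m) > 0" using x PS by (auto simp: overpartitions_max_def)
    hence "filter_mset (\<lambda>x. x \<noteq> Suc m) P + replicate_mset (Suc (count P (Suc m) - 1)) (Suc m) = P"
      by (auto simp: multiset_eq_iff)
    thus "add_parts (Suc m) (remove_parts (Suc m) x) = x"
      by (auto simp: PS add_parts_def remove_parts_def)
  qed
  show "add_parts (Suc m) ` (overpartitions_le m \<times> UNIV) \<subseteq> overpartitions_max m"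
    by (auto simp: add_parts_def overpartitions_le_def overpartitions_max_def split: if_splits)
  show "remove_parts (Suc m) ` overpartitions_max m \<subseteq> overpartitions_le m \<times> UNIV"
    by (auto simp: remove_parts_def overpartitions_le_def overpartitions_max_def le_Suc_eq)
qed

lemma weight_add_parts:
  assumes "x \<in> overpartitions_le m"
  shows "weight q y (add_parts (Suc m) (x, c, b)) =
    weight q y x * ((if b then y * q ^ Suc m else plain_factor q y (Suc m)) * plain_factor q y (Suc m) ^ c)"
proof -
  obtain P S where x: "x = (P, S)" by (metis prod.exhaust)
  have P: "set_mset P \<subseteq> {1..m}" "S \<subseteq> set_mset P" using assms x by (auto simp: overpartitions_le_def)
  hence n: "Suc m \<notin> S" by auto
  have fin: "finite S" using P finite_subset by blast
  have card: "card {k \<in> insert (Suc m) S. odd k} = card {k \<in> S. odd k} + (if odd (Suc m) then 1 else 0)"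
  proof (cases "odd (Suc m)")
    case True
    hence "{k \<in> insert (Suc m) S. odd k} = insert (Suc m) {k \<in> S. odd k}" by auto
    thus ?thesis using n fin True by simp
  next
    case False
    hence "{k \<in> insert (Suc m) S. odd k} = {k \<in> S. odd k}" by auto
    thus ?thesis using False by simp
  qed
  have sum: "\<Sum>\<^sub># (P + replicate_mset (Suc c) (Suc m)) = \<Sum>\<^sub># P + Suc m * Suc c"
    by (simp add: sum_mset_replicate_mset algebra_simps)
  have filt: "filter_mset even (replicate_mset j a) = (if even a then replicate_mset j a else {#})" for j a :: nat
    by (induction j) auto
  have np: "nontrivial_parts (add_parts (Suc m) ((P, S), c, b)) =
      nontrivial_parts (P, S) + (if even (Suc m) then Suc c else if b then 1 else 0)"
  proof (cases "even (Suc m)")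
    case True
    thus ?thesis using card by (simp add: add_parts_def nontrivial_parts_def filt del: even_Suc)
  next
    case False
    thus ?thesis using card by (simp add: add_parts_def nontrivial_parts_def filt del: even_Suc)
  qed
  have "weight q y (add_parts (Suc m) ((P, S), c, b)) =
      y ^ nontrivial_parts (add_parts (Suc m) ((P, S), c, b)) * q ^ (\<Sum>\<^sub># P + Suc m * Suc c)"
    unfolding sum[symmetric] by (simp add: weight_def add_parts_def del: replicate_mset_Suc)
  also have "\<dots> = weight q y x * ((if b then y * q ^ Suc m else plain_factor q y (Suc m)) * plain_factor q y (Suc m) ^ c)"
  proof -
    have "q ^ (Suc m * Suc c) = q ^ Suc m * (q ^ Suc m) ^ c" by (simp only: power_mult power_Suc)
    thus ?thesis
      unfolding np x weight_def prod.case plain_factor_def power_add[of q]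
      by (simp add: power_add power_mult_distrib mult_ac del: even_Suc power_Suc mult_Suc mult_Suc_right)
         (simp add: mult_ac)
  qed
  finally show ?thesis by (simp add: x)
qed

lemma norm_plain_factor:
  assumes "norm q < 1" "norm y = 1"
  shows "norm (plain_factor q y (Suc k)) < 1"
  using assms power_less_one_iff[of "norm q" "Suc k"] by (simp add: plain_factor_def norm_mult norm_power del: power_Suc)

lemma level_sum:
  fixes w s t :: complex
  assumes "norm w < 1"
  shows "((\<lambda>(c, b). (if b then s else t) * w ^ c) has_sum ((s + t) / (1 - w))) (UNIV :: (nat \<times> bool) set)"
    and "(\<lambda>(c, b). norm ((if b then s else t) * w ^ c)) summable_on (UNIV :: (nat \<times> bool) set)"
proof -
  have s: "summable (\<lambda>n. norm (w ^ n))" using assms by (auto simp: norm_power summable_geometric)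
  have 1: "((\<lambda>c. w ^ c) has_sum (1 / (1 - w))) UNIV"
    by (rule norm_summable_imp_has_sum[OF s geometric_sums[OF assms]])
  have 2: "(\<lambda>c. norm (w ^ c)) summable_on UNIV"
    using s by (intro summable_nonneg_imp_summable_on) auto
  have 3: "((\<lambda>b. if b then s else t) has_sum (s + t)) UNIV"
    by (rule has_sum_finiteI) (auto simp: UNIV_bool)
  have 4: "(\<lambda>b. norm (if b then s else t)) summable_on (UNIV :: bool set)" by simp
  have "((\<lambda>(c, b). w ^ c * (if b then s else t)) has_sum (1 / (1 - w) * (s + t))) (UNIV \<times> UNIV)"
    and "(\<lambda>(c, b). norm (w ^ c * (if b then s else t))) summable_on (UNIV \<times> UNIV)"
    by (rule has_sum_prod_mult[OF 1 2 3 4])+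
  thus "((\<lambda>(c, b). (if b then s else t) * w ^ c) has_sum ((s + t) / (1 - w))) (UNIV :: (nat \<times> bool) set)"
    and "(\<lambda>(c, b). norm ((if b then s else t) * w ^ c)) summable_on (UNIV :: (nat \<times> bool) set)"
    by (simp_all add: mult.commute)
qed

text \<open>T is abstract so as to cover both \<open>weight\<close> and \<open>rank_weight\<close>:
  s and t are the contributions of the first copy of the largest part, overlined or not, and w that
  of each further copy.\<close>

lemma overpartitions_max_has_sum:
  fixes T :: "overpartition \<Rightarrow> complex"
  assumes W: "(weight q y has_sum a) (overpartitions_le m)" "(\<lambda>x. norm (weight q y x)) summable_on overpartitions_le m"
    and w: "norm w < 1"
    and T: "\<And>x c b. x \<in> overpartitions_le m \<Longrightarrow> T (add_parts (Suc m) (x, c, b)) = weight q y x * ((if b then s else t) * w ^ c)"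
  shows "(T has_sum (a * ((s + t) / (1 - w)))) (overpartitions_max m)"
    and "(\<lambda>x. norm (T x)) summable_on overpartitions_max m"
proof -
  let ?g = "\<lambda>(c, b). (if b then s else t) * w ^ c"
  have g2: "(\<lambda>x. norm (?g x)) summable_on (UNIV :: (nat \<times> bool) set)"
    using level_sum(2)[OF w, of s t] by (simp add: case_prod_unfold)
  note P = has_sum_prod_mult[OF W level_sum(1)[OF w, of s t] g2]
  have eq: "T (add_parts (Suc m) z) = (case z of (x, y') \<Rightarrow> weight q y x * ?g y')" if "z \<in> overpartitions_le m \<times> UNIV" for z
    using that T by (auto simp: case_prod_unfold)
  have "((\<lambda>z. T (add_parts (Suc m) z)) has_sum (a * ((s + t) / (1 - w)))) (overpartitions_le m \<times> UNIV)"
    using P(1) by (subst has_sum_cong[OF eq]) auto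
  thus "(T has_sum (a * ((s + t) / (1 - w)))) (overpartitions_max m)"
    using has_sum_reindex_bij_betw[OF add_parts_bij, of T] by simp
  have "(\<lambda>z. norm (T (add_parts (Suc m) z))) summable_on (overpartitions_le m \<times> UNIV)"
    using P(2) by (subst summable_on_cong[where g = "\<lambda>(x, y'). norm (weight q y x * ?g y')"]) (auto simp: eq case_prod_unfold)
  thus "(\<lambda>x. norm (T x)) summable_on overpartitions_max m"
    using summable_on_reindex_bij_betw[OF add_parts_bij, of "\<lambda>x. norm (T x)"] by simp
qed

definition weight_gf :: "complex \<Rightarrow> complex \<Rightarrow> nat \<Rightarrow> complex" where
  "weight_gf q y m = (\<Prod>k<m. (1 + y * q ^ Suc k) / (1 - plain_factor q y (Suc k)))"

lemma overpartitions_le_has_sum: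
  assumes q: "norm q < 1" and y: "norm y = 1"
  shows "(weight q y has_sum weight_gf q y m) (overpartitions_le m) \<and>
    (\<lambda>x. norm (weight q y x)) summable_on overpartitions_le m"
proof (induction m)
  case 0
  have le0: "overpartitions_le 0 = {({#}, {})}" by (auto simp: overpartitions_le_def)
  have "(weight q y has_sum (\<Sum>x\<in>{({#}, {})}. weight q y x)) {({#}, {})}" by (rule has_sum_finite) simp
  thus ?case unfolding le0 by (simp add: weight_def weight_gf_def nontrivial_parts_def)
next
  case (Suc m)
  define w where "w = plain_factor q y (Suc m)"
  have w: "norm w < 1" unfolding w_def by (rule norm_plain_factor[OF q y])
  hence w1: "1 - w \<noteq> 0" by auto
  have wa: "weight q y (add_parts (Suc m) (x, c, b)) = weight q y x * ((if b then y * q ^ Suc m else w) * w ^ c)"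
    if "x \<in> overpartitions_le m" for x c b
    using weight_add_parts[OF that] by (simp add: w_def)
  note M = overpartitions_max_has_sum[OF conjunct1[OF Suc.IH] conjunct2[OF Suc.IH] w,
      where T = "weight q y" and s = "y * q ^ Suc m" and t = w, OF wa]
  have un: "overpartitions_le (Suc m) = overpartitions_le m \<union> overpartitions_max m"
    by (auto simp: overpartitions_le_def overpartitions_max_def le_Suc_eq)
  have dj: "overpartitions_le m \<inter> overpartitions_max m = {}"
    by (auto simp: overpartitions_le_def overpartitions_max_def)
  have "weight_gf q y m + weight_gf q y m * ((y * q ^ Suc m + w) / (1 - w)) = weight_gf q y (Suc m)"
  proof -
    have "1 + (y * q ^ Suc m + w) / (1 - w) = (1 + y * q ^ Suc m) / (1 - w)"
      using w1 by (simp add: divide_simps)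
    hence "weight_gf q y m * (1 + (y * q ^ Suc m + w) / (1 - w)) = weight_gf q y (Suc m)"
      by (simp add: weight_gf_def w_def)
    thus ?thesis by (simp only: distrib_left mult_1_right)
  qed
  thus ?case
    unfolding un using has_sum_Un_disjoint[OF conjunct1[OF Suc.IH] M(1) dj]
      summable_on_Un_disjoint[OF conjunct2[OF Suc.IH] M(2) dj] by simp
qed

definition all_overpartitions :: "overpartition set" where
  "all_overpartitions = {(P, S). 0 \<notin># P \<and> S \<subseteq> set_mset P \<and> P \<noteq> {#}}"

definition overpartition_size :: "overpartition \<Rightarrow> nat" where
  "overpartition_size = (\<lambda>(P, S). \<Sum>\<^sub># P)"

lemma largest_part_max:
  assumes "x \<in> overpartitions_max m"
  shows "largest_part x = Suc m"
  using assms by (auto simp: overpartitions_max_def largest_part_def intro!: Max_eqI)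

lemma all_overpartitions_max: "bij_betw snd (SIGMA m:UNIV. overpartitions_max m) all_overpartitions"
  unfolding bij_betw_def
proof
  show "inj_on snd (SIGMA m:UNIV. overpartitions_max m)"
    by (rule inj_onI) (auto dest!: largest_part_max)
  have "x \<in> overpartitions_max (Max (set_mset (fst x)) - 1)" if x: "x \<in> all_overpartitions" for x
  proof -
    obtain P S where PS: "x = (P, S)" by (metis prod.exhaust)
    have P: "0 \<notin># P" "S \<subseteq> set_mset P" "P \<noteq> {#}" using x PS by (auto simp: all_overpartitions_def)
    have mx: "Max (set_mset P) \<in># P" using P by simp
    hence "Max (set_mset P) \<noteq> 0" using P(1) by metis
    hence S: "Suc (Max (set_mset P) - 1) = Max (set_mset P)" by simp
    have "set_mset P \<subseteq> {1..Max (set_mset P)}"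
    proof
      fix j assume "j \<in># P"
      moreover from this have "j \<noteq> 0" using P by metis
      ultimately show "j \<in> {1..Max (set_mset P)}" by simp
    qed
    thus ?thesis using P mx unfolding overpartitions_max_def PS fst_conv S mem_Collect_eq prod.case by blast
  qed
  moreover have "x \<in> all_overpartitions" if "x \<in> overpartitions_max m" for x m
    using that by (auto simp: all_overpartitions_def overpartitions_max_def)
  ultimately show "snd ` (SIGMA m:UNIV. overpartitions_max m) = all_overpartitions"
    by force
qed

lemma weight_gf_one:
  assumes "norm q < 1"
  shows "weight_gf q 1 (Suc m) - weight_gf q 1 m = weight_gf q 1 m * ((q ^ Suc m + q ^ Suc m) / (1 - q ^ Suc m))"
proof -
  have "1 - q ^ Suc m \<noteq> 0"
    using norm_plain_factor[OF assms, of 1 m] by (auto simp: plain_factor_def simp del: power_Suc)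
  hence "(1 + q ^ Suc m) / (1 - q ^ Suc m) - 1 = (q ^ Suc m + q ^ Suc m) / (1 - q ^ Suc m)"
    by (simp add: divide_simps)
  moreover have "weight_gf q 1 (Suc m) = weight_gf q 1 m * ((1 + q ^ Suc m) / (1 - q ^ Suc m))"
    by (simp add: weight_gf_def plain_factor_def)
  ultimately show ?thesis
    by (metis mult.right_neutral right_diff_distrib)
qed

text \<open>For y = 1 and the real nome \<open>norm q\<close> the contributions of the successive
  largest parts telescope to the full overpartition product. As z lies on the unit circle, this is
  the absolute convergence of the rank series over all overpartitions at once.\<close>

lemma norm_size_summable:
  fixes q :: complex
  assumes q: "norm q < 1"
  shows "(\<lambda>x. norm q ^ overpartition_size x) summable_on all_overpartitions"
proof -
  define r where "r = complex_of_real (norm q)"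
  have r: "norm r < 1" "norm (1 :: complex) = 1" using q by (auto simp: r_def)
  have wt: "weight r 1 x = of_real (norm q ^ overpartition_size x)" for x
    by (simp add: weight_def overpartition_size_def r_def case_prod_unfold)
  note L = overpartitions_le_has_sum[OF r]
  have pf: "plain_factor r 1 k = r ^ k" for k by (simp add: plain_factor_def)
  have M: "(weight r 1 has_sum (weight_gf r 1 (Suc m) - weight_gf r 1 m)) (overpartitions_max m)" for m
    using overpartitions_max_has_sum(1)[OF conjunct1[OF L] conjunct2[OF L] norm_plain_factor[OF r, of m],
      where T = "weight r 1" and s = "1 * r ^ Suc m" and t = "plain_factor r 1 (Suc m)", OF weight_add_parts]
    unfolding weight_gf_one[OF r(1)] pf by simp
  define d where "d = (\<lambda>m. Re (weight_gf r 1 (Suc m) - weight_gf r 1 m))"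
  have Md: "((\<lambda>x. norm q ^ overpartition_size x) has_sum d m) (overpartitions_max m)" for m
    using has_sum_Re[OF M[of m]] by (simp add: wt d_def)
  have lim: "(\<lambda>m. weight_gf r 1 m) \<longlonglongrightarrow> qpoch_inf (- r) r / qpoch_inf r r"
  proof -
    have "weight_gf r 1 m = (\<Prod>k<m. 1 - (- r) * r ^ k) / (\<Prod>k<m. 1 - r * r ^ k)" for m
      by (simp add: weight_gf_def pf prod_dividef)
    thus ?thesis
      using qpoch_tendsto[OF r(1)] qpoch_self_nonzero[OF r(1)] by (simp only:) (intro tendsto_divide)
  qed
  have "(\<lambda>m. weight_gf r 1 (Suc m) - weight_gf r 1 m) sums (qpoch_inf (- r) r / qpoch_inf r r - weight_gf r 1 0)"
    by (rule telescope_sums[OF lim])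
  from sums_Re[OF this] have "summable d" unfolding d_def by (rule sums_summable)
  moreover have "d m \<ge> 0" for m by (rule has_sum_nonneg[OF Md]) simp
  ultimately have ds: "d summable_on UNIV" by (intro summable_nonneg_imp_summable_on) auto
  have "(\<lambda>(m, x). norm q ^ overpartition_size x) summable_on (SIGMA m:UNIV. overpartitions_max m)"
    by (rule summable_on_SigmaI[OF _ ds]) (use Md in auto)
  thus ?thesis
    using summable_on_reindex_bij_betw[OF all_overpartitions_max, of "\<lambda>x. norm q ^ overpartition_size x"]
    by (simp add: case_prod_unfold)
qed

lemma ceiling_half: "\<lceil>real k / 2\<rceil> = int ((k + 1) div 2)"
proof (cases "even k")
  case True
  then obtain j where "k = 2 * j" by blast
  thus ?thesis by simp
next
  case False
  then obtain j where j: "k = 2 * j + 1" by (auto elim: oddE)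
  have "real k / 2 = real j + 1 / 2" by (simp add: j)
  hence "\<lceil>real k / 2\<rceil> = int j + 1" by (simp add: ceiling_eq_iff)
  thus ?thesis by (simp add: j)
qed

definition rank_weight :: "complex \<Rightarrow> complex \<Rightarrow> overpartition \<Rightarrow> complex" where
  "rank_weight q z x = z powi M2_rank x * q ^ overpartition_size x"

text \<open>Apart from the largest part, the rank only sees \<open>nontrivial_parts\<close>, so the
  smaller parts have the weight with y = \<open>1 / z\<close>. The correction \<open>chi\<close>
  affects only the contribution of the first copy of the largest part.\<close>

lemma rank_weight_add_parts:
  assumes x: "x \<in> overpartitions_le m" and z: "z \<noteq> 0"
  shows "rank_weight q z (add_parts (Suc m) (x, c, b)) = weight q (1 / z) x *
    ((if b then z ^ (Suc (Suc m) div 2) * (1 / z * q ^ Suc m) else z ^ (Suc m div 2) * q ^ Suc m * (if odd (Suc m) then 1 else 1 / z))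
       * plain_factor q (1 / z) (Suc m) ^ c)"
proof -
  obtain P S where PS: "x = (P, S)" by (metis prod.exhaust)
  have P: "set_mset P \<subseteq> {1..m}" "S \<subseteq> set_mset P" using x PS by (auto simp: overpartitions_le_def)
  have nS: "Suc m \<notin> S" using P by auto
  define X where "X = add_parts (Suc m) (x, c, b)"
  have X: "X \<in> overpartitions_max m"
    using bij_betw_apply[OF add_parts_bij] x by (auto simp: X_def)
  obtain P' S' where X': "X = (P', S')" by (metis prod.exhaust)
  have S': "S' \<subseteq> set_mset P'" using X X' by (auto simp: overpartitions_max_def)
  have mem: "Suc m \<in> S' \<longleftrightarrow> b" using X' nS by (auto simp: X_def add_parts_def PS split: if_splits)
  have chi: "chi X = (if odd (Suc m) \<and> \<not> b then 1 else 0)"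
    using largest_part_max[OF X] mem by (simp add: chi_def X')
  \<comment> \<open>\<open>Suc (Suc m) div 2\<close> is the ceiling of half the largest part
    \<open>Suc m\<close>.\<close>
  have rank: "M2_rank X = int (Suc (Suc m) div 2) - int (nontrivial_parts X) - chi X"
    using size_odd_nonoverlined[OF S'] largest_part_max[OF X]
    unfolding M2_rank_def X' ceiling_half by simp
  have "rank_weight q z X = z powi (int (Suc (Suc m) div 2) - chi X) * weight q (1 / z) X"
  proof -
    have "int (Suc (Suc m) div 2) - int (nontrivial_parts X) - chi X =
        (int (Suc (Suc m) div 2) - chi X) + - int (nontrivial_parts X)" by simp
    hence "z powi M2_rank X = z powi (int (Suc (Suc m) div 2) - chi X) * (1 / z) ^ nontrivial_parts X"
      unfolding rank using z by (simp only: power_int_add power_int_minus power_int_of_nat power_one_over inverse_eq_divide simp_thms)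
    thus ?thesis by (simp add: rank_weight_def weight_def overpartition_size_def X')
  qed
  also have "weight q (1 / z) X = weight q (1 / z) x * ((if b then 1 / z * q ^ Suc m else plain_factor q (1 / z) (Suc m))
      * plain_factor q (1 / z) (Suc m) ^ c)"
    unfolding X_def by (rule weight_add_parts[OF x])
  also have "z powi (int (Suc (Suc m) div 2) - chi X) * (weight q (1 / z) x * ((if b then 1 / z * q ^ Suc m else plain_factor q (1 / z) (Suc m))
      * plain_factor q (1 / z) (Suc m) ^ c)) = weight q (1 / z) x *
    ((if b then z ^ (Suc (Suc m) div 2) * (1 / z * q ^ Suc m) else z ^ (Suc m div 2) * q ^ Suc m * (if odd (Suc m) then 1 else 1 / z))
       * plain_factor q (1 / z) (Suc m) ^ c)"
  proof (cases b)
    case True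
    hence "z powi (int (Suc (Suc m) div 2) - chi X) = z ^ (Suc (Suc m) div 2)"
      unfolding chi by (simp only: simp_thms if_False diff_0_right power_int_of_nat)
    thus ?thesis using True by (simp only: if_True mult_ac)
  next
    case nb: False
    show ?thesis
    proof (cases "odd (Suc m)")
      case True
      hence "Suc (Suc m) div 2 = Suc (Suc m div 2)" by presburger
      thus ?thesis using nb True z by (simp add: chi plain_factor_def power_int_diff)
    next
      case False
      hence "Suc (Suc m) div 2 = Suc m div 2" by presburger
      moreover have "z powi (int (Suc (Suc m) div 2) - chi X) = z ^ (Suc (Suc m) div 2)"
        unfolding chi using False by (simp only: simp_thms if_False diff_0_right power_int_of_nat)
      ultimately show ?thesis using nb False by (simp add: plain_factor_def del: even_Suc)
    qed
  qed
  finally show ?thesis by (simp add: X_def)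
qed

text \<open>Largest parts 2n+1 and 2n+2 are grouped, since odd and even parts have different plain
  weights. In their sum the terms with \<open>X / z\<close> cancel, which leaves the factor
  \<open>1 + q\<close> and a single rank term.\<close>

lemma overpartition_rank_gf:
  assumes q: "norm q < 1" and z: "norm z = 1"
  shows "(rank_weight q z has_sum rank_gf q z) all_overpartitions"
proof -
  have z0: "z \<noteq> 0" using z by auto
  define y where "y = 1 / z"
  have y: "norm y = 1" using z by (simp add: y_def norm_divide)
  have nrm: "norm (rank_weight q z x) = norm q ^ overpartition_size x" for x
    by (simp add: rank_weight_def norm_mult norm_power norm_power_int z)
  have "(\<lambda>x. norm (rank_weight q z x)) summable_on all_overpartitions"
    unfolding nrm by (rule norm_size_summable[OF q])
  hence summ: "rank_weight q z summable_on all_overpartitions"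
    by (rule Infinite_Sum.abs_summable_summable)
  then obtain R where R: "(rank_weight q z has_sum R) all_overpartitions" by (auto simp: summable_on_def)
  define st where "st = (\<lambda>m. z ^ (Suc (Suc m) div 2) * (1 / z * q ^ Suc m) +
      z ^ (Suc m div 2) * q ^ Suc m * (if odd (Suc m) then 1 else 1 / z))"
  define B where "B = (\<lambda>m. weight_gf q y m * (st m / (1 - plain_factor q y (Suc m))))"
  note L = overpartitions_le_has_sum[OF q y]
  have M: "(rank_weight q z has_sum B m) (overpartitions_max m)" for m
    unfolding B_def st_def
    by (rule overpartitions_max_has_sum(1)[OF conjunct1[OF L] conjunct2[OF L] norm_plain_factor[OF q y]])
       (unfold y_def, rule rank_weight_add_parts[OF _ z0])
  have "((\<lambda>(m, x). rank_weight q z x) has_sum R) (SIGMA m:UNIV. overpartitions_max m)"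
    using R has_sum_reindex_bij_betw[OF all_overpartitions_max, of "rank_weight q z" R]
    by (simp add: case_prod_unfold)
  hence "(B has_sum R) UNIV"
    by (rule has_sum_SigmaD) (use M in simp)
  hence "B sums R" by (rule has_sum_imp_sums)
  hence "(\<lambda>n. sum B {n * 2..<n * 2 + 2}) sums R" by (rule sums_group) simp
  moreover have "sum B {n * 2..<n * 2 + 2} = 2 * q * (1 + q) * rank_term q z n" for n
  proof -
    have "{n * 2..<n * 2 + 2} = {2 * n, Suc (2 * n)}" by auto
    hence sB: "sum B {n * 2..<n * 2 + 2} = B (2 * n) + B (Suc (2 * n))" by simp
    have gf: "weight_gf q y (2 * n) = qpoch_fin (- q / z) q (2 * n) / (qpoch_fin q (q\<^sup>2) n * qpoch_fin (q\<^sup>2 / z) (q\<^sup>2) n)" for n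
    proof (induction n)
      case (Suc n)
      have e: "2 * Suc n = Suc (Suc (2 * n))" "q ^ (2 * n) = (q\<^sup>2) ^ n" by (simp_all add: power_mult)
      have "weight_gf q y (2 * Suc n) = weight_gf q y (2 * n) * ((1 + y * q ^ Suc (2 * n)) / (1 - plain_factor q y (Suc (2 * n))))
         * ((1 + y * q ^ Suc (Suc (2 * n))) / (1 - plain_factor q y (Suc (Suc (2 * n)))))"
        unfolding e(1) weight_gf_def prod.lessThan_Suc ..
      also have "plain_factor q y (Suc (2 * n)) = q * (q\<^sup>2) ^ n" by (simp add: plain_factor_def e)
      also have "plain_factor q y (Suc (Suc (2 * n))) = q\<^sup>2 / z * (q\<^sup>2) ^ n"
        by (simp add: plain_factor_def e y_def power2_eq_square)
      also have "1 + y * q ^ Suc (2 * n) = 1 - (- q / z) * q ^ (2 * n)" by (simp add: y_def)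
      also have "1 + y * q ^ Suc (Suc (2 * n)) = 1 - (- q / z) * q ^ Suc (2 * n)" by (simp add: y_def)
      finally show ?case
        unfolding Suc.IH e(1) qpoch_fin_Suc by (simp add: mult_ac)
    qed (simp add: weight_gf_def)
    define N where "N = qpoch_fin (- q / z) q (2 * n)"
    define D where "D = qpoch_fin q (q\<^sup>2) n * qpoch_fin (q\<^sup>2 / z) (q\<^sup>2) n"
    define X where "X = (q\<^sup>2) ^ n"
    define d where "d = 1 - q * X"
    define e where "e = 1 - q\<^sup>2 / z * X"
    have X2: "q ^ (2 * n) = X" by (simp add: X_def power_mult)
    have pf: "1 - plain_factor q y (Suc (2 * n)) = d" "1 - plain_factor q y (Suc (Suc (2 * n))) = e"
      by (simp_all add: plain_factor_def d_def e_def X2 y_def power2_eq_square)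
    have de: "d \<noteq> 0" "e \<noteq> 0"
      using norm_plain_factor[OF q y, of "2 * n"] norm_plain_factor[OF q y, of "Suc (2 * n)"]
      unfolding pf[symmetric] by auto
    \<comment> \<open>Owing to \<open>chi\<close>, an overlined and a non-overlined first copy carry
      the same power of z, here and for the even part below; this is the source of the factor
      2.\<close>
    have st0: "st (2 * n) = 2 * z ^ n * (q * X)"
      unfolding st_def using z0 by (simp add: X2)
    have st1: "st (Suc (2 * n)) = 2 * z ^ n * (q * (q * X))"
    proof -
      have "Suc (Suc (Suc (2 * n))) div 2 = Suc n" "Suc (Suc (2 * n)) div 2 = Suc n" by presburger+
      thus ?thesis unfolding st_def using z0 by (simp add: X2)
    qed
    have wS: "weight_gf q y (Suc (2 * n)) = N / D * ((1 + q * X / z) / d)"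
      unfolding weight_gf_def prod.lessThan_Suc pf
      unfolding weight_gf_def[symmetric] gf N_def[symmetric] D_def[symmetric] by (simp add: y_def X2)
    have "B (2 * n) + B (Suc (2 * n)) = N / D * (2 * z ^ n * (q * X) / d)
       + N / D * ((1 + q * X / z) / d) * (2 * z ^ n * (q * (q * X)) / e)"
      unfolding B_def wS st0 st1 pf gf N_def D_def by simp
    also have "\<dots> = N / D * (2 * z ^ n * (q * X)) * ((e + (1 + q * X / z) * q) / (d * e))"
      using de by (simp add: add_divide_distrib distrib_left mult_ac)
    also have "e + (1 + q * X / z) * q = 1 + q"
      using z0 by (simp add: e_def power2_eq_square algebra_simps)
    also have "N / D * (2 * z ^ n * (q * X)) * ((1 + q) / (d * e)) = 2 * q * (1 + q) * rank_term q z n"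
      unfolding rank_term_def qpoch_fin_Suc N_def D_def d_def e_def X_def power_mult_distrib
      by (simp add: mult_ac)
    finally show ?thesis using sB by simp
  qed
  ultimately have "(\<lambda>n. 2 * q * (1 + q) * rank_term q z n) sums R" by simp
  moreover have "(\<lambda>n. 2 * q * (1 + q) * rank_term q z n) sums rank_gf q z"
    unfolding rank_gf_def using q z power_less_one_iff[of "norm q" 2]
    by (intro sums_mult rank_sum_sums) auto
  ultimately have "R = rank_gf q z" by (rule sums_unique2)
  thus ?thesis using R by simp
qed

section \<open>From the rank variable to rank residues modulo 3\<close>

definition overpartitions_of_size :: "nat \<Rightarrow> overpartition set" where
  "overpartitions_of_size n = {x. overpartition_of n x \<and> x \<noteq> ({#}, {})}"

lemma finite_overpartitions_of_size: "finite (overpartitions_of_size n)"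
proof -
  have "size P \<le> n \<and> set_mset P \<subseteq> {..n}" if "0 \<notin># P" "\<Sum>\<^sub># P = n" for P :: "nat multiset"
  proof
    have "size P = (\<Sum>x\<in>#P. 1)" by (rule size_eq_sum_mset)
    also have "\<dots> \<le> (\<Sum>x\<in>#P. x)" by (intro sum_mset_mono) (use that(1) in \<open>auto simp: Suc_le_eq intro!: gr0I\<close>)
    finally show "size P \<le> n" using that by simp
    show "set_mset P \<subseteq> {..n}"
      using that(2) by (auto dest!: multi_member_split)
  qed
  hence "overpartitions_of_size n \<subseteq> (\<Union>k\<le>n. multisets_of_size {..n} k) \<times> Pow {..n}"
    by (fastforce simp: overpartitions_of_size_def overpartition_of_def multisets_of_size_def)
  moreover have "finite ((\<Union>k\<le>n. multisets_of_size {..n} k) \<times> Pow {..n})"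
    by (intro finite_cartesian_product finite_UN_I finite_multisets_of_size) auto
  ultimately show ?thesis by (rule finite_subset)
qed

lemma overpartition_rank_gf_sums:
  assumes q: "norm q < 1" and z: "norm z = 1"
  shows "(\<lambda>n. (\<Sum>x\<in>overpartitions_of_size n. z powi M2_rank x) * q ^ n) sums rank_gf q z"
proof (rule has_sum_imp_sums)
  have "bij_betw snd (SIGMA n:UNIV. overpartitions_of_size n) all_overpartitions"
    unfolding bij_betw_def
    by (auto simp: inj_on_def overpartitions_of_size_def overpartition_of_def all_overpartitions_def image_iff)
  from has_sum_reindex_bij_betw[OF this, of "rank_weight q z" "rank_gf q z"] overpartition_rank_gf[OF assms]
  have "((\<lambda>(n, x). rank_weight q z x) has_sum rank_gf q z) (SIGMA n:UNIV. overpartitions_of_size n)"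
    by (simp add: case_prod_unfold)
  moreover have "((\<lambda>x. case (n, x) of (n, x) \<Rightarrow> rank_weight q z x) has_sum
      (\<Sum>x\<in>overpartitions_of_size n. z powi M2_rank x) * q ^ n) (overpartitions_of_size n)" for n
  proof (rule has_sum_finiteI[OF finite_overpartitions_of_size])
    show "(\<Sum>x\<in>overpartitions_of_size n. z powi M2_rank x) * q ^ n =
      (\<Sum>x\<in>overpartitions_of_size n. case (n, x) of (n, x) \<Rightarrow> rank_weight q z x)"
      unfolding sum_distrib_right prod.case
      by (intro sum.cong refl)
         (auto simp: rank_weight_def overpartition_size_def overpartitions_of_size_def overpartition_of_def)
  qed
  ultimately show "((\<lambda>n. (\<Sum>x\<in>overpartitions_of_size n. z powi M2_rank x) * q ^ n) has_sum rank_gf q z) UNIV"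
    by (rule has_sum_SigmaD)
qed

text \<open>Fourier inversion modulo 3. The trivial character drops out of the difference, and the
  coefficients are 1 - 1/w and 1 - 1/w^2.\<close>

lemma rank_difference_sum:
  fixes w :: complex
  assumes w: "w\<^sup>2 + w + 1 = 0"
  shows "of_nat (N2_bar 0 3 n) - of_nat (N2_bar 1 3 n) =
    ((\<Sum>x\<in>overpartitions_of_size n. w powi M2_rank x) * (1 - w\<^sup>2) +
     (\<Sum>x\<in>overpartitions_of_size n. (w\<^sup>2) powi M2_rank x) * (1 - w)) / 3"
proof -
  note wf = cube_root_facts[OF w]
  have card: "of_nat (N2_bar s 3 n) = (\<Sum>x\<in>overpartitions_of_size n. if [M2_rank x = s] (mod 3) then 1 else 0 :: complex)" for s
  proof -
    have "{x. overpartition_of n x \<and> x \<noteq> ({#}, {}) \<and> [M2_rank x = s] (mod 3)} =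
        overpartitions_of_size n \<inter> {x. [M2_rank x = s] (mod 3)}"
      by (auto simp: overpartitions_of_size_def)
    thus ?thesis unfolding N2_bar_def
      using finite_overpartitions_of_size[of n] by (simp add: sum.If_cases)
  qed
  have pt: "(if [r = 0] (mod 3) then 1 else 0) - (if [r = 1] (mod 3) then 1 else 0) =
      (w powi r * (1 - w\<^sup>2) + (w\<^sup>2) powi r * (1 - w)) / 3" for r :: int
  proof -
    have p: "w powi r = w ^ nat (r mod 3)" "(w\<^sup>2) powi r = (w\<^sup>2) ^ nat (r mod 3)"
    proof -
      have *: "u powi r = u ^ nat (r mod 3)" if u: "u ^ 3 = 1" for u :: complex
      proof -
        have u0: "u \<noteq> 0" using u by auto
        have "u powi r = u powi (3 * (r div 3) + r mod 3)" by simp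
        also have "\<dots> = u powi (3 * (r div 3)) * u powi (r mod 3)"
          using u0 by (intro power_int_add) auto
        also have "u powi (3 * (r div 3)) = (u ^ 3) powi (r div 3)"
          by (simp add: power_int_mult)
        finally show ?thesis by (simp add: u power_int_def)
      qed
      have w6: "(w\<^sup>2) ^ 3 = 1" using wf(1) by (metis power_mult mult.commute power_one)
      show "w powi r = w ^ nat (r mod 3)" "(w\<^sup>2) powi r = (w\<^sup>2) ^ nat (r mod 3)"
        by (rule *, fact wf(1)) (rule *, fact w6)
    qed
    have w4: "w\<^sup>2 * w\<^sup>2 = w" using wf(1) by (simp add: power2_eq_square power3_eq_cube mult.assoc)
    have w3: "w * w\<^sup>2 = 1" "w\<^sup>2 * w = 1" using wf(1) by (simp_all add: power2_eq_square power3_eq_cube mult.assoc)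
    have "r mod 3 = 0 \<or> r mod 3 = 1 \<or> r mod 3 = 2" by presburger
    then consider "r mod 3 = 0" | "r mod 3 = 1" | "r mod 3 = 2" by blast
    thus ?thesis
    proof cases
      case 1
      have "(1 - w\<^sup>2) + (1 - w) = 3" unfolding wf(7) by simp
      thus ?thesis unfolding p using 1 by (simp add: cong_def)
    next
      case 2
      have "w * (1 - w\<^sup>2) + w\<^sup>2 * (1 - w) = w + w\<^sup>2 - w * w\<^sup>2 - w\<^sup>2 * w" by (simp add: algebra_simps)
      also have "\<dots> = - 3" unfolding w3 unfolding wf(7) by simp
      finally show ?thesis unfolding p using 2 by (simp add: cong_def)
    next
      case 3
      have "w\<^sup>2 * (1 - w\<^sup>2) + (w\<^sup>2)\<^sup>2 * (1 - w) = w\<^sup>2 - w\<^sup>2 * w\<^sup>2 + w\<^sup>2 * w\<^sup>2 * (1 - w)"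
        by (simp add: algebra_simps power2_eq_square)
      also have "\<dots> = 0" unfolding w4 by (simp add: algebra_simps power2_eq_square)
      finally show ?thesis unfolding p using 3 by (simp add: cong_def)
    qed
  qed
  show ?thesis
    unfolding card sum_subtractf[symmetric] pt by (simp add: sum.distrib sum_distrib_right sum_divide_distrib add_divide_distrib)
qed

text \<open>\<open>rank_gf_cubic\<close> has the same right-hand side for w and
  \<open>w ^ 2\<close>, so both values of \<open>rank_gf\<close> coincide; their coefficients
  \<open>1 - w ^ 2\<close> and \<open>1 - w\<close> add up to 3.\<close>

lemma rank_difference_sums:
  assumes q: "norm q < 1" "q \<noteq> 0" and w: "w\<^sup>2 + w + 1 = 0"
  shows "(\<lambda>n. (of_nat (N2_bar 0 3 n) - of_nat (N2_bar 1 3 n)) * q ^ n) sums rank_gf q w"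
proof -
  note wf = cube_root_facts[OF w]
  have w': "(w\<^sup>2)\<^sup>2 + w\<^sup>2 + 1 = 0"
  proof -
    have "(w\<^sup>2)\<^sup>2 = w" using wf(1) by (simp add: power2_eq_square power3_eq_cube mult.assoc)
    thus ?thesis using w by (simp add: add.commute)
  qed
  have nz: "theta q 1 * theta (q ^ 9) 1 \<noteq> 0"
  proof -
    have "theta r 1 \<noteq> 0" if "norm r < 1" "r \<noteq> 0" for r
      using theta_product[OF that] qpoch_self_nonzero[OF that(1)] qpoch_nonzero_norm[OF that(1), of "-r"] that by simp
    moreover have "norm (q ^ 9) < 1" using q by (simp add: norm_power power_less_one_iff)
    ultimately show ?thesis using q by simp
  qed
  have "(1 + rank_gf q (w\<^sup>2)) * (theta q 1 * theta (q ^ 9) 1) = (1 + rank_gf q w) * (theta q 1 * theta (q ^ 9) 1)"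
    unfolding mult.assoc[symmetric] rank_gf_cubic[OF q w] rank_gf_cubic[OF q w'] ..
  hence "1 + rank_gf q (w\<^sup>2) = 1 + rank_gf q w"
    using nz by (simp only: mult_cancel_right) simp
  hence eq: "rank_gf q (w\<^sup>2) = rank_gf q w" by simp
  have "(\<lambda>n. ((\<Sum>x\<in>overpartitions_of_size n. w powi M2_rank x) * q ^ n * (1 - w\<^sup>2) +
     (\<Sum>x\<in>overpartitions_of_size n. (w\<^sup>2) powi M2_rank x) * q ^ n * (1 - w)) / 3)
     sums ((rank_gf q w * (1 - w\<^sup>2) + rank_gf q (w\<^sup>2) * (1 - w)) / 3)"
    using wf(2) by (intro sums_divide sums_add sums_mult2 overpartition_rank_gf_sums q) (auto simp: norm_power)
  moreover have "(rank_gf q w * (1 - w\<^sup>2) + rank_gf q (w\<^sup>2) * (1 - w)) / 3 = rank_gf q w"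
  proof -
    have "(1 - w\<^sup>2) + (1 - w) = 3" unfolding wf(7) by simp
    hence "rank_gf q w * (1 - w\<^sup>2) + rank_gf q w * (1 - w) = rank_gf q w * 3"
      by (simp only: distrib_left[symmetric])
    thus ?thesis unfolding eq by simp
  qed
  moreover have "(a * c ^ n * u + b * c ^ n * v) / 3 = (a * u + b * v) / 3 * c ^ n" for a b c u v :: complex and n
    by (simp add: algebra_simps add_divide_distrib)
  ultimately show ?thesis
    unfolding rank_difference_sum[OF w] by (simp only:)
qed

section \<open>Separating the residue classes\<close>

lemma cube_root_filter:
  fixes w :: complex
  assumes w: "w\<^sup>2 + w + 1 = 0"
  shows "1 + w ^ k + w ^ (2 * k) = (if 3 dvd k then 3 else 0)"
proof -
  note wf = cube_root_facts[OF w]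
  have "k = 3 * (k div 3) + k mod 3" by simp
  hence p: "w ^ k = w ^ (k mod 3)" by (metis wf(1) power_add power_mult power_one mult_1)
  have p2: "w ^ (2 * k) = (w ^ (k mod 3))\<^sup>2" by (simp add: p[symmetric] power_mult[symmetric] mult.commute)
  have w4: "w\<^sup>2 * w\<^sup>2 = w" using wf(1) by (simp add: power2_eq_square power3_eq_cube mult.assoc)
  have "k mod 3 = 0 \<or> k mod 3 = 1 \<or> k mod 3 = 2" by presburger
  thus ?thesis
  proof (elim disjE, goal_cases)
    case 1
    thus ?thesis unfolding p p2 by (simp add: mod_0_imp_dvd)
  next
    case 2
    hence "\<not> 3 dvd k" by presburger
    thus ?thesis unfolding p p2 2 using w by (simp add: algebra_simps)
  next
    case 3
    hence "\<not> 3 dvd k" by presburger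
    thus ?thesis unfolding p p2 3 using w w4 by (simp add: algebra_simps power2_eq_square[of "w\<^sup>2"])
  qed
qed

text \<open>Averaging over the arguments q, w q, w^2 q with the weights \<open>w ^ (2 * d)\<close>
  and \<open>w ^ (4 * d)\<close> selects one class; here 2d represents -d modulo 3. The coefficients
  U are the same for all three arguments, which expresses that they depend on the cube only.\<close>

lemma sums_trisection:
  fixes c :: "nat \<Rightarrow> complex" and w q :: complex
  assumes w: "w\<^sup>2 + w + 1 = 0" and q: "q \<noteq> 0"
    and s: "\<And>r. r ^ 3 = q ^ 3 \<Longrightarrow> (\<lambda>n. c n * r ^ n) sums (U 0 + r * U 1 + r\<^sup>2 * U (2 :: nat))"
    and d: "d < 3"
  shows "(\<lambda>n. c (3 * n + d) * (q ^ 3) ^ n) sums U d"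
proof -
  note wf = cube_root_facts[OF w] and filt = cube_root_filter[OF w]
  have r: "(w * q) ^ 3 = q ^ 3" "(w\<^sup>2 * q) ^ 3 = q ^ 3"
  proof -
    have "(w\<^sup>2) ^ 3 = (w ^ 3)\<^sup>2" by (simp flip: power_mult)
    thus "(w * q) ^ 3 = q ^ 3" "(w\<^sup>2 * q) ^ 3 = q ^ 3"
      by (simp_all add: power_mult_distrib wf(1))
  qed
  have "(\<lambda>n. 1 * (c n * q ^ n) + w ^ (2 * d) * (c n * (w * q) ^ n) + w ^ (4 * d) * (c n * (w\<^sup>2 * q) ^ n)) sums
     (1 * (U 0 + q * U 1 + q\<^sup>2 * U 2) + w ^ (2 * d) * (U 0 + (w * q) * U 1 + (w * q)\<^sup>2 * U 2)
       + w ^ (4 * d) * (U 0 + (w\<^sup>2 * q) * U 1 + (w\<^sup>2 * q)\<^sup>2 * U 2))"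
    by (intro sums_add sums_mult s r refl)
  also have "1 * (U 0 + q * U 1 + q\<^sup>2 * U 2) + w ^ (2 * d) * (U 0 + (w * q) * U 1 + (w * q)\<^sup>2 * U 2)
       + w ^ (4 * d) * (U 0 + (w\<^sup>2 * q) * U 1 + (w\<^sup>2 * q)\<^sup>2 * U 2) =
     (1 + w ^ (2 * d) + w ^ (2 * (2 * d))) * U 0 + (1 + w ^ (1 + 2 * d) + w ^ (2 * (1 + 2 * d))) * (q * U 1)
     + (1 + w ^ (2 + 2 * d) + w ^ (2 * (2 + 2 * d))) * (q\<^sup>2 * U 2)"
    by (simp add: power_add algebra_simps power_mult_distrib power2_eq_square power4_eq_xxxx flip: power_mult)
  also have "\<dots> = 3 * (q ^ d * U d)"
  proof -
    have "3 dvd 2 * d \<longleftrightarrow> d = 0" "3 dvd 1 + 2 * d \<longleftrightarrow> d = 1" "3 dvd 2 + 2 * d \<longleftrightarrow> d = 2"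
      using d by presburger+
    moreover have "d = 0 \<or> d = 1 \<or> d = 2" using d by linarith
    ultimately show ?thesis unfolding filt by auto
  qed
  also have "(\<lambda>n. 1 * (c n * q ^ n) + w ^ (2 * d) * (c n * (w * q) ^ n) + w ^ (4 * d) * (c n * (w\<^sup>2 * q) ^ n))
     = (\<lambda>n. (1 + w ^ (n + 2 * d) + w ^ (2 * (n + 2 * d))) * (c n * q ^ n))"
    by (intro ext) (simp add: power_add algebra_simps power_mult_distrib flip: power_mult)
  finally have "(\<lambda>n. (if 3 dvd n + 2 * d then 3 else 0) * (c n * q ^ n)) sums (3 * (q ^ d * U d))"
    unfolding filt .
  hence "(\<lambda>n. (if 3 dvd n + 2 * d then 3 else 0) * (c n * q ^ n) / 3) sums (3 * (q ^ d * U d) / 3)"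
    by (rule sums_divide)
  hence "(\<lambda>n. if 3 dvd n + 2 * d then c n * q ^ n else 0) sums (q ^ d * U d)"
    by (simp add: if_distrib[of "\<lambda>x. x * _"] if_distrib[of "\<lambda>x. x / _"] cong: if_cong)
  hence "(\<lambda>n. \<Sum>k\<in>{n * 3..<n * 3 + 3}. if 3 dvd k + 2 * d then c k * q ^ k else 0) sums (q ^ d * U d)"
    by (rule sums_group) simp
  moreover have "(\<Sum>k\<in>{n * 3..<n * 3 + 3}. if 3 dvd k + 2 * d then c k * q ^ k else 0) = q ^ d * (c (3 * n + d) * (q ^ 3) ^ n)" for n
  proof -
    have "{n * 3..<n * 3 + 3} = {3 * n, 3 * n + 1, 3 * n + 2}" by auto
    moreover have dd: "d = 0 \<or> d = 1 \<or> d = 2" using d by linarith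
    moreover have "3 dvd 3 * n + 2 * d \<longleftrightarrow> d = 0" "3 dvd 3 * n + 1 + 2 * d \<longleftrightarrow> d = 1" "3 dvd 3 * n + 2 + 2 * d \<longleftrightarrow> d = 2"
      using d by presburger+
    ultimately have "(\<Sum>k\<in>{n * 3..<n * 3 + 3}. if 3 dvd k + 2 * d then c k * q ^ k else 0) = c (3 * n + d) * q ^ (3 * n + d)"
      using dd by (elim disjE) simp_all
    thus ?thesis by (simp add: power_add power_mult)
  qed
  ultimately have "(\<lambda>n. q ^ d * (c (3 * n + d) * (q ^ 3) ^ n)) sums (q ^ d * U d)" by simp
  thus ?thesis using q by (simp add: sums_mult_iff)
qed

text \<open>The condition on a admits 1 and -1, so one proof serves numerator and denominator of
  \<open>theta_product\<close>. Split by exponents modulo 3, the classes 1 and 2 multiply over the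
  three roots to products with nome \<open>q ^ 9\<close>, while class 0 is common to all three and
  gives a cube.\<close>

lemma qpoch_product_over_cube_roots:
  assumes q: "norm q < 1" and w: "w\<^sup>2 + w + 1 = 0" and a: "a ^ 3 = (a :: complex)"
  shows "qpoch_inf (a * q) q * qpoch_inf (a * (w * q)) (w * q) * qpoch_inf (a * (w\<^sup>2 * q)) (w\<^sup>2 * q) *
     qpoch_inf (a * q ^ 9) (q ^ 9) = qpoch_inf (a * q ^ 3) (q ^ 3) ^ 4"
proof -
  note wf = cube_root_facts[OF w]
  have w4: "(w\<^sup>2)\<^sup>2 = w" using wf(1) by (simp add: power2_eq_square power3_eq_cube mult.assoc)
  have r: "(w * q) ^ 3 = q ^ 3" "(w\<^sup>2 * q) ^ 3 = q ^ 3"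
  proof -
    have "(w\<^sup>2) ^ 3 = (w ^ 3)\<^sup>2" by (simp flip: power_mult)
    thus "(w * q) ^ 3 = q ^ 3" "(w\<^sup>2 * q) ^ 3 = q ^ 3"
      by (simp_all add: power_mult_distrib wf(1))
  qed
  have n: "norm (w * q) < 1" "norm (w\<^sup>2 * q) < 1" using q wf(2) by (simp_all add: norm_mult norm_power)
  have q3: "norm (q ^ 3) < 1" using q by (simp add: norm_power power_less_one_iff)
  have w4': "w ^ 4 = w" using w4 by (simp flip: power_mult)
  define A where "A = qpoch_inf (a * q ^ 3) (q ^ 3)"
  have s: "qpoch_inf (a * x) x = qpoch_inf (a * x) (q ^ 3) * qpoch_inf (a * x\<^sup>2) (q ^ 3) * A"
    if "norm x < 1" "x ^ 3 = q ^ 3" for x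
  proof -
    have "a * x * x = a * x\<^sup>2" "a * x * x\<^sup>2 = a * x ^ 3"
      by (simp_all add: power2_eq_square power3_eq_cube)
    thus ?thesis using qpoch_three[OF that(1), of "a * x"] unfolding that(2) A_def by (simp only:)
  qed
  have c1: "qpoch_inf (a * q) (q ^ 3) * qpoch_inf (a * (w * q)) (q ^ 3) * qpoch_inf (a * (w\<^sup>2 * q)) (q ^ 3)
      = qpoch_inf (a * q ^ 3) (q ^ 9)"
    using qpoch_cube[OF q3 w, of "a * q"] a by (simp add: power_mult_distrib mult.left_commute flip: power_mult)
  have c2: "qpoch_inf (a * q\<^sup>2) (q ^ 3) * qpoch_inf (a * (w * q)\<^sup>2) (q ^ 3) * qpoch_inf (a * (w\<^sup>2 * q)\<^sup>2) (q ^ 3)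
      = qpoch_inf (a * q ^ 6) (q ^ 9)"
  proof -
    have e: "a * (w * q)\<^sup>2 = w\<^sup>2 * (a * q\<^sup>2)" "a * (w\<^sup>2 * q)\<^sup>2 = w * (a * q\<^sup>2)" "(a * q\<^sup>2) ^ 3 = a * q ^ 6"
      by (simp_all only: power_mult_distrib w4 a power_mult[symmetric]) (simp_all add: w4')
    show ?thesis using qpoch_cube[OF q3 w, of "a * q\<^sup>2"] unfolding e by (simp add: mult_ac flip: power_mult)
  qed
  have "A = qpoch_inf (a * q ^ 3) (q ^ 9) * qpoch_inf (a * q ^ 6) (q ^ 9) * qpoch_inf (a * q ^ 9) (q ^ 9)"
    using qpoch_three[OF q3, of "a * q ^ 3"] by (simp add: A_def mult.assoc flip: power_mult power_add)
  hence "A ^ 4 = (qpoch_inf (a * q ^ 3) (q ^ 9) * qpoch_inf (a * q ^ 6) (q ^ 9) * A ^ 3) * qpoch_inf (a * q ^ 9) (q ^ 9)"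
    by (simp add: power_eq_if mult_ac)
  also have "qpoch_inf (a * q ^ 3) (q ^ 9) * qpoch_inf (a * q ^ 6) (q ^ 9) * A ^ 3 =
     qpoch_inf (a * q) q * qpoch_inf (a * (w * q)) (w * q) * qpoch_inf (a * (w\<^sup>2 * q)) (w\<^sup>2 * q)"
    unfolding s[OF q refl] s[OF n(1) r(1)] s[OF n(2) r(2)] c1[symmetric] c2[symmetric]
    by (simp add: power3_eq_cube mult_ac)
  finally show ?thesis by (simp add: A_def)
qed

lemma theta_nonzero:
  assumes "norm q < 1" "q \<noteq> 0"
  shows "theta q 1 \<noteq> 0"
  using theta_product[OF assms] qpoch_self_nonzero[OF assms(1)] qpoch_nonzero_norm[OF assms(1), of "-q"] assms by simp

text \<open>The product of theta over q, w q and w^2 q, evaluated twice: by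
  \<open>theta_dissection\<close> it is a difference of cubes, by infinite products it is the fourth
  power divided by \<open>theta (q ^ 9) 1\<close>. This is what turns the 2-term dissection of theta
  into one of its reciprocal.\<close>

lemma theta_fourth_power:
  assumes q: "norm q < 1" "q \<noteq> 0"
  shows "theta (q ^ 3) 1 ^ 4 = theta (q ^ 9) 1 * (theta (q ^ 9) 1 ^ 3 - 8 * q ^ 3 * theta (q ^ 9) (q ^ 6) ^ 3)"
proof -
  define w where "w = Complex (- 1 / 2) (sqrt 3 / 2)"
  have w: "w\<^sup>2 + w + 1 = 0"
    by (simp add: w_def complex_eq_iff power2_eq_square)
  note wf = cube_root_facts[OF w]
  have n: "norm (w * q) < 1" "norm (w\<^sup>2 * q) < 1" "w * q \<noteq> 0" "w\<^sup>2 * q \<noteq> 0"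
    using q wf(2,3) by (simp_all add: norm_mult norm_power)
  have w6: "w ^ 6 = 1" "w ^ 9 = 1" "w ^ 12 = 1" "w ^ 18 = 1"
    using power_mult[of w 3 2] power_mult[of w 3 3] power_mult[of w 3 4] power_mult[of w 3 6] wf(1)
    by (simp_all flip: power_mult)
  define t9 Om where "t9 = theta (q ^ 9) 1" and "Om = theta (q ^ 9) (q ^ 6)"
  have "theta q 1 * theta (w * q) 1 * theta (w\<^sup>2 * q) 1 =
     t9 ^ 3 * ((1 - 2 * q * Om / t9) * (1 - w * (2 * q * Om / t9)) * (1 - w\<^sup>2 * (2 * q * Om / t9)))"
  proof -
    have "norm (q ^ 9) < 1" using q by (simp add: norm_power power_less_one_iff)
    hence t9: "t9 \<noteq> 0" unfolding t9_def using q by (intro theta_nonzero) auto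
    have "t9 - 2 * r * Om = t9 * (1 - 2 * r * Om / t9)" for r using t9 by (simp add: right_diff_distrib)
    hence "theta q 1 = t9 * (1 - 2 * q * Om / t9)" "theta (w * q) 1 = t9 * (1 - 2 * (w * q) * Om / t9)"
      "theta (w\<^sup>2 * q) 1 = t9 * (1 - 2 * (w\<^sup>2 * q) * Om / t9)"
      using theta_dissection[OF q] theta_dissection[OF n(1,3)] theta_dissection[OF n(2,4)]
      by (simp_all add: power_mult_distrib w6 t9_def[symmetric] Om_def[symmetric])
    thus ?thesis by (simp only: power3_eq_cube mult_ac times_divide_eq_right times_divide_eq_left)
  qed
  also have "\<dots> = t9 ^ 3 - 8 * q ^ 3 * Om ^ 3"
  proof -
    have "norm (q ^ 9) < 1" using q by (simp add: norm_power power_less_one_iff)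
    hence "t9 \<noteq> 0" unfolding t9_def using q by (intro theta_nonzero) auto
    thus ?thesis unfolding one_minus_cube[OF w] by (simp add: power_divide power_mult_distrib right_diff_distrib)
  qed
  finally have 1: "theta q 1 * theta (w * q) 1 * theta (w\<^sup>2 * q) 1 = t9 ^ 3 - 8 * q ^ 3 * Om ^ 3" .
  have n9: "norm (q ^ 9) < 1" "norm (q ^ 3) < 1" using q by (simp_all add: norm_power power_less_one_iff)
  have nz: "qpoch_inf (- x) x \<noteq> 0" "qpoch_inf x x \<noteq> 0" if "norm x < 1" for x
    using that qpoch_nonzero_norm[of x "- x"] qpoch_self_nonzero by simp_all
  define E m where "E = (\<lambda>x. qpoch_inf x x)" and "m = (\<lambda>x. qpoch_inf (- x) x)"
  have E: "E q * E (w * q) * E (w\<^sup>2 * q) * E (q ^ 9) = E (q ^ 3) ^ 4"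
    using qpoch_product_over_cube_roots[OF q(1) w, of 1] by (simp add: E_def)
  have m: "m q * m (w * q) * m (w\<^sup>2 * q) * m (q ^ 9) = m (q ^ 3) ^ 4"
    using qpoch_product_over_cube_roots[OF q(1) w, of "-1"] by (simp add: m_def)
  have th: "theta x 1 = E x / m x" if "norm x < 1" "x \<noteq> 0" for x
    using theta_product[OF that] by (simp add: E_def m_def)
  have "theta q 1 * theta (w * q) 1 * theta (w\<^sup>2 * q) 1 * t9 =
     (E q * E (w * q) * E (w\<^sup>2 * q) * E (q ^ 9)) / (m q * m (w * q) * m (w\<^sup>2 * q) * m (q ^ 9))"
    unfolding t9_def th[OF q] th[OF n(1,3)] th[OF n(2,4)] using th[OF n9(1)] q by simp
  also have "\<dots> = theta (q ^ 3) 1 ^ 4"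
    unfolding E m using th[OF n9(2)] q by (simp add: power_divide)
  finally show ?thesis unfolding 1 t9_def Om_def by (simp add: mult.commute)
qed

text \<open>The exponents 1 and 5 modulo 6 are the odd ones that are not multiples of 3, so products
  over them are quotients of products over all exponents.\<close>

lemma theta_quotient_product:
  assumes q: "norm q < 1" "q \<noteq> 0"
  shows "theta (q ^ 3) (q\<^sup>2) * (qpoch_inf (q\<^sup>2) (q\<^sup>2) * qpoch_inf (q ^ 3) (q ^ 3)) =
     qpoch_inf q q * qpoch_inf (q ^ 6) (q ^ 6) ^ 2"
proof -
  have n: "norm (q\<^sup>2) < 1" "norm (q ^ 3) < 1" "q ^ 3 \<noteq> 0"
    using q by (simp_all add: norm_power power_less_one_iff)
  have "theta (q ^ 3) (q\<^sup>2) = jprod (q ^ 5) (q ^ 6)"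
    using jacobi_triple_product[OF n(2,3), of "q\<^sup>2"] q by (simp flip: power_mult power_add)
  also have "\<dots> = qpoch_inf (q ^ 5) (q ^ 6) * qpoch_inf q (q ^ 6) * qpoch_inf (q ^ 6) (q ^ 6)"
  proof -
    have "q ^ 6 / q ^ 5 = q" using q by (simp add: power_eq_if)
    thus ?thesis by (simp add: jprod_def)
  qed
  finally have 1: "theta (q ^ 3) (q\<^sup>2) = qpoch_inf (q ^ 5) (q ^ 6) * qpoch_inf q (q ^ 6) * qpoch_inf (q ^ 6) (q ^ 6)" .
  have 2: "qpoch_inf q q = qpoch_inf q (q\<^sup>2) * qpoch_inf (q\<^sup>2) (q\<^sup>2)"
    using qpoch_even_odd[OF q(1), of q] by (simp add: power2_eq_square)
  have 3: "qpoch_inf q (q\<^sup>2) = qpoch_inf q (q ^ 6) * qpoch_inf (q ^ 3) (q ^ 6) * qpoch_inf (q ^ 5) (q ^ 6)"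
    using qpoch_three[OF n(1), of q] by (simp flip: power_mult power_Suc)
  have 4: "qpoch_inf (q ^ 3) (q ^ 3) = qpoch_inf (q ^ 3) (q ^ 6) * qpoch_inf (q ^ 6) (q ^ 6)"
    using qpoch_even_odd[OF n(2), of "q ^ 3"] by (simp flip: power_mult power_add)
  show ?thesis unfolding 1 2 3 4 by (simp add: power2_eq_square mult_ac)
qed

text \<open>A cube root r of q serves as nome, so that the coefficients of 1, r and r^2 are free of
  r, as \<open>sums_trisection\<close> requires. The cofactor of \<open>t9 - 2 * r * Om\<close> in
  the difference of cubes of \<open>theta_fourth_power\<close> replaces the division by
  \<open>theta r 1\<close>.\<close>

lemma rank_gf_trisected:
  assumes q: "norm q < 1" "q \<noteq> 0" and w: "w\<^sup>2 + w + 1 = 0" and r: "r ^ 3 = q"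
  shows "rank_gf r w = (theta (q ^ 3) 1 ^ 2 / theta q 1 - 1)
     + r * (2 * theta (q ^ 3) (q\<^sup>2) * theta (q ^ 3) 1 / theta q 1)
     + r\<^sup>2 * (4 * theta (q ^ 3) (q\<^sup>2) ^ 2 / theta q 1 + 6 * q * appell (q ^ 3) (q ^ 6) (q\<^sup>2) / theta (q ^ 3) 1)"
proof -
  have nr: "norm r < 1" "r \<noteq> 0"
  proof -
    have "norm r ^ 3 < 1" using r q by (simp flip: norm_power)
    thus "norm r < 1" by (simp add: power_less_one_iff)
  qed (use r q in auto)
  have n3: "norm (q ^ 3) < 1" "q ^ 3 \<noteq> 0" using q by (simp_all add: norm_power power_less_one_iff)
  have rp: "r ^ 9 = q ^ 3" "r ^ 6 = q\<^sup>2" "r ^ 18 = q ^ 6" "r ^ 5 = q * r\<^sup>2"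
    unfolding r[symmetric] by (simp_all flip: power_mult power_add)
  define t3 t9 Om A6 th where "t3 = theta q 1" and "t9 = theta (q ^ 3) 1" and "Om = theta (q ^ 3) (q\<^sup>2)"
    and "A6 = appell (q ^ 3) (q ^ 6) (q\<^sup>2)" and "th = theta r 1"
  have nz: "t3 \<noteq> 0" "t9 \<noteq> 0" "th \<noteq> 0"
    unfolding t3_def t9_def th_def
    by (rule theta_nonzero[OF q], rule theta_nonzero[OF n3], rule theta_nonzero[OF nr])
  have F: "(1 + rank_gf r w) * th * t9 = t3 ^ 3 + 6 * (q * r\<^sup>2) * th * A6"
    using rank_gf_cubic[OF nr w] unfolding rp r th_def[symmetric] t3_def[symmetric] t9_def[symmetric] A6_def[symmetric] .
  have th: "th = t9 - 2 * r * Om"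
    using theta_dissection[OF nr] unfolding rp by (simp add: th_def t9_def Om_def)
  have f4: "t3 ^ 4 = t9 * (t9 ^ 3 - 8 * q * Om ^ 3)"
    using theta_fourth_power[OF nr] unfolding rp r t3_def[symmetric] t9_def[symmetric] Om_def[symmetric] .
  have "t9 ^ 3 - 8 * q * Om ^ 3 = th * (t9\<^sup>2 + 2 * r * Om * t9 + 4 * r\<^sup>2 * Om\<^sup>2)"
    unfolding th r[symmetric] by (simp add: algebra_simps power2_eq_square power3_eq_cube)
  hence "t3 ^ 3 * t3 = (t9\<^sup>2 + 2 * r * Om * t9 + 4 * r\<^sup>2 * Om\<^sup>2) * (th * t9)"
    using f4 by (simp add: power_eq_if mult_ac)
  hence "t3 ^ 3 / (th * t9) = (t9\<^sup>2 + 2 * r * Om * t9 + 4 * r\<^sup>2 * Om\<^sup>2) / t3"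
    using nz by (simp add: frac_eq_eq)
  moreover have "1 + rank_gf r w = t3 ^ 3 / (th * t9) + 6 * (q * r\<^sup>2) * A6 / t9"
  proof -
    have "1 + rank_gf r w = ((1 + rank_gf r w) * th * t9) / (th * t9)" using nz by simp
    thus ?thesis unfolding F using nz by (simp add: add_divide_distrib)
  qed
  ultimately have "1 + rank_gf r w = (t9\<^sup>2 + 2 * r * Om * t9 + 4 * r\<^sup>2 * Om\<^sup>2) / t3 + 6 * (q * r\<^sup>2) * A6 / t9" by simp
  hence "rank_gf r w = (t9\<^sup>2 / t3 - 1) + r * (2 * Om * t9 / t3) + r\<^sup>2 * (4 * Om\<^sup>2 / t3 + 6 * q * A6 / t9)"
    by (simp add: add_divide_distrib algebra_simps)
  thus ?thesis by (simp add: t3_def t9_def Om_def A6_def)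
qed

lemma R01_sums_nonzero:
  assumes q: "norm q < 1" "q \<noteq> 0" and d: "d < 3"
  shows "(\<lambda>n. fps_nth (R01 d) n * q ^ n) sums
     [theta (q ^ 3) 1 ^ 2 / theta q 1 - 1, 2 * theta (q ^ 3) (q\<^sup>2) * theta (q ^ 3) 1 / theta q 1,
      4 * theta (q ^ 3) (q\<^sup>2) ^ 2 / theta q 1 + 6 * q * appell (q ^ 3) (q ^ 6) (q\<^sup>2) / theta (q ^ 3) 1] ! d"
proof -
  define w where "w = Complex (- 1 / 2) (sqrt 3 / 2)"
  have w: "w\<^sup>2 + w + 1 = 0"
    by (simp add: w_def complex_eq_iff power2_eq_square)
  \<comment> \<open>The principal branch merely picks one cube root; \<open>sums_trisection\<close>
    runs over all three.\<close>
  define r where "r = exp (Ln q / 3)"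
  have r: "r ^ 3 = q" using q by (simp add: r_def flip: exp_of_nat_mult)
  define U where "U = (!) [theta (q ^ 3) 1 ^ 2 / theta q 1 - 1, 2 * theta (q ^ 3) (q\<^sup>2) * theta (q ^ 3) 1 / theta q 1,
      4 * theta (q ^ 3) (q\<^sup>2) ^ 2 / theta q 1 + 6 * q * appell (q ^ 3) (q ^ 6) (q\<^sup>2) / theta (q ^ 3) 1]"
  have "(\<lambda>n. (of_nat (N2_bar 0 3 (3 * n + d)) - of_nat (N2_bar 1 3 (3 * n + d))) * (r ^ 3) ^ n) sums U d"
  proof (rule sums_trisection[OF w _ _ d, where c = "\<lambda>n. of_nat (N2_bar 0 3 n) - of_nat (N2_bar 1 3 n)"])
    fix x assume "x ^ 3 = r ^ 3"
    hence x: "x ^ 3 = q" using r by simp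
    have nx: "norm x < 1" "x \<noteq> 0"
    proof -
      have "norm x ^ 3 < 1" using x q by (simp flip: norm_power)
      thus "norm x < 1" by (simp add: power_less_one_iff)
    qed (use x q in auto)
    show "(\<lambda>n. (of_nat (N2_bar 0 3 n) - of_nat (N2_bar 1 3 n)) * x ^ n) sums (U 0 + x * U 1 + x\<^sup>2 * U 2)"
      using rank_difference_sums[OF nx w] unfolding rank_gf_trisected[OF q w x] by (simp add: U_def)
  qed (simp add: r_def)
  thus ?thesis by (simp add: R01_def U_def r)
qed

text \<open>Evaluates the constant terms of the three series for the point q = 0. All nonempty
  overpartitions of 1 and 2 have rank 0.\<close>

lemma N2_bar_small:
  "N2_bar s 3 0 = 0" "N2_bar s 3 1 = (if [0 = s] (mod 3) then 2 else 0)" "N2_bar s 3 2 = (if [0 = s] (mod 3) then 4 else 0)"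
proof -
  have P0: "P = {#}" if "0 \<notin># P" "\<Sum>\<^sub># P = 0" for P :: "nat multiset"
    using that by (cases P) auto
  have P1: "P = {#1#}" if P: "0 \<notin># P" "\<Sum>\<^sub># P = 1" for P :: "nat multiset"
  proof (cases P)
    case (add x Q)
    hence "x = 1" "\<Sum>\<^sub># Q = 0" "0 \<notin># Q" using P by (auto simp: add_is_1)
    thus ?thesis using P0[of Q] add by simp
  qed (use P in simp)
  have P2: "P = {#2#} \<or> P = {#1, 1#}" if P: "0 \<notin># P" "\<Sum>\<^sub># P = 2" for P :: "nat multiset"
  proof (cases P)
    case (add x Q)
    hence Q: "x \<noteq> 0" "0 \<notin># Q" "x + \<Sum>\<^sub># Q = 2" using P by auto
    hence "x = 2 \<and> \<Sum>\<^sub># Q = 0 \<or> x = 1 \<and> \<Sum>\<^sub># Q = 1" by linarith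
    thus ?thesis using P0[of Q] P1[of Q] Q add by auto
  qed (use P in simp)
  have sub: "S \<subseteq> {a} \<longleftrightarrow> S = {} \<or> S = {a}" for S and a :: nat by auto
  have o0: "overpartitions_of_size 0 = {}"
  proof -
    have False if "overpartition_of 0 (P, S)" "(P, S) \<noteq> ({#}, {})" for P S
      using that P0[of P] unfolding overpartition_of_def by auto
    thus ?thesis by (auto simp: overpartitions_of_size_def)
  qed
  have o1: "overpartitions_of_size 1 = {({#1#}, {}), ({#1#}, {1})}"
    by (auto simp: overpartitions_of_size_def overpartition_of_def sub dest!: P1)
  have o2: "overpartitions_of_size 2 = {({#2#}, {}), ({#2#}, {2}), ({#1, 1#}, {}), ({#1, 1#}, {1})}"
    by (auto simp: overpartitions_of_size_def overpartition_of_def sub dest!: P2)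
  note defs = M2_rank_def largest_part_def num_parts_def odd_nonoverlined_def chi_def
  have r1: "M2_rank x = 0" if "x \<in> overpartitions_of_size 1" for x
    using that unfolding o1 by (auto simp: defs ceiling_half[of 1, simplified])
  have r2: "M2_rank x = 0" if "x \<in> overpartitions_of_size 2" for x
    using that unfolding o2 by (auto simp: defs ceiling_half[of 1, simplified])
  have N: "N2_bar s 3 n = card {x \<in> overpartitions_of_size n. [M2_rank x = s] (mod 3)}" for n
    unfolding N2_bar_def overpartitions_of_size_def by (rule arg_cong[of _ _ card]) auto
  show "N2_bar s 3 0 = 0" unfolding N o0 by simp
  have "{x \<in> overpartitions_of_size 1. [M2_rank x = s] (mod 3)} = (if [0 = s] (mod 3) then overpartitions_of_size 1 else {})"
    using r1 by auto
  moreover have "card (overpartitions_of_size 1) = 2" unfolding o1 by simp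
  ultimately show "N2_bar s 3 1 = (if [0 = s] (mod 3) then 2 else 0)"
    unfolding N by (simp only: if_distrib[of card] card.empty)
  have "{x \<in> overpartitions_of_size 2. [M2_rank x = s] (mod 3)} = (if [0 = s] (mod 3) then overpartitions_of_size 2 else {})"
    using r2 by auto
  thus "N2_bar s 3 2 = (if [0 = s] (mod 3) then 4 else 0)" unfolding N by (simp add: o2)
qed

lemma qpoch_inf_0 [simp]: "qpoch_inf 0 q = 1"
  by (simp add: qpoch_inf_def)

theorem theorem1p1:
  fixes q :: complex
  assumes "norm q < 1"
  shows "(\<lambda>n. fps_nth (R01 0) n * q ^ n) sums
           (- 1 + qpoch_inf (- q) q * qpoch_inf (q ^ 3) (q ^ 3) ^ 2
                  / (qpoch_inf q q * qpoch_inf (- (q ^ 3)) (q ^ 3) ^ 2))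
    \<and> (\<lambda>n. fps_nth (R01 1) n * q ^ n) sums
           (2 * qpoch_inf (q ^ 3) (q ^ 3) * qpoch_inf (q ^ 6) (q ^ 6) / qpoch_inf q q)
    \<and> (\<lambda>n. fps_nth (R01 2) n * q ^ n) sums
           (4 * qpoch_inf (q ^ 6) (q ^ 6) ^ 4
              / (qpoch_inf (q ^ 2) (q ^ 2) * qpoch_inf (q ^ 3) (q ^ 3) ^ 2)
            + 6 * q * qpoch_inf (- (q ^ 3)) (q ^ 3) / qpoch_inf (q ^ 3) (q ^ 3)
              * (\<Sum>\<^sub>\<infinity>n::int. (- 1) powi n * q powi (3 * n ^ 2 + 6 * n)
                                / (1 - q powi (6 * n + 2))))"
proof (cases "q = 0")
  case True
  \<comment> \<open>At q = 0 the series reduce to their constant terms 0, 2 and 4. The first matches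
    -1 + 1 because the empty overpartition is not counted.\<close>
  have z: "(\<lambda>n. fps_nth (R01 d) n * 0 ^ n) sums (of_nat (N2_bar 0 3 d) - of_nat (N2_bar 1 3 d))" for d
    using powser_sums_zero[of "fps_nth (R01 d)"] by (simp add: R01_def)
  have ncong: "\<not> [0 = 1] (mod (3 :: int))" by (simp add: cong_def)
  show ?thesis
    using z[of 0] z[of 1] z[of 2] ncong unfolding N2_bar_small True by simp
next
  case False
  note q = assms False
  have n: "norm (q\<^sup>2) < 1" "norm (q ^ 3) < 1" "norm (q ^ 6) < 1" "q ^ 3 \<noteq> 0"
    using q by (simp_all add: norm_power power_less_one_iff)
  define E1 E2 E3 E6 m1 m3 where "E1 = qpoch_inf q q" and "E2 = qpoch_inf (q\<^sup>2) (q\<^sup>2)"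
    and "E3 = qpoch_inf (q ^ 3) (q ^ 3)" and "E6 = qpoch_inf (q ^ 6) (q ^ 6)"
    and "m1 = qpoch_inf (- q) q" and "m3 = qpoch_inf (- (q ^ 3)) (q ^ 3)"
  have nz: "E1 \<noteq> 0" "E2 \<noteq> 0" "E3 \<noteq> 0" "E6 \<noteq> 0"
    unfolding E1_def E2_def E3_def E6_def using q n by (simp_all add: qpoch_self_nonzero)
  \<comment> \<open>Since (x; x)(-x; x) = (x^2; x^2), every product becomes a monomial in
    \<open>E1\<close>, \<open>E3\<close>, \<open>m1\<close> and \<open>m3\<close>, and the remaining
    comparisons are algebra.\<close>
  have E2: "E2 = E1 * m1" and E6: "E6 = E3 * m3"
    using qpoch_mult_minus[OF q(1), of q] qpoch_mult_minus[OF n(2), of "q ^ 3"]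
    by (simp_all add: E1_def E2_def E3_def E6_def m1_def m3_def flip: power_mult)
  have nzm: "m1 \<noteq> 0" "m3 \<noteq> 0" using nz E2 E6 by auto
  define S where "S = (\<Sum>\<^sub>\<infinity>n::int. (- 1) powi n * q powi (3 * n ^ 2 + 6 * n) / (1 - q powi (6 * n + 2)))"
  have S: "appell (q ^ 3) (q ^ 6) (q\<^sup>2) = S"
    unfolding appell_def S_def
    by (intro infsum_cong) (simp add: power_int_power power_int_add False mult.commute)
  have t: "theta q 1 = E1 / m1" "theta (q ^ 3) 1 = E3 / m3"
    using theta_product[OF q] theta_product[OF n(2,4)] by (simp_all add: E1_def E3_def m1_def m3_def)
  have Om: "theta (q ^ 3) (q\<^sup>2) = E6\<^sup>2 / (m1 * E3)"
  proof -
    have "theta (q ^ 3) (q\<^sup>2) * (E2 * E3) = E1 * E6\<^sup>2"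
      using theta_quotient_product[OF q] by (simp add: E1_def E2_def E3_def E6_def)
    thus ?thesis unfolding E2 using nz nzm by (simp add: eq_divide_eq mult_ac)
  qed
  have "theta (q ^ 3) 1 ^ 2 / theta q 1 - 1 = - 1 + m1 * E3\<^sup>2 / (E1 * m3\<^sup>2)"
    unfolding t by (simp add: power_divide mult_ac)
  moreover have "2 * theta (q ^ 3) (q\<^sup>2) * theta (q ^ 3) 1 / theta q 1 = 2 * E3 * E6 / E1"
    unfolding t Om E6 using nz nzm by (simp add: power2_eq_square)
  moreover have "4 * theta (q ^ 3) (q\<^sup>2) ^ 2 / theta q 1 + 6 * q * appell (q ^ 3) (q ^ 6) (q\<^sup>2) / theta (q ^ 3) 1
     = 4 * E6 ^ 4 / (E2 * E3\<^sup>2) + 6 * q * m3 / E3 * S"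
    unfolding t Om S E2 using nz nzm by (simp add: power2_eq_square power_eq_if mult_ac)
  ultimately show ?thesis
    using R01_sums_nonzero[OF q, of 0] R01_sums_nonzero[OF q, of 1] R01_sums_nonzero[OF q, of 2]
    by (simp add: S_def[symmetric] E1_def E2_def E3_def E6_def m1_def m3_def)
qed

end
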